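(* Let $0\le r\le 4$ and let $w$ be an integer with $(r+1)w\equiv0\pmod{12}$. Every balanced quasimodular form $f$ of depth $r$ and weight $w$ is a solution of a modular differential equation of the form $$\partial_{w-r}^{r+1}f+a_4E_4\,\partial_{w-r}^{r-1}f+a_6E_6\,\partial_{w-r}^{r-2}f+\cdots+a_{2r+2}E_{2r+2}f=0,$$ i.e. $\partial_{w-r}^{r+1}f+\sum_{\ell=2}^{r+1}a_{2\ell}E_{2\ell}\,\partial_{w-r}^{r+1-\ell}f=0$, with $a_4,a_6,\ldots,a_{2r+2}\in\mathbb{Q}$.
   Context: $\mathcal{M}_k$ denotes the space of holomorphic modular forms of weight $k$ for $\mathrm{PSL}(2,\mathbb{Z})$ (holomorphic also at $i\infty$); $q=e^{2\pi iz}$; $E_{2k}=1-\frac{4k}{B_{2k}}\sum_{n\ge1}\sigma_{2k-1}(n)q^n$ are the Eisenstein series ($k\ge1$). $f'=\frac1{2\pi i}\frac{df}{dz}$; the Serre derivative is $\partial_k f=f'-\frac{k}{12}E_2f$, iterated as $\partial_k^0f=f$, $\partial_k^{j+1}f=\partial_{k+2j}(\partial_k^jf)$. Quasimodular forms of weight $w$ and depth $\le r$ are the elements of $\mathcal{QM}_w^r=\bigoplus_{\ell=0}^rE_2^\ell\mathcal{M}_{w-2\ell}$. If $f=\sum_{\ell=0}^rE_2^\ell h_\ell$ with $h_\ell\in\mathcal{M}_{w-2\ell}$ has depth $r$ (i.e. $h_r\ne0$), define quasimodular forms $g_\ell$ of weight $w-2\ell$ and depth $\le r-\ell$ by $\binom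 r\ell g_\ell=\left(\frac{6}{\pi i}\right)^\ell\sum_{m=0}^{r-\ell}\binom{\ell+m}{m}E_2^mh_{\ell+m}$ ($0\le\ell\le r$); thus $g_0=f$ and $z^{-w}f(-1/z)=\sum_{\ell=0}^r\binom r\ell z^{-\ell}g_\ell(z)$. The form $f$ (of weight $w$, depth $r$) is called balanced if there are non-negative integers $\lambda_0\ge\lambda_1\ge\cdots\ge\lambda_r$ with $\lambda_\ell<\dim\mathcal{QM}_{w-2\ell}^{r-\ell}$ for all $\ell$, such that $g_\ell=q^{\lambda_\ell}\sum_{n\ge0}a_\ell(n)q^n$ with $a_\ell(0)\neq0$ for $\ell=0,\dots,r$, and $\lambda_0+\cdots+\lambda_r=\dim\mathcal{QM}_w^r-1$. *)

theory Defs
  imports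
    "HOL-Complex_Analysis.Complex_Analysis"
    "HOL-Library.Function_Algebras"
    "HOL-Number_Theory.Cong"
begin

definition upper_half :: "complex set" where
  "upper_half = {z. Im z > 0}"

definition qpar :: "complex \<Rightarrow> complex" where
  "qpar z = exp (2 * of_real pi * \<i> * z)"

text \<open>
  Functions on the upper half-plane are represented by functions on the complex plane.  Members
  of the spaces below vanish off the upper half-plane, so that each function on the half-plane has
  a unique representative and dimensions are not inflated by values outside of it.
  Negative weights are allowed, since weights such as $w - 2\ell$ may be negative.
\<close>

definition modular_forms :: "int \<Rightarrow> (complex \<Rightarrow> complex) set" where
  "modular_forms k = {f.
     f holomorphic_on upper_half \<and>
     (\<forall>a b c d :: int. a * d - b * c = 1 \<longrightarrow>
        (\<forall>z \<in> upper_half.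
           f ((of_int a * z + of_int b) / (of_int c * z + of_int d)) =
             (of_int c * z + of_int d) powi k * f z)) \<and>
     (\<exists>a :: nat \<Rightarrow> complex. \<forall>z \<in> upper_half. (\<lambda>n. a n * qpar z ^ n) sums f z) \<and>
     (\<forall>z. z \<notin> upper_half \<longrightarrow> f z = 0)}"

text \<open>
  The recursion is $\sum_{k=0}^{n+1} \binom{n+2}{k} B_k = 0$, solved for $B_{n+1}$; it gives
  $B_1 = -1/2$.
\<close>

fun bernoulli :: "nat \<Rightarrow> real" where
  "bernoulli 0 = 1"
| "bernoulli (Suc n) = - (\<Sum>k\<le>n. of_nat ((n + 2) choose k) * bernoulli k) / (of_nat n + 2)"

definition divisor_sigma :: "nat \<Rightarrow> nat \<Rightarrow> nat" where
  "divisor_sigma k n = (\<Sum>d | d dvd n. d ^ k)"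

text \<open>
  The index is the (even, positive) weight: at $m = 2k$ the factor is
  $2m / B_m = 4k / B_{2k}$.
\<close>

definition eisenstein :: "nat \<Rightarrow> complex \<Rightarrow> complex" where
  "eisenstein m z =
     1 - of_real (2 * of_nat m / bernoulli m) *
         (\<Sum>n. of_nat (divisor_sigma (m - 1) (Suc n)) * qpar z ^ Suc n)"

definition serre_deriv :: "int \<Rightarrow> (complex \<Rightarrow> complex) \<Rightarrow> complex \<Rightarrow> complex" where
  "serre_deriv k f z =
     deriv f z / (2 * of_real pi * \<i>) - of_int k / 12 * eisenstein 2 z * f z"

primrec serre_iter :: "int \<Rightarrow> nat \<Rightarrow> (complex \<Rightarrow> complex) \<Rightarrow> complex \<Rightarrow> complex" where
  "serre_iter k 0 f = f"
| "serre_iter k (Suc j) f = serre_deriv (k + 2 * int j) (serre_iter k j f)"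

text \<open>
  \<open>E2_decomposition w r h f\<close>: the functions \<open>h l\<close> (\<open>l \<le> r\<close>) are the coefficients of \<open>f\<close> as a
  polynomial in $E_2$ over modular forms.
\<close>

definition E2_decomposition ::
    "int \<Rightarrow> nat \<Rightarrow> (nat \<Rightarrow> complex \<Rightarrow> complex) \<Rightarrow> (complex \<Rightarrow> complex) \<Rightarrow> bool" where
  "E2_decomposition w r h f \<longleftrightarrow>
     (\<forall>l\<le>r. h l \<in> modular_forms (w - 2 * int l)) \<and>
     f = (\<lambda>z. \<Sum>l\<le>r. eisenstein 2 z ^ l * h l z)"

definition quasimodular_forms :: "int \<Rightarrow> nat \<Rightarrow> (complex \<Rightarrow> complex) set" where
  "quasimodular_forms w r = {f. \<exists>h. E2_decomposition w r h f}"

global_interpretation cfun: vector_space "\<lambda>(c :: complex) (f :: complex \<Rightarrow> complex) z. c * f z"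
  by unfold_locales (auto simp: fun_eq_iff algebra_simps)

definition companion ::
    "nat \<Rightarrow> (nat \<Rightarrow> complex \<Rightarrow> complex) \<Rightarrow> nat \<Rightarrow> complex \<Rightarrow> complex" where
  "companion r h l z =
     (6 / (of_real pi * \<i>)) ^ l *
     (\<Sum>m\<le>r - l. of_nat ((l + m) choose m) * eisenstein 2 z ^ m * h (l + m) z) /
     of_nat (r choose l)"

definition balanced :: "int \<Rightarrow> nat \<Rightarrow> (complex \<Rightarrow> complex) \<Rightarrow> bool" where
  "balanced w r f \<longleftrightarrow>
     (\<exists>h. E2_decomposition w r h f \<and> h r \<noteq> 0 \<and>
       (\<exists>lam :: nat \<Rightarrow> nat.
          (\<forall>l<r. lam (Suc l) \<le> lam l) \<and>
          (\<forall>l\<le>r. lam l < cfun.dim (quasimodular_forms (w - 2 * int l) (r - l))) \<and>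
          (\<forall>l\<le>r. \<exists>a :: nat \<Rightarrow> complex. a 0 \<noteq> 0 \<and>
             (\<forall>z \<in> upper_half. (\<lambda>n. a n * qpar z ^ (lam l + n)) sums companion r h l z)) \<and>
          (\<Sum>l\<le>r. lam l) + 1 = cfun.dim (quasimodular_forms w r)))"

end

theory Submission
  imports Defs "Jordan_Normal_Form.Determinant"
begin

text \<open>
  Let \<open>B l\<close> (\<open>l \<le> r\<close>) be the companions of \<open>f\<close>, rescaled so that \<open>\<Sum>l. B l z * (z - t) ^ (r - l)\<close>, as a family of
  functions of \<open>z\<close> with a parameter \<open>t\<close>, transforms like a form of weight \<open>k = w - r\<close>.  The Serre derivative
  of the family raises the weight by 2, and the determinant formed by the first \<open>r\<close> derivatives is a
  modular form of weight \<open>(r + 1) * (k + r)\<close> that vanishes at the cusp to the order \<open>\<Sum>l. lam l\<close> at least,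
  where \<open>lam l\<close> bounds the order of \<open>B l\<close> from below.  If this exceeds a twelfth of the weight, then the
  determinant vanishes, the functions in the family are linearly dependent, and hence \<open>B 0 = 0\<close>.

  Applied to \<open>f\<close>, and combined with a lower bound for the dimension of the space of quasimodular forms,
  this gives \<open>\<Sum>l. lam l = (r + 1) * w / 12\<close>.  Therefore there are rational numbers \<open>a\<^sub>4, a\<^sub>6, \<dots>\<close> such that the
  indicial polynomial of the operator \<open>L\<close> in the theorem is \<open>\<Prod>l. (x - lam l)\<close>.  Then every component of the
  family \<open>L B\<close> has order at least \<open>lam l + 1\<close>, and as its weight is \<open>k + 2 * r + 2\<close> and \<open>r < 5\<close>, the vanishing
  criterion applies to \<open>L B\<close> and yields \<open>L f = 0\<close>.
\<close>

text \<open>There is no modular form of weight 2, so the equation has no term of order r, and this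
  forces the exponents of the operator at the cusp to add up to (r + 1) w / 12, the sum of the
  shifts (w - r + 2 j) / 12 for j <= r. Hence the total order must be known exactly. Exponents and
  shifts are rational, and so are the coefficients of the equation; the arithmetic of the expansion
  of \<open>f\<close> does not enter. Consecutive exponents may coincide, and then the leading terms
  of the companions are coupled, so that the operator cannot be studied component by component. The
  bound r <= 4 acts in three places: in the dimension count, in the Eisenstein series that occur
  (weights up to 10, where no cusp forms exist), and in the final vanishing, as 2 r + 2 < 12. The
  Eisenstein series are given as q-series with Bernoulli constants, so their inversion laws must be
  derived, by summing over a lattice by rows and by columns. In weight 2 the two orders of summation
  disagree; the discrepancy is the anomaly of E_2, on which the Serre derivative, the discriminant
  and the companions depend.\<close>

abbreviation two_pi_i :: complex ("\<tau>") where
  "\<tau> \<equiv> 2 * of_real pi * \<i>"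

section \<open>The upper half-plane and the variable q\<close>

lemma upper_half_iff [simp]: "z \<in> upper_half \<longleftrightarrow> Im z > 0"
  by (simp add: upper_half_def)

lemma open_upper_half [simp, intro]: "open upper_half"
  unfolding upper_half_def by (rule open_halfspace_Im_gt)

lemma convex_upper_half: "convex upper_half"
  unfolding upper_half_def by (rule convex_halfspace_Im_gt)

lemma Im_minus_inverse: "Im (-1 / z) = Im z / (norm z)\<^sup>2"
  by (cases "z = 0") (auto simp: Im_divide cmod_power2 divide_simps)

lemma Im_minus_inverse_pos [simp]: "Im z > 0 \<Longrightarrow> Im (-1 / z) > 0"
  by (subst Im_minus_inverse) (auto intro!: divide_pos_pos)

lemma norm_qpar: "norm (qpar z) = exp (-2 * pi * Im z)"
  by (simp add: qpar_def norm_exp_eq_Re)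

lemma norm_qpar_less_1 [simp]: "Im z > 0 \<Longrightarrow> norm (qpar z) < 1"
  by (simp add: norm_qpar)

lemma qpar_nonzero [simp]: "qpar z \<noteq> 0"
  by (simp add: qpar_def)

lemma qpar_mult_nat: "qpar (of_nat m * z) = qpar z ^ m"
  by (simp add: qpar_def exp_of_nat_mult [symmetric] mult_ac)

lemma qpar_plus_of_int [simp]: "qpar (z + of_int n) = qpar z"
proof -
  have "exp (\<tau> * of_int n) = (1 :: complex)"
    by (auto simp: exp_eq_1)
  thus ?thesis by (simp add: qpar_def ring_distribs exp_add)
qed

lemma qpar_plus_of_nat [simp]: "qpar (z + of_nat n) = qpar z"
  using qpar_plus_of_int[of z "int n"] by simp

lemma has_field_derivative_qpar [derivative_intros]:
  assumes "(f has_field_derivative f') (at z within A)"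
  shows "((\<lambda>x. qpar (f x)) has_field_derivative \<tau> * qpar (f z) * f') (at z within A)"
  unfolding qpar_def by (rule derivative_eq_intros assms refl)+ simp

lemma holomorphic_on_qpar [holomorphic_intros]:
  "f holomorphic_on A \<Longrightarrow> (\<lambda>z. qpar (f z)) holomorphic_on A"
  unfolding qpar_def by (intro holomorphic_intros)

lemma holomorphic_compose_qpar:
  assumes "g holomorphic_on ball 0 1"
  shows "(\<lambda>z. g (qpar z)) holomorphic_on upper_half"
  by (rule holomorphic_on_compose_gen[OF _ assms, unfolded o_def]) (auto intro!: holomorphic_intros)

lemma qpar_surj:
  assumes "q \<noteq> 0" "norm q < 1"
  obtains z where "Im z > 0" "qpar z = q"
proof -
  define z where "z = Ln q / (\<tau>)"
  have "qpar z = q"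
    using assms by (simp add: qpar_def z_def)
  moreover have "Im z > 0"
  proof -
    have "exp (-2 * pi * Im z) < exp 0"
      using \<open>qpar z = q\<close> assms by (metis norm_qpar exp_zero)
    thus ?thesis by (simp add: zero_less_mult_iff)
  qed
  ultimately show ?thesis using that by blast
qed

subsection \<open>The Lipschitz formula\<close>

text \<open>This is the logarithmic derivative of Gamma(z) Gamma(1 - z) = pi / sin(pi z): both sides
  are differentiated and the common factor is cancelled.\<close>

lemma Digamma_reflection:
  fixes z :: complex
  assumes "z \<notin> \<int>"
  shows "Digamma (1 - z) - Digamma z = of_real pi * cot (of_real pi * z)"
proof -
  have nz: "z \<notin> \<int>\<^sub>\<le>\<^sub>0" "1 - z \<notin> \<int>\<^sub>\<le>\<^sub>0"
    using assms nonpos_Ints_Int Ints_diff[OF Ints_1, of "1 - z"] by auto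
  have "open (- \<int> :: complex set)"
    by (simp add: closed_Ints open_Compl)
  have sin: "sin (of_real pi * z) \<noteq> 0"
    using assms by (auto simp: sin_eq_0)
    let ?D = "(of_real pi * of_real pi * cos (of_real pi * z) / sin (of_real pi * z) ^ 2)"
  have "((\<lambda>z. Gamma z * Gamma (1 - z)) has_field_derivative
          Gamma z * Gamma (1 - z) * (Digamma z - Digamma (1 - z))) (at z)"
    using nz by (auto intro!: derivative_eq_intros simp: algebra_simps)
  moreover have "((\<lambda>z. of_real pi / sin (of_real pi * z)) has_field_derivative
      - ?D) (at z)"
    using sin by (auto intro!: derivative_eq_intros simp: power2_eq_square)
  ultimately have "Gamma z * Gamma (1 - z) * (Digamma z - Digamma (1 - z)) =
      - ?D"
    unfolding Gamma_reflection_complex by (rule DERIV_unique)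
  hence *: "(of_real pi / sin (of_real pi * z)) * (Digamma z - Digamma (1 - z)) =
      - ?D"
    unfolding Gamma_reflection_complex .
  have "(of_real pi / sin (of_real pi * z)) * (Digamma (1 - z) - Digamma z) =
         - ((of_real pi / sin (of_real pi * z)) * (Digamma z - Digamma (1 - z)))"
    by (subst mult_minus_right [symmetric]) simp
  also have "\<dots> = (of_real pi / sin (of_real pi * z)) * (of_real pi * cot (of_real pi * z))"
    unfolding * by (simp add: cot_def power2_eq_square)
  finally have "(of_real pi / sin (of_real pi * z)) * (Digamma (1 - z) - Digamma z) =
         (of_real pi / sin (of_real pi * z)) * (of_real pi * cot (of_real pi * z))" .
  thus ?thesis using sin by simp
qed

lemma pi_cot_qpar:
  assumes "Im z > 0"
  shows "of_real pi * cot (of_real pi * z) = of_real pi * \<i> - \<tau> / (1 - qpar z)"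
proof -
  define w where "w = exp (\<i> * (of_real pi * z))"
  have [simp]: "w \<noteq> 0" by (simp add: w_def)
  have w2: "qpar z = w ^ 2"
    by (simp add: w_def qpar_def exp_double [symmetric] mult_ac)
  have "w ^ 2 \<noteq> 1"
    using norm_qpar_less_1[OF assms] unfolding w2 by (metis norm_one less_irrefl)
  hence ne: "1 - w ^ 2 \<noteq> 0" "w ^ 2 - 1 \<noteq> 0" by auto
  have e: "exp (- (\<i> * (of_real pi * z))) = 1 / w"
    by (simp add: w_def exp_minus field_simps)
  have c: "cos (of_real pi * z) = (w ^ 2 + 1) / (2 * w)"
    unfolding cos_exp_eq e w_def[symmetric] by (simp add: field_simps power2_eq_square)
  have s: "sin (of_real pi * z) = (w ^ 2 - 1) / (2 * \<i> * w)"
    unfolding sin_exp_eq e w_def[symmetric] by (simp add: field_simps power2_eq_square)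
  have *: "(u + 1) / (u - 1) = 1 - 2 / (1 - u)" if "u \<noteq> 1" for u :: complex
    using that by (simp add: divide_simps) (simp add: algebra_simps)
  have "cot (of_real pi * z) = \<i> * ((w ^ 2 + 1) / (w ^ 2 - 1))"
    unfolding cot_def c s by simp
  also have "\<dots> = \<i> * (1 - 2 / (1 - w ^ 2))"
    using \<open>w ^ 2 \<noteq> 1\<close> by (subst *) auto
  finally show ?thesis
    by (simp add: w2 ring_distribs)
qed

text \<open>The polylogarithm of order -j, with a term n = 0 added; that term is 1 for j = 0, as 0 ^
  0 = 1, and 0 otherwise.\<close>

definition power_moment :: "nat \<Rightarrow> complex \<Rightarrow> complex" where
  "power_moment j q = (\<Sum>n. of_nat n ^ j * q ^ n)"

lemma summable_power_moment:
  fixes q :: "'a :: {real_normed_field, banach}"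
  assumes "norm q < 1"
  shows "summable (\<lambda>n. norm (of_nat n ^ j * q ^ n))"
proof -
  obtain K where K: "norm q < K" "K < 1" using assms dense by blast
  have "(\<lambda>n. (real (Suc n) / real n) ^ j * norm q) \<longlonglongrightarrow> 1 ^ j * norm q"
    by (intro tendsto_intros LIMSEQ_Suc_n_over_n)
  hence "eventually (\<lambda>n. (real (Suc n) / real n) ^ j * norm q < K) sequentially"
    using K by (auto dest: order_tendstoD)
  then obtain N where N: "\<And>n. n \<ge> N \<Longrightarrow> (real (Suc n) / real n) ^ j * norm q < K"
    unfolding eventually_sequentially by blast
  show ?thesis
  proof (rule summable_ratio_test[OF K(2)])
    fix n assume n: "n \<ge> max N 1"
    have "norm (norm (of_nat (Suc n) ^ j * q ^ Suc n)) =
       (real (Suc n) / real n) ^ j * norm q * norm (norm (of_nat n ^ j * q ^ n))"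
      using n by (simp add: norm_mult norm_power power_divide field_simps del: of_nat_Suc)
    also have "\<dots> \<le> K * norm (norm (of_nat n ^ j * q ^ n))"
      using N[of n] n by (intro mult_right_mono) auto
    finally show "norm (norm (of_nat (Suc n) ^ j * q ^ Suc n)) \<le> K * norm (norm (of_nat n ^ j * q ^ n))" .
  qed
qed

lemma summable_power_moment': "norm (q :: complex) < 1 \<Longrightarrow> summable (\<lambda>n. of_nat n ^ j * q ^ n)"
  by (rule summable_norm_cancel[OF summable_power_moment])

lemma power_moment_0: "norm q < 1 \<Longrightarrow> power_moment 0 q = 1 / (1 - q)"
  by (simp add: power_moment_def suminf_geometric)

lemma power_series_disc:
  fixes a :: "nat \<Rightarrow> complex"
  assumes "\<And>q. norm q < 1 \<Longrightarrow> summable (\<lambda>n. a n * q ^ n)" and q: "norm q < 1"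
  shows "((\<lambda>q. \<Sum>n. a n * q ^ n) has_field_derivative (\<Sum>n. diffs a n * q ^ n)) (at q)"
    and "summable (\<lambda>n. diffs a n * q ^ n)"
    and "q * (\<Sum>n. diffs a n * q ^ n) = (\<Sum>n. of_nat n * a n * q ^ n)"
proof -
  obtain K where K: "norm q < K" "K < 1" using q dense by blast
  have K0: "K > 0" using K by (meson norm_ge_zero le_less_trans)
  show 1: "((\<lambda>q. \<Sum>n. a n * q ^ n) has_field_derivative (\<Sum>n. diffs a n * q ^ n)) (at q)"
    using assms K K0 by (intro termdiffs_strong[where K = "of_real K"]) auto
  show 2: "summable (\<lambda>n. diffs a n * q ^ n)"
    using assms K K0 by (intro termdiff_converges[where K = K]) auto
  have "(\<lambda>n. q * (diffs a n * q ^ n)) sums (q * (\<Sum>n. diffs a n * q ^ n))"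
    by (intro sums_mult summable_sums 2)
  hence "(\<lambda>n. of_nat (Suc n) * a (Suc n) * q ^ Suc n) sums (q * (\<Sum>n. diffs a n * q ^ n))"
    by (simp add: diffs_def mult_ac)
  hence "(\<lambda>n. of_nat n * a n * q ^ n) sums (q * (\<Sum>n. diffs a n * q ^ n))"
    by (subst (asm) sums_Suc_iff) simp
  thus "q * (\<Sum>n. diffs a n * q ^ n) = (\<Sum>n. of_nat n * a n * q ^ n)"
    by (simp add: sums_iff)
qed

lemma has_field_derivative_power_moment_qpar:
  assumes "Im z > 0"
  shows "((\<lambda>z. power_moment j (qpar z)) has_field_derivative
           \<tau> * power_moment (Suc j) (qpar z)) (at z)"
proof -
  have ps: "((\<lambda>q. \<Sum>n. of_nat n ^ j * q ^ n) has_field_derivative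
        (\<Sum>n. diffs (\<lambda>n. of_nat n ^ j) n * qpar z ^ n)) (at (qpar z))"
      "qpar z * (\<Sum>n. diffs (\<lambda>n. of_nat n ^ j) n * qpar z ^ n) =
        (\<Sum>n. of_nat n * of_nat n ^ j * qpar z ^ n)"
    using assms by (auto intro!: power_series_disc summable_power_moment')
  have "((\<lambda>z. power_moment j (qpar z)) has_field_derivative
      (\<Sum>n. diffs (\<lambda>n. of_nat n ^ j) n * qpar z ^ n) * (\<tau> * qpar z * 1)) (at z)"
    unfolding power_moment_def
    by (rule DERIV_chain2[where g = qpar, OF _ has_field_derivative_qpar[OF DERIV_ident]]) (rule ps(1))
  also have "(\<Sum>n. diffs (\<lambda>n. of_nat n ^ j) n * qpar z ^ n) * (\<tau> * qpar z * 1) =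
      \<tau> * power_moment (Suc j) (qpar z)"
    using ps(2) by (simp add: power_moment_def mult_ac)
  finally show ?thesis .
qed

lemma Im_pos_not_Int: "Im z \<noteq> 0 \<Longrightarrow> z \<notin> \<int>"
  by (auto elim!: Ints_cases)

text \<open>The case j = 0 is the q-expansion of pi cot(pi z). Each derivative in z multiplies q^n
  by \<open>\<tau>\<close> n and removes the constant, which is therefore present for j = 0
  only.\<close>

lemma Polygamma_reflection_qpar:
  assumes "Im z > 0"
  shows "(-1) ^ j * Polygamma j (1 - z) - Polygamma j z =
     (if j = 0 then of_real pi * \<i> else 0) - (\<tau>) ^ Suc j * power_moment j (qpar z)"
  using assms
proof (induction j arbitrary: z)
  case 0
  thus ?case
    using pi_cot_qpar[of z] Digamma_reflection[of z] by (simp add: power_moment_0 Im_pos_not_Int)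
next
  case (Suc j)
  have nz: "z \<notin> \<int>\<^sub>\<le>\<^sub>0" "1 - z \<notin> \<int>\<^sub>\<le>\<^sub>0"
    using Suc.prems by (auto elim!: nonpos_Ints_cases simp: complex_eq_iff)
  have "((\<lambda>z. (-1) ^ j * Polygamma j (1 - z) - Polygamma j z) has_field_derivative
          (-1) ^ Suc j * Polygamma (Suc j) (1 - z) - Polygamma (Suc j) z) (at z)"
    using nz by (auto intro!: derivative_eq_intros)
  moreover have "((\<lambda>z. (if j = 0 then of_real pi * \<i> else 0) -
        (\<tau>) ^ Suc j * power_moment j (qpar z)) has_field_derivative
          0 - (\<tau>) ^ Suc j * (\<tau> * power_moment (Suc j) (qpar z))) (at z)"
    by (intro derivative_intros DERIV_cmult has_field_derivative_power_moment_qpar Suc.prems)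
  hence "((\<lambda>z. (-1) ^ j * Polygamma j (1 - z) - Polygamma j z) has_field_derivative
          0 - (\<tau>) ^ Suc j * (\<tau> * power_moment (Suc j) (qpar z))) (at z)"
    by (rule has_field_derivative_transform_within_open[of _ _ _ upper_half])
       (use Suc.prems Suc.IH in auto)
  ultimately have "(-1) ^ Suc j * Polygamma (Suc j) (1 - z) - Polygamma (Suc j) z =
     0 - (\<tau>) ^ Suc j * (\<tau> * power_moment (Suc j) (qpar z))"
    by (rule DERIV_unique)
  thus ?case by (simp add: mult_ac)
qed

lemma has_sum_int_split:
  fixes f :: "int \<Rightarrow> 'a :: {comm_monoid_add, topological_comm_monoid_add}"
  assumes "((\<lambda>n::nat. f (int n)) has_sum A) UNIV" "((\<lambda>n::nat. f (- int n - 1)) has_sum B) UNIV"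
  shows "(f has_sum (A + B)) UNIV"
proof -
  have "(f has_sum A) (range int)"
    using assms(1) by (subst has_sum_reindex) (auto simp: o_def)
  moreover have "(f has_sum B) (range (\<lambda>n. - int n - 1))"
    using assms(2) by (subst has_sum_reindex) (auto simp: o_def inj_on_def)
  moreover have "range int \<inter> range (\<lambda>n. - int n - 1) = {}"
    by auto
  ultimately have "(f has_sum (A + B)) (range int \<union> range (\<lambda>n. - int n - 1))"
    by (rule has_sum_Un_disjoint)
  moreover have "range int \<union> range (\<lambda>n. - int n - 1) = UNIV"
  proof -
    have "x \<in> range int \<union> range (\<lambda>n. - int n - 1)" for x :: int
    proof (cases "x \<ge> 0")
      case True
      hence "x = int (nat x)" by simp
      thus ?thesis by blast
    next
      case False
      hence "x = - int (nat (-x-1)) - 1" by simp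
      thus ?thesis by blast
    qed
    thus ?thesis by auto
  qed
  ultimately show ?thesis by simp
qed

lemma Polygamma_has_sum:
  fixes z :: complex
  assumes "z \<notin> \<int>\<^sub>\<le>\<^sub>0" "j > 0"
  shows "((\<lambda>k. 1 / (z + of_nat k) ^ Suc j) has_sum ((-1) ^ Suc j * Polygamma j z / fact j)) UNIV"
proof (rule norm_summable_imp_has_sum)
  have nz: "z \<noteq> 0" using assms by auto
  show "summable (\<lambda>k. norm (1 / (z + of_nat k) ^ Suc j))"
  proof (rule summable_comparison_test_ev)
    show "summable (\<lambda>k. 2 ^ Suc j * inverse (real k ^ Suc j))"
      using assms by (intro summable_mult inverse_power_summable) auto
    have "eventually (\<lambda>k. real k > 2 * norm z) sequentially"
      using filterlim_real_sequentially unfolding filterlim_at_top_dense by blast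
    thus "eventually (\<lambda>k. norm (norm (1 / (z + of_nat k) ^ Suc j)) \<le> 2 ^ Suc j * inverse (real k ^ Suc j)) sequentially"
    proof eventually_elim
      case (elim k)
      have "real k / 2 \<le> real k - norm z"
        using elim by simp
      also have "\<dots> \<le> norm (z + of_nat k)"
        using norm_diff_ineq[of "of_nat k" z] by (simp add: add.commute)
      finally have le: "real k / 2 \<le> norm (z + of_nat k)" .
      have k: "real k > 0" using elim by (meson norm_ge_zero less_le_trans le_less_trans mult_nonneg_nonneg zero_le_numeral)
      hence "(real k / 2) ^ Suc j \<le> norm (z + of_nat k) ^ Suc j"
        using le by (intro power_mono) auto
      hence "1 / norm (z + of_nat k) ^ Suc j \<le> 1 / (real k / 2) ^ Suc j"
        using k le by (intro divide_left_mono mult_pos_pos zero_less_power) auto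
      also have "\<dots> = 2 ^ Suc j * inverse (real k ^ Suc j)"
        by (simp only: power_divide divide_divide_eq_right) (simp only: divide_inverse mult_1)
      finally show ?case
        by (simp only: norm_divide norm_power norm_one real_norm_def abs_divide abs_one power_abs abs_norm_cancel)
    qed
  qed
  have "summable (\<lambda>k. inverse ((z + of_nat k) ^ Suc j))"
    using Polygamma_converges'[OF nz, of "Suc j"] assms by simp
  hence "(\<lambda>k. inverse ((z + of_nat k) ^ Suc j)) sums ((-1) ^ Suc j * Polygamma j z / fact j)"
    using assms by (simp add: sums_iff Polygamma_def power_mult_distrib [symmetric])
  thus "(\<lambda>k. 1 / (z + of_nat k) ^ Suc j) sums ((-1) ^ Suc j * Polygamma j z / fact j)"
    by (simp add: field_simps)
qed

text \<open>The terms n >= 0 sum to a Polygamma value at z, the terms n < 0 to one at 1 - z. For odd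
  j the exponent is even, so both halves enter with the same sign and the reflection formula
  evaluates their sum.\<close>

lemma lipschitz_formula:
  assumes "Im z > 0" "odd j"
  shows "((\<lambda>n::int. 1 / (z + of_int n) ^ Suc j) has_sum
     ((\<tau>) ^ Suc j / fact j * power_moment j (qpar z))) UNIV"
proof -
  have nz: "z \<notin> \<int>\<^sub>\<le>\<^sub>0" "1 - z \<notin> \<int>\<^sub>\<le>\<^sub>0"
    using assms by (auto elim!: nonpos_Ints_cases simp: complex_eq_iff)
  have j: "j > 0" using assms by (auto intro: Nat.gr0I)
  have 1: "((\<lambda>n. 1 / (z + of_int (int n)) ^ Suc j) has_sum (Polygamma j z / fact j)) UNIV"
    using Polygamma_has_sum[OF nz(1) j] assms by simp
  have eq: "1 / (1 - z + of_nat n) ^ Suc j = 1 / (z + of_int (- int n - 1)) ^ Suc j" for n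
  proof -
    have "(1 - z + of_nat n) ^ Suc j = (-(1 - z + of_nat n)) ^ Suc j"
      using assms by (subst power_minus_even) auto
    thus ?thesis by (simp add: algebra_simps)
  qed
  have 2: "((\<lambda>n. 1 / (z + of_int (- int n - 1)) ^ Suc j) has_sum (Polygamma j (1 - z) / fact j)) UNIV"
    using Polygamma_has_sum[OF nz(2) j] assms unfolding eq by simp
  have "Polygamma j (1 - z) + Polygamma j z = (\<tau>) ^ Suc j * power_moment j (qpar z)"
    using Polygamma_reflection_qpar[OF assms(1), of j] assms j by (simp add: algebra_simps)
  hence "Polygamma j z / fact j + Polygamma j (1 - z) / fact j =
      (\<tau>) ^ Suc j / fact j * power_moment j (qpar z)"
    by (simp add: add_divide_distrib [symmetric] add.commute)
  with has_sum_int_split[OF 1 2] show ?thesis by simp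
qed

subsection \<open>Lambert series\<close>

definition sigma_series :: "nat \<Rightarrow> complex \<Rightarrow> complex" where
  "sigma_series j q = (\<Sum>n. of_nat (divisor_sigma j (Suc n)) * q ^ Suc n)"

lemma divisor_sigma_le: "n > 0 \<Longrightarrow> divisor_sigma j n \<le> n ^ Suc j"
proof -
  assume n: "n > 0"
  have "divisor_sigma j n \<le> (\<Sum>d\<in>{1..n}. n ^ j)"
    unfolding divisor_sigma_def using n
    by (intro order_trans[OF sum_mono sum_mono2] power_mono) (auto dest: dvd_imp_le intro: Nat.gr0I)
  thus ?thesis by simp
qed

lemma summable_divisor_sigma:
  fixes q :: "'a :: {real_normed_field, banach}"
  assumes "norm q < 1"
  shows "summable (\<lambda>n. norm (of_nat (divisor_sigma j n) * q ^ n))"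
proof (rule summable_comparison_test_ev)
  show "summable (\<lambda>n. norm (of_nat n ^ Suc j * q ^ n))"
    by (rule summable_power_moment[OF assms])
  show "eventually (\<lambda>n. norm (norm (of_nat (divisor_sigma j n) * q ^ n)) \<le> norm (of_nat n ^ Suc j * q ^ n)) sequentially"
    using eventually_gt_at_top[of 0]
  proof eventually_elim
    case (elim n)
    have "real (divisor_sigma j n) \<le> real (n ^ Suc j)"
      using divisor_sigma_le[OF elim] by (rule of_nat_mono)
    thus ?case by (auto simp: norm_mult norm_power intro!: mult_right_mono)
  qed
qed

lemma power_moment_has_sum:
  assumes "norm q < 1" "j > 0"
  shows "((\<lambda>d. of_nat d ^ j * q ^ d) has_sum power_moment j q) {1..}"
proof -
  have "((\<lambda>d. of_nat d ^ j * q ^ d) has_sum power_moment j q) UNIV"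
    unfolding power_moment_def
    by (intro norm_summable_imp_has_sum summable_power_moment summable_sums summable_power_moment' assms)
  thus ?thesis
    by (rule has_sum_cong_neutral[THEN iffD1, rotated -1]) (use assms in auto)
qed

lemma sigma_series_has_sum:
  assumes "norm q < 1"
  shows "((\<lambda>n. of_nat (divisor_sigma j n) * q ^ n) has_sum sigma_series j q) {1..}"
proof -
  have sm: "summable (\<lambda>n. norm (of_nat (divisor_sigma j (Suc n)) * q ^ Suc n))"
    using summable_divisor_sigma[OF assms, of j] by (subst summable_Suc_iff)
  have "((\<lambda>n. of_nat (divisor_sigma j (Suc n)) * q ^ Suc n) has_sum sigma_series j q) UNIV"
    unfolding sigma_series_def
    by (intro norm_summable_imp_has_sum sm summable_sums summable_norm_cancel[OF sm])
  also have "?this \<longleftrightarrow> ?thesis"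
    by (rule has_sum_reindex_bij_witness[of _ "\<lambda>n. n - 1" Suc]) auto
  finally show ?thesis .
qed

text \<open>Both sides sum d^j q^(m d) over all m, d >= 1, the right side after grouping by n = m d.
  Absolute convergence permits the regrouping.\<close>

lemma lambert_series:
  assumes q: "norm q < 1" and j: "j > 0"
  shows "((\<lambda>m. power_moment j (q ^ m)) has_sum sigma_series j q) {1..}"
proof -
  define f where "f = (\<lambda>(n, d). of_nat d ^ j * q ^ n)"
  define f' where "f' = (\<lambda>(m, d). of_nat d ^ j * (q ^ m) ^ d)"
  have sumd: "((\<lambda>d. f (n, d)) has_sum (of_nat (divisor_sigma j n) * q ^ n)) {d. d dvd n}" if "n \<in> {1..}" for n
    using that by (auto simp: f_def divisor_sigma_def sum_distrib_right intro!: has_sum_finiteI)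
  have "(\<lambda>p. norm (f p)) summable_on (SIGMA n:{1..}. {d. d dvd n})"
  proof (rule summable_on_SigmaI)
    fix n :: nat assume "n \<in> {1..}"
    thus "((\<lambda>d. norm (f (n, d))) has_sum (real (divisor_sigma j n) * norm q ^ n)) {d. d dvd n}"
      by (auto simp: f_def divisor_sigma_def sum_distrib_right norm_mult norm_power intro!: has_sum_finiteI)
  next
    have "(\<lambda>n. real (divisor_sigma j n) * norm q ^ n) summable_on UNIV"
      by (rule norm_summable_imp_summable_on, rule summable_divisor_sigma) (use q in auto)
    thus "(\<lambda>n. real (divisor_sigma j n) * norm q ^ n) summable_on {1..}"
      by (rule summable_on_subset_banach) auto
  qed auto
  hence "f summable_on (SIGMA n:{1..}. {d. d dvd n})"
    by (rule abs_summable_summable)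
  then obtain S where S: "(f has_sum S) (SIGMA n:{1..}. {d. d dvd n})"
    by (auto simp: summable_on_def)
  have "((\<lambda>n. of_nat (divisor_sigma j n) * q ^ n) has_sum S) {1..}"
    by (rule has_sum_SigmaD[OF S sumd])
  hence "S = sigma_series j q"
    using sigma_series_has_sum[OF q] has_sum_unique by blast
  moreover have "(f has_sum S) (SIGMA n:{1..}. {d. d dvd n}) \<longleftrightarrow> (f' has_sum S) ({1..} \<times> {1..})"
    by (rule has_sum_reindex_bij_witness[of _ "\<lambda>(m, d). (m * d, d)" "\<lambda>(n, d). (n div d, d)"])
       (auto simp: f_def f'_def power_mult [symmetric] mult.commute elim!: dvdE intro: Nat.gr0I)
  ultimately have *: "(f' has_sum sigma_series j q) ({1..} \<times> {1..})"
    using S by simp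
  show ?thesis
  proof (rule has_sum_SigmaD[OF *])
    fix m :: nat assume m: "m \<in> {1..}"
    have "norm (q ^ m) < 1"
      using q m by (cases m) (auto simp: norm_power power_less_one_iff power_Suc_less_one simp del: power_Suc)
    from power_moment_has_sum[OF this j]
    show "((\<lambda>d. f' (m, d)) has_sum power_moment j (q ^ m)) {1..}"
      by (simp add: f'_def)
  qed
qed

subsection \<open>Eisenstein series as lattice sums\<close>

definition lattice_term :: "nat \<Rightarrow> complex \<Rightarrow> int \<Rightarrow> int \<Rightarrow> complex" where
  "lattice_term k z m n = 1 / (of_int m * z + of_int n) ^ k"

text \<open>The value, by the Lipschitz formula, of the sum of (z + n)^(-k) over all integers n, for
  even k >= 2.\<close>

definition lattice_row :: "nat \<Rightarrow> complex \<Rightarrow> complex" where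
  "lattice_row k z = (\<tau>) ^ k / fact (k - 1) * power_moment (k - 1) (qpar z)"

text \<open>For even k >= 2 this is the sum of all rows with nonzero m. Together with
  \<open>int_zeta k\<close>, the row m = 0, it is the lattice Eisenstein series of weight k, summed
  by rows.\<close>

definition lattice_tail :: "nat \<Rightarrow> complex \<Rightarrow> complex" where
  "lattice_tail k z = 2 * (\<tau>) ^ k / fact (k - 1) * sigma_series (k - 1) (qpar z)"

definition int_zeta :: "nat \<Rightarrow> complex" where
  "int_zeta k = infsum (\<lambda>n::int. 1 / of_int n ^ k) (-{0})"

lemma has_sum_int_nonzero_symmetric:
  fixes f :: "int \<Rightarrow> complex"
  assumes "((\<lambda>n::nat. f (int n)) has_sum A) {1..}" "\<And>n. f (- n) = f n"
  shows "(f has_sum (2 * A)) (-{0})"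
proof -
  have 1: "(f has_sum A) (int ` {1..})"
    using assms by (subst has_sum_reindex) (auto simp: o_def)
  have 2: "(f has_sum A) ((\<lambda>n. - int n) ` {1..})"
    using assms by (subst has_sum_reindex) (auto simp: o_def inj_on_def)
  have "(f has_sum (A + A)) (int ` {1..} \<union> (\<lambda>n. - int n) ` {1..})"
    by (rule has_sum_Un_disjoint[OF 1 2]) auto
  moreover have "int ` {1..} \<union> (\<lambda>n. - int n) ` {1..} = -{0}"
  proof -
    have "x \<in> int ` {1..} \<union> (\<lambda>n. - int n) ` {1..}" if "x \<noteq> 0" for x :: int
    proof (cases "x > 0")
      case True
      hence "x = int (nat x)" "nat x \<in> {1..}" by auto
      thus ?thesis by blast
    next
      case False
      hence "x = - int (nat (-x))" "nat (-x) \<in> {1..}" using that by auto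
      thus ?thesis by blast
    qed
    thus ?thesis by auto
  qed
  ultimately show ?thesis by simp
qed

lemma has_sum_minus:
  fixes f g :: "'a \<Rightarrow> complex"
  assumes "(f has_sum a) A" "(g has_sum b) A"
  shows "((\<lambda>x. f x - g x) has_sum (a - b)) A"
  using has_sum_add[OF assms(1) has_sum_uminusI[OF assms(2)]] by simp

lemma lattice_term_row_has_sum:
  assumes "Im z > 0" "even k" "k \<ge> 2"
  shows "((\<lambda>n. lattice_term k z 1 n) has_sum lattice_row k z) UNIV"
proof -
  have "odd (k - 1)" "Suc (k - 1) = k" using assms by auto
  thus ?thesis
    using lipschitz_formula[OF assms(1), of "k - 1"]
    by (simp add: lattice_term_def lattice_row_def)
qed

lemma lattice_row_has_sum:
  assumes "Im z > 0" "even k" "k \<ge> 2" "m \<noteq> 0"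
  shows "((\<lambda>n. lattice_term k z m n) has_sum lattice_row k (of_int \<bar>m\<bar> * z)) UNIV"
proof -
  have sum: "((\<lambda>n. lattice_term k (of_int \<bar>m\<bar> * z) 1 n) has_sum lattice_row k (of_int \<bar>m\<bar> * z)) UNIV"
    using assms by (intro lattice_term_row_has_sum) auto
  show ?thesis
  proof (cases "m > 0")
    case True
    thus ?thesis using sum by (simp add: lattice_term_def)
  next
    case False
    have "lattice_term k (of_int \<bar>m\<bar> * z) 1 (-n) = lattice_term k z m n" for n
    proof -
      have "of_int m * z + of_int n = - (of_int \<bar>m\<bar> * z + of_int (-n))"
        using False by simp
      thus ?thesis using assms(2) unfolding lattice_term_def by (simp only: power_minus_even) simp
    qed
    thus ?thesis using sum
      by (subst has_sum_reindex_bij_witness[of UNIV uminus uminus UNIV]) auto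
  qed
qed

lemma lattice_tail_has_sum:
  assumes "Im z > 0" "even k" "k \<ge> 2"
  shows "((\<lambda>m. lattice_row k (of_int \<bar>m\<bar> * z)) has_sum lattice_tail k z) (-{0})"
proof -
  have "((\<lambda>m. (\<tau>) ^ k / fact (k - 1) * power_moment (k - 1) (qpar z ^ m)) has_sum
      ((\<tau>) ^ k / fact (k - 1) * sigma_series (k - 1) (qpar z))) {1..}"
    using assms by (intro has_sum_cmult_right lambert_series) auto
  hence "((\<lambda>m. lattice_row k (of_int \<bar>int m\<bar> * z)) has_sum
      ((\<tau>) ^ k / fact (k - 1) * sigma_series (k - 1) (qpar z))) {1..}"
    by (simp add: lattice_row_def qpar_mult_nat)
  from has_sum_int_nonzero_symmetric[OF this] show ?thesis
    by (simp add: lattice_tail_def mult_ac)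
qed

lemma int_zeta_has_sum:
  assumes "k \<ge> 2" "even k"
  shows "((\<lambda>n::int. 1 / of_int n ^ k) has_sum int_zeta k) (-{0})"
proof -
  have "summable (\<lambda>n. norm (1 / of_nat n ^ k :: complex))"
    using inverse_power_summable[OF assms(1), where 'a = real]
    by (simp add: norm_inverse norm_power divide_inverse)
  hence "(\<lambda>n. 1 / of_nat n ^ k :: complex) summable_on UNIV"
    by (rule norm_summable_imp_summable_on)
  hence "(\<lambda>n. 1 / of_nat n ^ k :: complex) summable_on {1..}"
    by (rule summable_on_subset_banach) auto
  then obtain A where "((\<lambda>n. 1 / of_nat n ^ k :: complex) has_sum A) {1..}"
    by (auto simp: summable_on_def)
  hence "((\<lambda>n::int. 1 / of_int n ^ k :: complex) has_sum (2 * A)) (-{0})"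
    by (intro has_sum_int_nonzero_symmetric) (use assms in auto)
  thus ?thesis by (auto simp: int_zeta_def infsumI)
qed

lemma lattice_term_invert:
  assumes "z \<noteq> 0" "even k"
  shows "lattice_term k z m n = 1 / z ^ k * lattice_term k (-1/z) n (-m)"
proof -
  have "of_int m * z + of_int n = - z * (of_int n * (-1/z) + of_int (-m))"
    using assms by (simp add: field_simps)
  thus ?thesis using assms by (simp only: lattice_term_def power_mult_distrib power_minus_even) simp
qed

text \<open>Up to the factor z^k, column n of the lattice of z is row n of the lattice of -1/z. The
  subtracted term is the entry m = 0.\<close>

lemma lattice_column_has_sum:
  assumes "Im z > 0" "even k" "k \<ge> 2" "n \<noteq> 0"
  shows "((\<lambda>m. lattice_term k z m n) has_sum
     (1 / z ^ k * lattice_row k (of_int \<bar>n\<bar> * (-1/z)) - 1 / of_int n ^ k)) (-{0})"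
proof -
  have "z \<noteq> 0" using assms by auto
  have "((\<lambda>m. lattice_term k (-1/z) n m) has_sum lattice_row k (of_int \<bar>n\<bar> * (-1/z))) UNIV"
    by (intro lattice_row_has_sum Im_minus_inverse_pos assms)
  hence "((\<lambda>m. lattice_term k (-1/z) n (-m)) has_sum lattice_row k (of_int \<bar>n\<bar> * (-1/z))) UNIV"
    by (subst has_sum_reindex_bij_witness[of UNIV uminus uminus UNIV]) auto
  hence "((\<lambda>m. lattice_term k z m n) has_sum (1 / z ^ k * lattice_row k (of_int \<bar>n\<bar> * (-1/z)))) UNIV"
    unfolding lattice_term_invert[OF \<open>z \<noteq> 0\<close> assms(2), of _ n] by (rule has_sum_cmult_right)
  hence "((\<lambda>m. lattice_term k z m n) has_sum
     (1 / z ^ k * lattice_row k (of_int \<bar>n\<bar> * (-1/z)) - lattice_term k z 0 n)) (UNIV - {0})"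
    by (rule has_sum_Diff) (auto intro!: has_sum_finiteI)
  thus ?thesis by (simp add: lattice_term_def Compl_eq_Diff_UNIV)
qed

lemma lattice_column_zero_has_sum:
  assumes "Im z > 0" "even k" "k \<ge> 2"
  shows "((\<lambda>m. lattice_term k z m 0) has_sum (1 / z ^ k * int_zeta k)) (-{0})"
  using has_sum_cmult_right[OF int_zeta_has_sum[OF assms(3,2)], of "1 / z ^ k"]
  by (simp add: lattice_term_def power_mult_distrib mult.commute)

definition lattice_column :: "nat \<Rightarrow> complex \<Rightarrow> int \<Rightarrow> complex" where
  "lattice_column k z n = (if n = 0 then 1 / z ^ k * int_zeta k
     else 1 / z ^ k * lattice_row k (of_int \<bar>n\<bar> * (-1/z)) - 1 / of_int n ^ k)"

lemma lattice_column_has_sum':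
  assumes "Im z > 0" "even k" "k \<ge> 2"
  shows "((\<lambda>m. lattice_term k z m n) has_sum lattice_column k z n) (-{0})"
  using lattice_column_has_sum[OF assms] lattice_column_zero_has_sum[OF assms]
  by (auto simp: lattice_column_def)

text \<open>The rows at -1/z reassemble into its lattice tail; the trailing
  \<open>int_zeta k\<close> collects the entries m = 0 that were removed from the columns with
  nonzero n.\<close>

lemma lattice_columns_has_sum:
  assumes "Im z > 0" "even k" "k \<ge> 2"
  shows "(lattice_column k z has_sum
     (1 / z ^ k * (lattice_tail k (-1/z) + int_zeta k) - int_zeta k)) UNIV"
proof -
  have "((\<lambda>n. 1 / z ^ k * lattice_row k (of_int \<bar>n\<bar> * (-1/z)) - 1 / of_int n ^ k) has_sum
      (1 / z ^ k * lattice_tail k (-1/z) - int_zeta k)) (-{0})"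
    by (intro has_sum_minus has_sum_cmult_right lattice_tail_has_sum int_zeta_has_sum Im_minus_inverse_pos assms)
  hence "(lattice_column k z has_sum (1 / z ^ k * lattice_tail k (-1/z) - int_zeta k)) (-{0})"
    by (rule has_sum_cong[THEN iffD1, rotated]) (auto simp: lattice_column_def)
  hence "(lattice_column k z has_sum (lattice_column k z 0 + (1 / z ^ k * lattice_tail k (-1/z) - int_zeta k))) (insert 0 (-{0}))"
    by (intro has_sum_insert) auto
  moreover have "insert 0 (-{0 :: int}) = UNIV" by auto
  ultimately show ?thesis by (simp add: lattice_column_def algebra_simps)
qed

text \<open>The modulus of m z + n dominates |m| through the imaginary part and |n| through the
  triangle inequality, so its square dominates their product. The maximum with 1 keeps the bound
  useful for n = 0.\<close>

lemma lattice_norm_lower_bound: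
  assumes "Im z > 0"
  obtains c where "c > 0"
    "\<And>m n :: int. m \<noteq> 0 \<Longrightarrow> norm (of_int m * z + of_int n) ^ 2 \<ge> c * (of_int \<bar>m\<bar> * of_int (max 1 \<bar>n\<bar>))"
proof -
  define y where "y = Im z"
  define C where "C = (norm z + 1) / y + 1"
  have y: "y > 0" using assms by (simp add: y_def)
  have C: "C > 0" using y by (auto simp: C_def intro!: add_nonneg_pos divide_nonneg_pos)
  show ?thesis
  proof (rule that[of "y / C"])
    show "y / C > 0" using y C by auto
    fix m n :: int assume m: "m \<noteq> 0"
    define N where "N = norm (of_int m * z + of_int n)"
    have 1: "y * \<bar>of_int m\<bar> \<le> N"
      using abs_Im_le_cmod[of "of_int m * z + of_int n"] y by (simp add: N_def y_def abs_mult mult.commute)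
    hence le1: "\<bar>of_int m\<bar> \<le> N / y" using y by (simp add: field_simps)
    have N0: "N \<ge> 0" by (simp add: N_def)
    have m1: "(1 :: real) \<le> \<bar>of_int m\<bar>" using m by linarith
    have "\<bar>of_int n\<bar> = norm ((of_int m * z + of_int n) - of_int m * z)"
      by (simp add: norm_of_int)
    also have "\<dots> \<le> N + norm (of_int m * z)"
      unfolding N_def by (rule norm_triangle_ineq4)
    also have "\<dots> = N + \<bar>of_int m\<bar> * norm z"
      by (simp add: norm_mult norm_of_int)
    also have "\<dots> \<le> N + N / y * norm z"
      using le1 by (intro add_left_mono mult_right_mono) auto
    finally have n: "\<bar>of_int n\<bar> \<le> N + N / y * norm z" .
    have "of_int (max 1 \<bar>n\<bar>) \<le> 1 + \<bar>real_of_int n\<bar>" by simp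
    also have "\<dots> \<le> N / y + (N + N / y * norm z)"
      using n le1 m1 by linarith
    also have "\<dots> = C * N" by (simp add: C_def algebra_simps add_divide_distrib)
    finally have "of_int (max 1 \<bar>n\<bar>) \<le> C * N" .
    hence "(y * \<bar>of_int m\<bar>) * of_int (max 1 \<bar>n\<bar>) \<le> N * (C * N)"
      using 1 N0 by (intro mult_mono) auto
    thus "norm (of_int m * z + of_int n) ^ 2 \<ge> y / C * (of_int \<bar>m\<bar> * of_int (max 1 \<bar>n\<bar>))"
      using C by (simp add: N_def field_simps power2_eq_square)
  qed
qed

lemma lattice_cubes_summable:
  assumes "Im z > 0"
  shows "(\<lambda>(m, n). 1 / norm (of_int m * z + of_int n) ^ 3) summable_on (-{0 :: int}) \<times> (UNIV :: int set)"
proof -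
  obtain c where c: "c > 0"
    "\<And>m n :: int. m \<noteq> 0 \<Longrightarrow> norm (of_int m * z + of_int n) ^ 2 \<ge> c * (of_int \<bar>m\<bar> * of_int (max 1 \<bar>n\<bar>))"
    using lattice_norm_lower_bound[OF assms] by blast
  \<comment> \<open>A cube is a square to the power 3/2, so the product bound separates the
    variables and leaves a series with exponent 3/2 > 1 in each of them.\<close>
  define v where "v = (\<lambda>n :: int. real_of_int (max 1 \<bar>n\<bar>) powr (-(3/2)))"
  have v: "v summable_on UNIV"
  proof -
    have "summable (\<lambda>n. real n powr (-(3/2)))"
      by (subst summable_real_powr_iff) auto
    hence "summable (\<lambda>n. norm (v (int n)))" "summable (\<lambda>n. norm (v (- int n - 1)))"
      by (rule summable_comparison_test_ev[rotated];
          auto simp: v_def intro!: eventually_sequentiallyI[of 1] powr_mono2')+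
    hence "(\<lambda>n. v (int n)) summable_on UNIV" "(\<lambda>n. v (- int n - 1)) summable_on UNIV"
      by (auto intro: norm_summable_imp_summable_on)
    thus ?thesis unfolding summable_on_def using has_sum_int_split by blast
  qed
  have v0: "v n \<ge> 0" for n by (simp add: v_def)
  have "(\<lambda>(m, n). c powr (-(3/2)) * v m * v n) summable_on (-{0}) \<times> UNIV"
  proof (rule summable_on_SigmaI)
    show "((\<lambda>n. case (m, n) of (m, n) \<Rightarrow> c powr (-(3/2)) * v m * v n) has_sum (c powr (-(3/2)) * v m * infsum v UNIV)) UNIV" for m
      using v by (auto intro!: has_sum_cmult_right)
    have "v summable_on (-{0})" by (rule summable_on_subset_banach[OF v]) auto
    thus "(\<lambda>m. c powr (-(3/2)) * v m * infsum v UNIV) summable_on (-{0})"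
      by (intro summable_on_cmult_left summable_on_cmult_right)
  qed (use v0 in auto)
  hence "(\<lambda>p. norm (case p of (m, n) \<Rightarrow> 1 / norm (of_int m * z + of_int n) ^ 3)) summable_on (-{0 :: int}) \<times> (UNIV :: int set)"
  proof (rule Infinite_Sum.abs_summable_on_comparison_test')
    fix p :: "int \<times> int" assume p: "p \<in> (-{0}) \<times> UNIV"
    obtain m n where [simp]: "p = (m, n)" by (cases p)
    have m: "m \<noteq> 0" using p by auto
    define N where "N = norm (of_int m * z + of_int n)"
    define x where "x = c * (of_int \<bar>m\<bar> * of_int (max 1 \<bar>n\<bar>))"
    have x: "x > 0" unfolding x_def using c(1) m by (intro mult_pos_pos) auto
    have N: "N ^ 2 \<ge> x" using c(2)[OF m] by (simp add: N_def x_def)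
    have N0: "N > 0"
    proof -
      have "N \<noteq> 0" using N x by auto
      thus ?thesis by (simp add: N_def)
    qed
    have "(N ^ 2) powr (-(3/2)) = (N powr 2) powr (-(3/2))"
      using N0 by simp
    also have "\<dots> = N powr (-3)"
      by (simp only: powr_powr) simp
    also have "\<dots> = 1 / N ^ 3"
      using N0 by (simp add: powr_minus_divide)
    finally have "1 / N ^ 3 = (N ^ 2) powr (-(3/2))" ..
    also have "\<dots> \<le> x powr (-(3/2))"
      using x N by (intro powr_mono2') auto
    also have "\<dots> = c powr (-(3/2)) * v m * v n"
      using c(1) m unfolding x_def v_def by (simp add: powr_mult max_def)
    finally show "norm (case p of (m, n) \<Rightarrow> 1 / norm (of_int m * z + of_int n) ^ 3) \<le>
        (case p of (m, n) \<Rightarrow> c powr (-(3/2)) * v m * v n)"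
      using N0 by (simp add: N_def)
  qed
  thus ?thesis
    by (rule summable_on_cong[THEN iffD1, rotated]) auto
qed

lemma lattice_norm_ge:
  fixes m n :: int
  assumes "Im z > 0" "m \<noteq> 0"
  shows "Im z \<le> norm (of_int m * z + of_int n)"
proof -
  have "1 \<le> \<bar>real_of_int m\<bar>" using assms(2) by linarith
  hence "Im z * 1 \<le> Im z * \<bar>of_int m\<bar>"
    using assms(1) by (intro mult_left_mono) auto
  also have "\<dots> \<le> norm (of_int m * z + of_int n)"
    using abs_Im_le_cmod[of "of_int m * z + of_int n"] assms(1) by (simp add: abs_mult mult.commute)
  finally show ?thesis by simp
qed

lemma lattice_summable_by_cubes:
  assumes "Im z > 0"
    and "\<And>m n. m \<noteq> 0 \<Longrightarrow> norm (f m n) \<le> C * (1 / norm (of_int m * z + of_int n) ^ 3)"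
  shows "(\<lambda>(m, n). f m n :: complex) summable_on (-{0 :: int}) \<times> (UNIV :: int set)"
proof (rule abs_summable_summable, rule Infinite_Sum.abs_summable_on_comparison_test')
  show "(\<lambda>p. C * (case p of (m, n) \<Rightarrow> 1 / norm (of_int m * z + of_int n) ^ 3)) summable_on (-{0 :: int}) \<times> (UNIV :: int set)"
    by (intro summable_on_cmult_right lattice_cubes_summable assms(1))
next
  fix p :: "int \<times> int" assume "p \<in> (-{0}) \<times> UNIV"
  thus "norm (case p of (m, n) \<Rightarrow> f m n) \<le> C * (case p of (m, n) \<Rightarrow> 1 / norm (of_int m * z + of_int n) ^ 3)"
    using assms(2)[of "fst p" "snd p"] by (cases p) simp
qed

lemma has_sum_swap_rows_columns:
  fixes f :: "'a \<Rightarrow> 'b \<Rightarrow> complex"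
  assumes "(\<lambda>(m, n). f m n) summable_on A \<times> B"
    and "\<And>m. m \<in> A \<Longrightarrow> (f m has_sum g m) B" "\<And>n. n \<in> B \<Longrightarrow> ((\<lambda>m. f m n) has_sum h n) A"
    and "(g has_sum S) A"
  shows "(h has_sum S) B"
proof -
  obtain T where T: "((\<lambda>(m, n). f m n) has_sum T) (A \<times> B)"
    using assms(1) by (auto simp: summable_on_def)
  have "(g has_sum T) A"
    by (rule has_sum_SigmaD[OF T]) (use assms(2) in auto)
  with assms(4) have "T = S" using has_sum_unique by blast
  have T': "((\<lambda>(n, m). f m n) has_sum T) (B \<times> A)"
    using T by (subst (asm) has_sum_swap) simp
  have "(h has_sum T) B"
    by (rule has_sum_SigmaD[OF T']) (use assms(3) in auto)
  with \<open>T = S\<close> show ?thesis by simp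
qed

text \<open>For k >= 4 the lattice sum converges absolutely, so its value by rows, expressed at z,
  equals its value by columns, expressed at -1/z.\<close>

lemma lattice_tail_inversion:
  assumes "Im z > 0" "even k" "k \<ge> 4"
  shows "lattice_tail k (-1/z) + int_zeta k = z ^ k * (lattice_tail k z + int_zeta k)"
proof -
  have "z \<noteq> 0" using assms by auto
  have k: "k \<ge> 2" using assms by auto
  have "(\<lambda>(m, n). lattice_term k z m n) summable_on (-{0}) \<times> UNIV"
  proof (rule lattice_summable_by_cubes[OF assms(1)])
    fix m n :: int assume m: "m \<noteq> 0"
    define N where "N = norm (of_int m * z + of_int n)"
    have N: "Im z \<le> N"
      using lattice_norm_ge[OF assms(1) m, of n] by (simp add: N_def)
    hence "N > 0" using assms(1) by linarith
    have "1 / N ^ k = 1 / N ^ (k - 3) * (1 / N ^ 3)"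
      using assms by (simp flip: power_add)
    also have "\<dots> \<le> 1 / Im z ^ (k - 3) * (1 / N ^ 3)"
      using N \<open>N > 0\<close> assms(1) by (intro mult_right_mono divide_left_mono power_mono) auto
    finally show "norm (lattice_term k z m n) \<le> 1 / Im z ^ (k - 3) * (1 / norm (of_int m * z + of_int n) ^ 3)"
      by (simp add: lattice_term_def norm_divide norm_power N_def)
  qed
  hence "(lattice_column k z has_sum lattice_tail k z) UNIV"
  proof (rule has_sum_swap_rows_columns)
    show "(lattice_term k z m has_sum lattice_row k (of_int \<bar>m\<bar> * z)) UNIV" if "m \<in> -{0}" for m
      using lattice_row_has_sum[OF assms(1,2) k, of m] that by simp
  qed (intro lattice_column_has_sum' lattice_tail_has_sum assms k)+
  from has_sum_unique[OF this lattice_columns_has_sum[OF assms(1,2) k]]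
  have "lattice_tail k z + int_zeta k = 1 / z ^ k * (lattice_tail k (-1/z) + int_zeta k)"
    by simp
  thus ?thesis using \<open>z \<noteq> 0\<close> by simp
qed

text \<open>Turns an unconditional sum over integers into a limit along growing intervals, where
  telescoping and symmetric pairing become possible.\<close>

lemma int_intervals_exhaust:
  assumes "\<And>N. finite (F N)" "\<And>N. F N \<subseteq> A" "\<And>N x. x \<in> A \<Longrightarrow> \<bar>x\<bar> < int N \<Longrightarrow> x \<in> F N"
  shows "filterlim F (finite_subsets_at_top A) sequentially"
  unfolding filterlim_finite_subsets_at_top
proof safe
  fix X assume X: "finite X" "X \<subseteq> A"
  define M where "M = Max (insert 0 (abs ` X))"
  have M: "\<bar>x\<bar> \<le> M" if "x \<in> X" for x
    unfolding M_def using X that by (intro Max_ge) auto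
  show "eventually (\<lambda>N. finite (F N) \<and> X \<subseteq> F N \<and> F N \<subseteq> A) sequentially"
    using eventually_gt_at_top[of "nat M"]
  proof eventually_elim
    case (elim N)
    have "x \<in> F N" if "x \<in> X" for x
      using assms(3)[of x N] M[OF that] elim X that by auto
    thus ?case using assms(1,2) by blast
  qed
qed

lemma has_sum_telescope_int:
  fixes u :: "int \<Rightarrow> complex"
  assumes "((\<lambda>n. u n - u (n + 1)) has_sum S) UNIV" "(\<lambda>N. u (- int N) - u (int N)) \<longlonglongrightarrow> L"
  shows "S = L"
proof -
  have "filterlim (\<lambda>N. {- int N..<int N}) (finite_subsets_at_top UNIV) sequentially"
    by (rule int_intervals_exhaust) auto
  with assms(1) have "(\<lambda>N. \<Sum>n\<in>{- int N..<int N}. u n - u (n + 1)) \<longlonglongrightarrow> S"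
    unfolding has_sum_def by (rule filterlim_compose)
  moreover have "(\<Sum>n\<in>{- int N..<int N}. u n - u (n + 1)) = u (- int N) - u (int N)" for N
  proof (induction N)
    case (Suc N)
    have *: "{- int (Suc N)..<int (Suc N)} = insert (- int N - 1) (insert (int N) {- int N..<int N})"
      by auto
    have **: "- int (Suc N) = - int N - 1" "int (Suc N) = int N + 1" by auto
    show ?case unfolding * unfolding ** using Suc by simp
  qed auto
  ultimately have "(\<lambda>N. u (- int N) - u (int N)) \<longlonglongrightarrow> S" by simp
  thus ?thesis using assms(2) LIMSEQ_unique by blast
qed

lemma has_sum_symmetric_limit:
  fixes u :: "int \<Rightarrow> complex"
  assumes "(u has_sum S) (-{0})" "(\<lambda>N. \<Sum>k<N. u (int (Suc k)) + u (- int (Suc k))) \<longlonglongrightarrow> L"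
  shows "S = L"
proof -
  have "filterlim (\<lambda>N. {- int N..int N} - {0}) (finite_subsets_at_top (-{0})) sequentially"
    by (rule int_intervals_exhaust) auto
  with assms(1) have "(\<lambda>N. sum u ({- int N..int N} - {0})) \<longlonglongrightarrow> S"
    unfolding has_sum_def by (rule filterlim_compose)
  moreover have "sum u ({- int N..int N} - {0}) = (\<Sum>k<N. u (int (Suc k)) + u (- int (Suc k)))" for N
  proof (induction N)
    case (Suc N)
    have "{- int (Suc N)..int (Suc N)} - {0} = insert (- int (Suc N)) (insert (int (Suc N)) ({- int N..int N} - {0}))"
      by auto
    thus ?case using Suc by (simp add: algebra_simps)
  qed auto
  ultimately have "(\<lambda>N. \<Sum>k<N. u (int (Suc k)) + u (- int (Suc k))) \<longlonglongrightarrow> S" by (simp only:)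
  thus ?thesis using assms(2) by (rule LIMSEQ_unique)
qed

subsection \<open>The quasimodular transformation in weight two\<close>

text \<open>The symmetric value of \<open>\<Sum>m\<noteq>0. 1 / (m z + n)\<close>; for \<open>n = 0\<close> both summands are \<open>0\<close>
  by the conventions \<open>cot 0 = 0\<close> and \<open>1 / 0 = 0\<close>.\<close>

definition cot_column :: "complex \<Rightarrow> int \<Rightarrow> complex" where
  "cot_column z n = of_real pi / z * cot (of_real pi * (of_int n / z)) - 1 / of_int n"

text \<open>With x = n / z, pairing m with -m gives the partial fraction series of the cotangent at
  x, which is the difference of the Digamma series at 1 - x and at 1 + x.\<close>

lemma cot_column_limit:
  assumes "Im z > 0"
  shows "(\<lambda>N. \<Sum>k<N. lattice_term 1 z (int (Suc k)) n + lattice_term 1 z (- int (Suc k)) n) \<longlonglongrightarrow> cot_column z n"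
proof (cases "n = 0")
  case True
  have "lattice_term 1 z (int (Suc k)) 0 + lattice_term 1 z (- int (Suc k)) 0 = 0" for k
    by (simp add: lattice_term_def del: of_nat_Suc)
  thus ?thesis using True by (simp only:) (simp add: cot_column_def)
next
  case False
  have z: "z \<noteq> 0" using assms by auto
  define x where "x = of_int n / z"
  have "Im x \<noteq> 0" using assms False z by (simp add: x_def Im_divide)
  hence x: "x \<notin> \<int>" by (rule Im_pos_not_Int)
  have nz: "of_nat k + x \<noteq> 0" "of_nat k - x \<noteq> 0" for k
    using \<open>Im x \<noteq> 0\<close> by (auto simp: complex_eq_iff)
  have "(\<lambda>k. (inverse (of_nat (Suc k)) - inverse (1 - x + of_nat k))) sums (Digamma (1 - x) + euler_mascheroni)"
    using summable_sums[OF summable_Digamma[of "1 - x"]] nz(2)[of 1] by (simp add: Digamma_def)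
  moreover have "(\<lambda>k. (inverse (of_nat (Suc k)) - inverse (1 + x + of_nat k))) sums (Digamma (1 + x) + euler_mascheroni)"
    using summable_sums[OF summable_Digamma[of "1 + x"]] nz(1)[of 1] by (simp add: Digamma_def)
  ultimately have "(\<lambda>k. (inverse (of_nat (Suc k)) - inverse (1 - x + of_nat k)) -
      (inverse (of_nat (Suc k)) - inverse (1 + x + of_nat k))) sums
      (Digamma (1 - x) + euler_mascheroni - (Digamma (1 + x) + euler_mascheroni))"
    by (rule sums_diff)
  hence "(\<lambda>k. inverse (1 + x + of_nat k) - inverse (1 - x + of_nat k)) sums (Digamma (1 - x) - Digamma (1 + x))"
    by simp
  hence "(\<lambda>k. (inverse (1 + x + of_nat k) - inverse (1 - x + of_nat k)) / z) sums ((Digamma (1 - x) - Digamma (1 + x)) / z)"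
    by (rule sums_divide)
  moreover have "Digamma (1 + x) = Digamma x + 1 / x"
    using Digamma_plus1[of x] nz(1)[of 0] by (simp add: add.commute)
  hence "(Digamma (1 - x) - Digamma (1 + x)) / z = cot_column z n"
    using Digamma_reflection[OF x] False z
    by (simp add: cot_column_def x_def [symmetric] diff_divide_distrib) (simp add: x_def field_simps)
  moreover have "(inverse (1 + x + of_nat k) - inverse (1 - x + of_nat k)) / z =
      lattice_term 1 z (int (Suc k)) n + lattice_term 1 z (- int (Suc k)) n" for k
  proof -
    have "of_int (int (Suc k)) * z + of_int n = z * (1 + x + of_nat k)"
      using z by (simp add: x_def field_simps)
    moreover have "of_int (- int (Suc k)) * z + of_int n = - (z * (1 - x + of_nat k))"
      using z by (simp add: x_def field_simps)
    moreover have "(inverse A - inverse B) / z = 1 / (z * A) ^ 1 + 1 / (- (z * B)) ^ 1" for A B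
      by (simp add: divide_inverse left_diff_distrib right_diff_distrib mult.commute)
    ultimately show ?thesis
      unfolding lattice_term_def by (simp only:)
  qed
  ultimately show ?thesis
    by (simp add: sums_def)
qed

lemma Im_complex_of_nat_mult: "Im (of_nat N * z) = real N * Im z"
  by simp

text \<open>The cotangent has different limits at the two ends, because \<open>qpar (-1/z)\<close>
  to the power N tends to 0. This jump is the origin of the linear term in the inversion law of
  E_2.\<close>

lemma cot_column_boundary:
  assumes "Im z > 0"
  shows "(\<lambda>N. cot_column z (- int N) - cot_column z (int N)) \<longlonglongrightarrow> - (\<tau> / z)"
proof -
  define p where "p = qpar (-1/z)"
  have p: "norm p < 1" unfolding p_def by (intro norm_qpar_less_1 Im_minus_inverse_pos assms)
  have "(\<lambda>N. 2 / z * (of_real pi * \<i> - \<tau> / (1 - p ^ N)) + 2 * inverse (of_nat N)) \<longlonglongrightarrow>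
      2 / z * (of_real pi * \<i> - \<tau> / (1 - 0)) + 2 * 0"
    using p by (intro tendsto_intros LIMSEQ_power_zero lim_inverse_n) auto
  moreover have "eventually (\<lambda>N. 2 / z * (of_real pi * \<i> - \<tau> / (1 - p ^ N)) + 2 * inverse (of_nat N) =
       cot_column z (- int N) - cot_column z (int N)) sequentially"
    using eventually_gt_at_top[of 0]
  proof eventually_elim
    case (elim N)
    define w where "w = of_nat N * (-1/z)"
    have "Im w = real N * Im (-1/z)" unfolding w_def by (rule Im_complex_of_nat_mult)
    hence "Im w > 0" using elim Im_minus_inverse_pos[OF assms] by (simp only:) (intro mult_pos_pos, auto)
    from pi_cot_qpar[OF this]
    have 1: "of_real pi * cot (of_real pi * w) = of_real pi * \<i> - \<tau> / (1 - p ^ N)"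
      by (simp only: w_def qpar_mult_nat p_def)
    have "of_real pi * (of_int (- int N) / z) = of_real pi * w"
         "of_real pi * (of_int (int N) / z) = - (of_real pi * w)"
      by (simp_all add: w_def)
    hence "cot_column z (- int N) - cot_column z (int N) =
       2 / z * (of_real pi * cot (of_real pi * w)) + 2 * inverse (of_nat N)"
      unfolding cot_column_def by (simp only: cot_minus) (simp add: divide_inverse algebra_simps)
    thus ?case by (simp only: 1)
  qed
  ultimately have "(\<lambda>N. cot_column z (- int N) - cot_column z (int N)) \<longlonglongrightarrow>
      2 / z * (of_real pi * \<i> - \<tau> / (1 - 0)) + 2 * 0"
    by (rule Lim_transform_eventually)
  thus ?thesis by (simp add: algebra_simps)
qed

lemma lattice_term_1_tendsto_0:
  assumes "Im z > 0" "m \<noteq> 0"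
  shows "(\<lambda>N. lattice_term 1 z m (- int N) - lattice_term 1 z m (int N)) \<longlonglongrightarrow> 0"
proof -
  have inf: "filterlim (\<lambda>N. of_nat N :: complex) at_infinity sequentially"
    by (rule tendsto_of_nat)
  have "(\<lambda>N. inverse (of_int m * z + of_nat N)) \<longlonglongrightarrow> 0"
    by (intro filterlim_compose[OF tendsto_inverse_0] tendsto_add_filterlim_at_infinity[OF tendsto_const] inf)
  moreover have "(\<lambda>N. - inverse (- (of_int m * z) + of_nat N)) \<longlonglongrightarrow> - 0"
    by (intro tendsto_minus filterlim_compose[OF tendsto_inverse_0] tendsto_add_filterlim_at_infinity[OF tendsto_const] inf)
  ultimately have "(\<lambda>N. - inverse (- (of_int m * z) + of_nat N) - inverse (of_int m * z + of_nat N)) \<longlonglongrightarrow> - 0 - 0"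
    by (rule tendsto_diff[rotated])
  moreover have "- inverse (- (of_int m * z) + of_nat N) = lattice_term 1 z m (- int N)" for N
    by (simp add: lattice_term_def inverse_minus_eq [symmetric] divide_inverse del: inverse_minus_eq)
  ultimately show ?thesis
    by (simp add: lattice_term_def divide_inverse)
qed

text \<open>Eisenstein's trick: in weight 2 absolute convergence fails, so the telescoping terms 1 /
  (m z + n) - 1 / (m z + n + 1) are subtracted, which leaves cubic decay. By rows the correction
  sums to 0, by columns to -\<open>\<tau>\<close> / z; the difference is the anomaly.\<close>

lemma lattice_tail_2_inversion:
  assumes "Im z > 0"
  shows "lattice_tail 2 (-1/z) + int_zeta 2 = z\<^sup>2 * (lattice_tail 2 z + int_zeta 2) - \<tau> * z"
proof -
  have "z \<noteq> 0" using assms by auto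
  define u where "u = lattice_term 1 z"
  define d where "d = (\<lambda>m n. lattice_term 2 z m n - (u m n - u m (n + 1)))"
  have d: "(\<lambda>(m, n). d m n) summable_on (-{0}) \<times> UNIV"
  proof (rule lattice_summable_by_cubes[OF assms])
    fix m n :: int assume m: "m \<noteq> 0"
    define x where "x = of_int m * z + of_int n"
    have x: "Im z \<le> norm x" "Im z \<le> norm (x + 1)"
      using lattice_norm_ge[OF assms m, of n] lattice_norm_ge[OF assms m, of "n + 1"]
      by (simp_all add: x_def add.assoc)
    hence nz: "x \<noteq> 0" "x + 1 \<noteq> 0" using assms by auto
    have nz': "norm x > 0" "norm (x + 1) > 0" using nz by auto
    have "d m n = 1 / (x ^ 2 * (x + 1))"
    proof -
      have "d m n = 1 / x ^ 2 - (1 / x - 1 / (x + 1))"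
        by (simp add: d_def u_def lattice_term_def x_def add.assoc)
      also have "\<dots> = 1 / (x ^ 2 * (x + 1))"
        using nz by (simp add: divide_simps) (simp add: algebra_simps power2_eq_square)
      finally show ?thesis .
    qed
    moreover define C where "C = 1 + 1 / Im z"
    have "norm x \<le> C * norm (x + 1)"
    proof -
      have "norm x \<le> norm (x + 1) + norm (1 :: complex)"
        using norm_triangle_ineq4[of "x + 1" 1] by simp
      also have "norm (1 :: complex) \<le> norm (x + 1) / Im z"
        using x(2) assms by simp
      finally show ?thesis by (simp add: C_def algebra_simps)
    qed
    hence "norm x / (norm x ^ 3 * norm (x + 1)) \<le> C * norm (x + 1) / (norm x ^ 3 * norm (x + 1))"
      by (intro divide_right_mono) auto
    hence "1 / (norm x ^ 2 * norm (x + 1)) \<le> C * (1 / norm x ^ 3)"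
      using nz' by (simp add: power3_eq_cube power2_eq_square)
    ultimately show "norm (d m n) \<le> (1 + 1 / Im z) * (1 / norm (of_int m * z + of_int n) ^ 3)"
      by (simp add: norm_divide norm_mult norm_power x_def C_def)
  qed
  \<comment> \<open>The correction is summable along a column because \<open>d\<close> and the
    weight 2 terms are; its value can then be read off from symmetric partial sums.\<close>
  have col: "((\<lambda>m. d m n) has_sum (lattice_column 2 z n - (cot_column z n - cot_column z (n + 1)))) (-{0})" for n
  proof -
    have 1: "((\<lambda>m. lattice_term 2 z m n) has_sum lattice_column 2 z n) (-{0})"
      using lattice_column_has_sum'[OF assms, of 2] by simp
    have "(\<lambda>(n, m). d m n) summable_on UNIV \<times> (-{0})"
      using d by (subst (asm) summable_on_swap) simp
    hence "(\<lambda>m. d m n) summable_on (-{0})"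
      by (rule summable_on_SigmaD1) auto
    then obtain D where D: "((\<lambda>m. d m n) has_sum D) (-{0})" by (auto simp: summable_on_def)
    have "((\<lambda>m. u m n - u m (n + 1)) has_sum (lattice_column 2 z n - D)) (-{0})"
      using has_sum_minus[OF 1 D] by (simp add: d_def)
    moreover have "(\<lambda>N. \<Sum>k<N. (u (int (Suc k)) n - u (int (Suc k)) (n + 1)) + (u (- int (Suc k)) n - u (- int (Suc k)) (n + 1)))
         \<longlonglongrightarrow> cot_column z n - cot_column z (n + 1)"
      using tendsto_diff[OF cot_column_limit[OF assms, of n] cot_column_limit[OF assms, of "n + 1"]]
      unfolding u_def sum_subtractf [symmetric] by (simp add: algebra_simps)
    ultimately have "lattice_column 2 z n - D = cot_column z n - cot_column z (n + 1)"
      by (rule has_sum_symmetric_limit)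
    hence "D = lattice_column 2 z n - (cot_column z n - cot_column z (n + 1))"
      by (simp add: algebra_simps)
    with D show ?thesis by simp
  qed
  have row: "(d m has_sum lattice_row 2 (of_int \<bar>m\<bar> * z)) UNIV" if m: "m \<noteq> 0" for m
  proof -
    have 1: "(lattice_term 2 z m has_sum lattice_row 2 (of_int \<bar>m\<bar> * z)) UNIV"
      using lattice_row_has_sum[OF assms, of 2 m] m by simp
    have "d m summable_on UNIV"
      using d by (rule summable_on_SigmaD1) (use m in auto)
    then obtain D where D: "(d m has_sum D) UNIV" by (auto simp: summable_on_def)
    have "((\<lambda>n. u m n - u m (n + 1)) has_sum (lattice_row 2 (of_int \<bar>m\<bar> * z) - D)) UNIV"
      using has_sum_minus[OF 1 D] by (simp add: d_def)
    hence "lattice_row 2 (of_int \<bar>m\<bar> * z) - D = 0"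
      by (rule has_sum_telescope_int) (unfold u_def, rule lattice_term_1_tendsto_0[OF assms m])
    with D show ?thesis by simp
  qed
  have 1: "((\<lambda>n. lattice_column 2 z n - (cot_column z n - cot_column z (n + 1))) has_sum lattice_tail 2 z) UNIV"
    by (rule has_sum_swap_rows_columns[OF d])
       (use row col lattice_tail_has_sum[OF assms, of 2] in auto)
  have "((\<lambda>n. cot_column z n - cot_column z (n + 1)) has_sum
      (1 / z\<^sup>2 * (lattice_tail 2 (-1/z) + int_zeta 2) - int_zeta 2 - lattice_tail 2 z)) UNIV"
    using has_sum_minus[OF lattice_columns_has_sum[OF assms, of 2] 1] by simp
  hence "1 / z\<^sup>2 * (lattice_tail 2 (-1/z) + int_zeta 2) - int_zeta 2 - lattice_tail 2 z = - (\<tau> / z)"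
    by (rule has_sum_telescope_int) (rule cot_column_boundary[OF assms])
  hence "z\<^sup>2 * (1 / z\<^sup>2 * (lattice_tail 2 (-1/z) + int_zeta 2) - int_zeta 2 - lattice_tail 2 z) = - (z\<^sup>2 * (\<tau> / z))"
    by simp
  thus ?thesis using \<open>z \<noteq> 0\<close>
    by (simp add: ring_distribs power2_eq_square) (simp add: algebra_simps)
qed

lemma int_zeta_2: "int_zeta 2 = of_real (pi\<^sup>2 / 3)"
proof -
  have "(\<lambda>n. 1 / real (n + 1) ^ 2) sums (pi\<^sup>2 / 6)"
    using inverse_squares_sums by simp
  hence "((\<lambda>n. 1 / real (Suc n) ^ 2) has_sum (pi\<^sup>2 / 6)) UNIV"
    by (intro sums_nonneg_imp_has_sum) auto
  hence "((\<lambda>n. complex_of_real (1 / real (Suc n) ^ 2)) has_sum of_real (pi\<^sup>2 / 6)) UNIV"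
    by (subst has_sum_of_real_iff)
  also have "?this \<longleftrightarrow> ((\<lambda>n. 1 / of_int (int n) ^ 2) has_sum complex_of_real (pi\<^sup>2 / 6)) {1..}"
    by (rule has_sum_reindex_bij_witness[of _ "\<lambda>n. n - 1" Suc]) auto
  finally have "((\<lambda>n::int. 1 / of_int n ^ 2) has_sum 2 * complex_of_real (pi\<^sup>2 / 6)) (-{0})"
    by (intro has_sum_int_nonzero_symmetric) auto
  thus ?thesis by (simp add: int_zeta_def infsumI)
qed

subsection \<open>Level one forms as functions on the unit disc\<close>

text \<open>A form is represented by its expansion \<open>g\<close> in \<open>q = qpar z\<close>, so that periodicity and holomorphy at the
  cusp are built in and only the inversion remains to be required.\<close>

definition disc_form :: "int \<Rightarrow> (complex \<Rightarrow> complex) \<Rightarrow> bool" where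
  "disc_form k g \<longleftrightarrow> g holomorphic_on ball 0 1 \<and>
     (\<forall>z. Im z > 0 \<longrightarrow> g (qpar (-1/z)) = z powi k * g (qpar z))"

lemma disc_form_holomorphic: "disc_form k g \<Longrightarrow> g holomorphic_on ball 0 1"
  and disc_form_inversion: "disc_form k g \<Longrightarrow> Im z > 0 \<Longrightarrow> g (qpar (-1/z)) = z powi k * g (qpar z)"
  by (simp_all add: disc_form_def)

lemma disc_form_1: "disc_form 0 (\<lambda>_. 1)"
  by (simp add: disc_form_def)

lemma disc_form_0: "disc_form k (\<lambda>_. 0)"
  by (simp add: disc_form_def)

lemma disc_form_mult:
  assumes "disc_form k f" "disc_form l g"
  shows "disc_form (k + l) (\<lambda>q. f q * g q)"
  unfolding disc_form_def
proof (intro conjI allI impI)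
  show "(\<lambda>q. f q * g q) holomorphic_on ball 0 1"
    using assms by (intro holomorphic_on_mult disc_form_holomorphic)
  fix z assume z: "Im z > 0"
  hence "z \<noteq> 0" by auto
  thus "f (qpar (-1/z)) * g (qpar (-1/z)) = z powi (k + l) * (f (qpar z) * g (qpar z))"
    by (simp only: disc_form_inversion[OF assms(1) z] disc_form_inversion[OF assms(2) z])
       (simp add: power_int_add)
qed

lemma disc_form_power: "disc_form k f \<Longrightarrow> disc_form (int n * k) (\<lambda>q. f q ^ n)"
proof (induction n)
  case 0
  thus ?case using disc_form_1 by simp
next
  case (Suc n)
  have "int (Suc n) * k = k + int n * k" by (simp add: algebra_simps)
  thus ?case using disc_form_mult[OF Suc.prems Suc.IH[OF Suc.prems]] by simp
qed

lemma disc_form_cmult: "disc_form k f \<Longrightarrow> disc_form k (\<lambda>q. c * f q)"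
  unfolding disc_form_def by (auto intro!: holomorphic_intros)

lemma disc_form_diff: "disc_form k f \<Longrightarrow> disc_form k g \<Longrightarrow> disc_form k (\<lambda>q. f q - g q)"
  unfolding disc_form_def by (auto intro!: holomorphic_intros simp: right_diff_distrib)

lemma disc_form_sum: "(\<And>i. i \<in> I \<Longrightarrow> disc_form k (f i)) \<Longrightarrow> disc_form k (\<lambda>q. \<Sum>i\<in>I. f i q)"
  unfolding disc_form_def by (auto intro!: holomorphic_intros simp: sum_distrib_left)

text \<open>If \<open>Im z < 1/2\<close> and \<open>\<bar>Re z\<bar> \<le> 1/2\<close>, then \<open>\<bar>z\<bar>\<^sup>2 \<le> 1/2\<close>, so the inversion doubles the imaginary part.\<close>

lemma reduce_to_strip:
  assumes inv: "\<And>z. Im z > 0 \<Longrightarrow> v (qpar (-1/z)) = v (qpar z)" and z: "Im z > 0"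
  obtains z' where "Im z' \<ge> 1/2" "v (qpar z') = v (qpar z)"
proof -
  \<comment> \<open>N doublings of the imaginary part suffice; the induction is on the number of
    doublings still to be made.\<close>
  obtain N where "(1/2) / Im z < 2 ^ N"
    using real_arch_pow[of 2 "(1/2) / Im z"] by auto
  hence "Im z * 2 ^ N \<ge> 1/2" using z by (simp add: field_simps)
  hence "\<exists>z'. Im z' \<ge> 1/2 \<and> v (qpar z') = v (qpar z)"
    using z
  proof (induction N arbitrary: z)
    case 0
    thus ?case by auto
  next
    case (Suc N)
    show ?case
    proof (cases "Im z \<ge> 1/2")
      case False
      define w where "w = z + of_int (- round (Re z))"
      have Imw: "Im w = Im z" by (simp add: w_def)
      have "\<bar>Re w\<bar> \<le> 1/2"
        using of_int_round_abs_le[of "Re z"] by (simp add: w_def abs_minus_commute)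
      hence "(Re w)\<^sup>2 \<le> (1/2)\<^sup>2"
        by (metis abs_ge_zero power2_abs power_mono)
      moreover have "(Im w)\<^sup>2 \<le> (1/2)\<^sup>2"
        using False Suc.prems Imw by (intro power_mono) auto
      ultimately have "(norm w)\<^sup>2 \<le> 1/2"
        by (simp only: cmod_power2) (simp add: power2_eq_square)
      moreover have "w \<noteq> 0" using Imw Suc.prems by auto
      ultimately have "2 * Im w \<le> Im (-1/w)"
        using Imw Suc.prems by (subst Im_minus_inverse) (auto simp: field_simps)
      hence "2 * Im w * 2 ^ N \<le> Im (-1/w) * 2 ^ N"
        by (intro mult_right_mono) auto
      moreover have "Im z * 2 ^ Suc N = 2 * Im w * 2 ^ N"
        using Imw by simp
      ultimately have "1/2 \<le> Im (-1/w) * 2 ^ N" using Suc.prems by linarith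
      moreover have "Im (-1/w) > 0" using Imw Suc.prems by (intro Im_minus_inverse_pos) auto
      ultimately obtain z' where z': "Im z' \<ge> 1/2" "v (qpar z') = v (qpar (-1/w))"
        using Suc.IH by blast
      have "v (qpar (-1/w)) = v (qpar w)" using inv[of w] Imw Suc.prems by simp
      moreover have "qpar w = qpar z" unfolding w_def by (rule qpar_plus_of_int)
      ultimately show ?thesis using z' by (intro exI[of _ z']) simp
    qed auto
  qed
  thus ?thesis using that by blast
qed

text \<open>Euclid's algorithm on the lower row: with d = c n + d', a translation by n and an
  inversion replace c by d', and |d'| < |c|. At c = 0 only translations up to sign remain, and the
  sign is harmless because k is even.\<close>

lemma disc_form_SL2Z:
  assumes g: "disc_form k g" and k: "even k" and det: "a * d - b * c = (1::int)" and z: "Im z > 0"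
  shows "g (qpar ((of_int a * z + of_int b) / (of_int c * z + of_int d))) =
     (of_int c * z + of_int d) powi k * g (qpar z)"
  using det z
proof (induction "nat \<bar>c\<bar>" arbitrary: a b c d z rule: less_induct)
  case (less c a b d z)
  show ?case
  proof (cases "c = 0")
    case True
    hence "a * d = 1" using less.prems by simp
    hence "a = 1 \<and> d = 1 \<or> a = -1 \<and> d = -1" by (rule zmult_eq_1_iff[THEN iffD1])
    thus ?thesis
    proof
      assume "a = 1 \<and> d = 1"
      thus ?thesis using True by simp
    next
      assume ad: "a = -1 \<and> d = -1"
      have "(of_int a * z + of_int b) / (of_int c * z + of_int d) = z + of_int (-b)"
        using ad True by simp
      moreover have "(of_int c * z + of_int d) powi k = 1"
        using ad True k by simp
      ultimately show ?thesis by (simp only: qpar_plus_of_int) simp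
    qed
  next
    case False
    define n where "n = d div c"
    define d' where "d' = d mod c"
    define b' where "b' = b - a * n"
    define w where "w = z + of_int n"
    define v where "v = -1 / w"
    have Imw: "Im w > 0" using less.prems by (simp add: w_def)
    hence w0: "w \<noteq> 0" by auto
    have Imv: "Im v > 0" unfolding v_def by (intro Im_minus_inverse_pos Imw)
    have d: "d = c * n + d'" by (simp add: n_def d'_def)
    have b: "b = a * n + b'" by (simp add: b'_def)
    have "\<bar>d'\<bar> < \<bar>c\<bar>" using False unfolding d'_def by (rule abs_mod_less)
    hence lt: "nat \<bar>d'\<bar> < nat \<bar>c\<bar>" by simp
    have det': "b' * (-c) - (-a) * d' = 1"
      using less.prems(1) unfolding d b by (simp add: algebra_simps)
    have num: "of_int a * z + of_int b = - (of_int b' * v + of_int (-a)) * w"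
      unfolding b v_def using w0 by (simp add: w_def field_simps)
    have den: "of_int c * z + of_int d = - (of_int d' * v + of_int (-c)) * w"
      unfolding d v_def using w0 by (simp add: w_def field_simps)
    have "g (qpar ((of_int b' * v + of_int (-a)) / (of_int d' * v + of_int (-c)))) =
        (of_int d' * v + of_int (-c)) powi k * g (qpar v)"
      using less.hyps[OF lt det' Imv] .
    also have "g (qpar v) = w powi k * g (qpar w)"
      unfolding v_def by (rule disc_form_inversion[OF g Imw])
    also have "qpar w = qpar z" unfolding w_def by (rule qpar_plus_of_int)
    also have "(of_int d' * v + of_int (-c)) powi k * (w powi k * g (qpar z)) =
        (- (of_int d' * v + of_int (-c)) * w) powi k * g (qpar z)"
      using k by (simp only: power_int_mult_distrib power_int_minus_left_even mult.assoc)
    also have "(of_int b' * v + of_int (-a)) / (of_int d' * v + of_int (-c)) =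
        (of_int a * z + of_int b) / (of_int c * z + of_int d)"
      unfolding num den nonzero_mult_divide_mult_cancel_right[OF w0] minus_divide_divide ..
    finally show ?thesis unfolding den .
  qed
qed

lemma disc_form_modular_form:
  assumes "disc_form k g" "even k"
  shows "(\<lambda>z. if Im z > 0 then g (qpar z) else 0) \<in> modular_forms k"
  unfolding modular_forms_def mem_Collect_eq
proof (intro conjI allI impI ballI)
  have "(\<lambda>z. g (qpar z)) holomorphic_on upper_half"
    by (intro holomorphic_compose_qpar disc_form_holomorphic[OF assms(1)])
  thus "(\<lambda>z. if Im z > 0 then g (qpar z) else 0) holomorphic_on upper_half"
    by (rule holomorphic_transform) auto
next
  fix a b c d :: int and z assume det: "a * d - b * c = 1" and z: "z \<in> upper_half"
  define D where "D = of_int c * z + of_int d"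
  have "Im ((of_int a * z + of_int b) / D) = of_int (a * d - b * c) * Im z / (norm D)\<^sup>2"
    by (simp add: D_def Im_divide cmod_power2 algebra_simps)
  moreover have "D \<noteq> 0"
  proof
    assume "D = 0"
    hence "c = 0" "d = 0" using z by (auto simp: D_def complex_eq_iff)
    thus False using det by simp
  qed
  ultimately have "Im ((of_int a * z + of_int b) / D) > 0"
    using det z by (auto intro!: divide_pos_pos)
  thus "(if Im ((of_int a * z + of_int b) / (of_int c * z + of_int d)) > 0
           then g (qpar ((of_int a * z + of_int b) / (of_int c * z + of_int d))) else 0) =
        (of_int c * z + of_int d) powi k * (if Im z > 0 then g (qpar z) else 0)"
    using disc_form_SL2Z[OF assms det, of z] z by (simp add: D_def)
next
  show "\<exists>a. \<forall>z\<in>upper_half. (\<lambda>n. a n * qpar z ^ n) sums (if Im z > 0 then g (qpar z) else 0)"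
    using holomorphic_power_series[OF disc_form_holomorphic[OF assms(1)]]
    by (intro exI[of _ "\<lambda>n. (deriv ^^ n) g 0 / fact n"]) simp
qed auto

text \<open>Every nonzero point of the disc has the form \<open>qpar z\<close>, so convergence on
  the upper half-plane means a radius of convergence of at least 1.\<close>

lemma disc_power_series:
  fixes a :: "nat \<Rightarrow> complex"
  assumes "\<And>z. Im z > 0 \<Longrightarrow> summable (\<lambda>n. a n * qpar z ^ n)"
  shows "(\<lambda>q. \<Sum>n. a n * q ^ n) holomorphic_on ball 0 1"
proof -
  have sm: "summable (\<lambda>n. a n * q ^ n)" if "norm q < 1" for q
  proof (cases "q = 0")
    case False
    with that obtain z where "Im z > 0" "qpar z = q" using qpar_surj by blast
    thus ?thesis using assms[of z] by simp
  qed auto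
  show ?thesis
    unfolding holomorphic_on_def field_differentiable_def
  proof (intro ballI exI)
    fix q :: complex assume "q \<in> ball 0 1"
    hence q: "norm q < 1" by simp
    show "((\<lambda>q. \<Sum>n. a n * q ^ n) has_field_derivative (\<Sum>n. diffs a n * q ^ n)) (at q within ball 0 1)"
      by (rule has_field_derivative_at_within, rule power_series_disc(1)[where a = a and q = q]) (erule sm, rule q)
  qed
qed

lemma modular_form_disc_form:
  assumes "f \<in> modular_forms k"
  obtains g where "disc_form k g" "\<And>z. Im z > 0 \<Longrightarrow> f z = g (qpar z)"
proof -
  have "\<exists>a. \<forall>z\<in>upper_half. (\<lambda>n. a n * qpar z ^ n) sums f z"
    using assms unfolding modular_forms_def by blast
  then obtain a where "\<forall>z\<in>upper_half. (\<lambda>n. a n * qpar z ^ n) sums f z"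
    by blast
  hence a: "\<And>z. Im z > 0 \<Longrightarrow> (\<lambda>n. a n * qpar z ^ n) sums f z"
    by simp
  define g where "g = (\<lambda>q. \<Sum>n. a n * q ^ n)"
  have fg: "f z = g (qpar z)" if "Im z > 0" for z
    using a[OF that] by (simp add: g_def sums_iff)
  have "f ((of_int 0 * z + of_int (-1)) / (of_int 1 * z + of_int 0)) = (of_int 1 * z + of_int 0) powi k * f z"
    if "Im z > 0" for z
    using assms that unfolding modular_forms_def mem_Collect_eq
    by (elim conjE allE[of _ "0::int"] allE[of _ "-1::int"] allE[of _ "1::int"]) auto
  hence "f (-1/z) = z powi k * f z" if "Im z > 0" for z
    using that by simp
  hence "g (qpar (-1/z)) = z powi k * g (qpar z)" if "Im z > 0" for z
    using that fg[OF that] fg[OF Im_minus_inverse_pos[OF that]] by metis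
  moreover have "g holomorphic_on ball 0 1"
    unfolding g_def using a by (intro disc_power_series) (auto simp: sums_iff)
  ultimately have "disc_form k g" by (simp add: disc_form_def)
  thus ?thesis using that fg by blast
qed

text \<open>The negative identity matrix fixes every z but multiplies the value by (-1)^k.\<close>

lemma modular_form_odd_weight:
  assumes "f \<in> modular_forms k" "odd k"
  shows "f = 0"
proof
  fix z
  show "f z = 0 z"
  proof (cases "Im z > 0")
    case True
    have "\<forall>a b c d :: int. a * d - b * c = 1 \<longrightarrow> (\<forall>z\<in>upper_half. f ((of_int a * z + of_int b) / (of_int c * z + of_int d)) =
             (of_int c * z + of_int d) powi k * f z)"
      using assms unfolding modular_forms_def by blast
    from this[rule_format, of "-1" "-1" 0 0 z] True have "f z = (-1) powi k * f z" by simp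
    thus ?thesis using assms(2) by (simp add: power_int_minus_left_odd)
  next
    case False
    thus ?thesis using assms(1) by (simp add: modular_forms_def)
  qed
qed

subsection \<open>Eisenstein series in the disc variable\<close>

definition eis :: "nat \<Rightarrow> complex \<Rightarrow> complex" where
  "eis m q = 1 - of_real (2 * of_nat m / bernoulli m) * sigma_series (m - 1) q"

lemma eisenstein_eq_eis: "eisenstein m z = eis m (qpar z)"
  by (simp add: eisenstein_def eis_def sigma_series_def)

lemma bernoulli_values:
  "bernoulli 2 = 1/6" "bernoulli 4 = -1/30" "bernoulli 6 = 1/42" "bernoulli 8 = -1/30" "bernoulli 10 = 5/66"
  by (simp_all add: eval_nat_numeral)

lemma divisor_sigma_0 [simp]: "divisor_sigma j 0 = 0"
  by (simp add: divisor_sigma_def)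

lemma divisor_sigma_1 [simp]: "divisor_sigma j (Suc 0) = 1"
  by (simp add: divisor_sigma_def)

lemma divisor_sigma_2: "divisor_sigma j 2 = 1 + 2 ^ j"
proof -
  have "{d :: nat. d dvd 2} = {1, 2}"
    using prime_nat_iff two_is_prime_nat by auto
  thus ?thesis by (simp add: divisor_sigma_def)
qed

lemma summable_divisor_sigma':
  "norm (q :: complex) < 1 \<Longrightarrow> summable (\<lambda>n. of_nat (divisor_sigma j n) * q ^ n)"
  by (rule summable_norm_cancel[OF summable_divisor_sigma])

lemma sigma_series_eq:
  assumes "norm q < 1"
  shows "sigma_series j q = (\<Sum>n. of_nat (divisor_sigma j n) * q ^ n)"
  using suminf_split_head[OF summable_divisor_sigma'[OF assms, of j]]
  by (simp add: sigma_series_def)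

lemma holomorphic_sigma_series: "sigma_series j holomorphic_on ball 0 1"
proof -
  have "(\<lambda>q. \<Sum>n. of_nat (divisor_sigma j n) * q ^ n) holomorphic_on ball 0 1"
    by (rule disc_power_series) (auto intro: summable_divisor_sigma')
  thus ?thesis
    by (rule holomorphic_transform) (simp add: sigma_series_eq)
qed

lemma holomorphic_eis: "eis m holomorphic_on ball 0 1"
  unfolding eis_def by (intro holomorphic_intros holomorphic_sigma_series)

lemma holomorphic_eisenstein: "eisenstein m holomorphic_on upper_half"
  unfolding eisenstein_eq_eis[abs_def] by (rule holomorphic_compose_qpar[OF holomorphic_eis])

lemma sigma_series_0 [simp]: "sigma_series j 0 = 0"
  by (simp add: sigma_series_def)

lemma eis_at_0 [simp]: "eis m 0 = 1"
  by (simp add: eis_def)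

lemma eis_2: "eis 2 q = 1 - 24 * sigma_series 1 q"
  by (simp add: eis_def bernoulli_values)

lemma eis_2_inversion:
  assumes "Im z > 0"
  shows "eis 2 (qpar (-1/z)) = z\<^sup>2 * eis 2 (qpar z) + 6 / (of_real pi * \<i>) * z"
proof -
  have *: "lattice_tail 2 w + int_zeta 2 = of_real (pi\<^sup>2 / 3) * eis 2 (qpar w)" for w
    by (simp add: lattice_tail_def int_zeta_2 eis_2 power_mult_distrib algebra_simps)
  \<comment> \<open>\<open>P\<close> is 2 zeta(2), the constant term of the lattice sum, and
    \<open>k\<close> is the anomaly -2 pi i divided by \<open>P\<close>.\<close>
  define P k where "P = complex_of_real (pi\<^sup>2 / 3)" and "k = 6 / (complex_of_real pi * \<i>)"
  have Pk: "P * k = - (\<tau>)"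
    by (simp add: P_def k_def field_simps power2_eq_square)
  have "P * eis 2 (qpar (-1/z)) = z\<^sup>2 * (P * eis 2 (qpar z)) - \<tau> * z"
    using lattice_tail_2_inversion[OF assms] unfolding * P_def .
  also have "\<dots> = z\<^sup>2 * (P * eis 2 (qpar z)) + (P * k) * z"
    by (simp add: Pk)
  also have "\<dots> = P * (z\<^sup>2 * eis 2 (qpar z) + k * z)"
    by (simp add: algebra_simps)
  finally show ?thesis unfolding k_def [symmetric]
    by (simp add: P_def)
qed

subsection \<open>The discriminant\<close>

text \<open>\<open>- 24 * delta_log q\<close> is the logarithm of \<open>\<Prod>n\<ge>1. (1 - q ^ n) ^ 24\<close>; the summand for \<open>n = 0\<close>
  is \<open>0 / 0 = 0\<close>.\<close>

definition delta_log :: "complex \<Rightarrow> complex" where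
  "delta_log q = (\<Sum>n. (of_nat (divisor_sigma 1 n) / of_nat n) * q ^ n)"

definition delta_unit :: "complex \<Rightarrow> complex" where
  "delta_unit q = exp (-24 * delta_log q)"

lemma delta_unit_nonzero [simp]: "delta_unit q \<noteq> 0"
  by (simp add: delta_unit_def)

lemma delta_log_summable: "norm q < 1 \<Longrightarrow> summable (\<lambda>n. (of_nat (divisor_sigma 1 n) / of_nat n) * q ^ n :: complex)"
proof (rule summable_comparison_test)
  assume "norm q < 1"
  thus "summable (\<lambda>n. norm (of_nat (divisor_sigma 1 n) * q ^ n))"
    by (rule summable_divisor_sigma)
  show "\<exists>N. \<forall>n\<ge>N. norm ((of_nat (divisor_sigma 1 n) / of_nat n) * q ^ n) \<le> norm (of_nat (divisor_sigma 1 n) * q ^ n)"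
  proof (intro exI[of _ 1] allI impI)
    fix n :: nat assume "n \<ge> 1"
    hence "real (divisor_sigma 1 n) / real n \<le> real (divisor_sigma 1 n) / 1"
      by (intro divide_left_mono) auto
    thus "norm ((of_nat (divisor_sigma 1 n) / of_nat n) * q ^ n) \<le> norm (of_nat (divisor_sigma 1 n) * q ^ n)"
      unfolding norm_mult norm_divide norm_of_nat by (intro mult_right_mono) auto
  qed
qed

lemma delta_log_deriv:
  assumes "norm q < 1"
  obtains D where "(delta_log has_field_derivative D) (at q)" "q * D = sigma_series 1 q"
proof
  show "(delta_log has_field_derivative (\<Sum>n. diffs (\<lambda>n. of_nat (divisor_sigma 1 n) / of_nat n) n * q ^ n)) (at q)"
    unfolding delta_log_def by (rule power_series_disc(1)) (rule delta_log_summable, assumption, rule assms)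
  have "q * (\<Sum>n. diffs (\<lambda>n. of_nat (divisor_sigma 1 n) / of_nat n) n * q ^ n) =
      (\<Sum>n. of_nat n * (of_nat (divisor_sigma 1 n) / of_nat n) * q ^ n)"
    by (rule power_series_disc(3)) (rule delta_log_summable, assumption, rule assms)
  also have "(\<lambda>n. of_nat n * (of_nat (divisor_sigma 1 n) / of_nat n) * q ^ n) = (\<lambda>n. of_nat (divisor_sigma 1 n) * q ^ n)"
    by (auto simp: fun_eq_iff)
  finally show "q * (\<Sum>n. diffs (\<lambda>n. of_nat (divisor_sigma 1 n) / of_nat n) n * q ^ n) = sigma_series 1 q"
    using assms by (simp add: sigma_series_eq)
qed

lemma holomorphic_delta_unit: "delta_unit holomorphic_on ball 0 1"
proof -
  have "delta_log holomorphic_on ball 0 1"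
    unfolding delta_log_def by (rule disc_power_series) (rule delta_log_summable, simp)
  thus ?thesis unfolding delta_unit_def by (intro holomorphic_intros)
qed

text \<open>The logarithmic derivative of the discriminant is \<open>\<tau>\<close> E_2: the factor
  q contributes 1, and q d/dq applied to -24 \<open>delta_log\<close> gives -24 times the divisor
  sum series.\<close>

lemma delta_deriv:
  assumes "Im z > 0"
  shows "((\<lambda>z. qpar z * delta_unit (qpar z)) has_field_derivative
     \<tau> * eis 2 (qpar z) * (qpar z * delta_unit (qpar z))) (at z)"
proof -
  obtain D where D: "(delta_log has_field_derivative D) (at (qpar z))" "qpar z * D = sigma_series 1 (qpar z)"
    using delta_log_deriv[OF norm_qpar_less_1[OF assms]] by blast
  have q: "(qpar has_field_derivative \<tau> * qpar z) (at z)"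
    using has_field_derivative_qpar[OF DERIV_ident, of z UNIV] by simp
  have "((\<lambda>z. delta_log (qpar z)) has_field_derivative D * (\<tau> * qpar z)) (at z)"
    by (rule DERIV_chain2[OF D(1) q])
  hence "((\<lambda>z. delta_log (qpar z)) has_field_derivative \<tau> * sigma_series 1 (qpar z)) (at z)"
    by (simp only: D(2)[symmetric] mult_ac)
  hence "((\<lambda>z. qpar z * exp (-24 * delta_log (qpar z))) has_field_derivative
      \<tau> * qpar z * exp (-24 * delta_log (qpar z)) +
      (exp (-24 * delta_log (qpar z)) * (-24 * (\<tau> * sigma_series 1 (qpar z)))) * qpar z) (at z)"
    by (auto intro!: derivative_eq_intros q)
  thus ?thesis
    by (simp add: delta_unit_def eis_2 algebra_simps)
qed

text \<open>The quotient of Delta(-1/z) by z^12 Delta(z) has derivative 0: the anomaly of E_2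
  contributes 12 / z, which is the logarithmic derivative of z^12. The constant is found at the
  fixed point i, where i^12 = 1.\<close>

lemma disc_form_delta: "disc_form 12 (\<lambda>q. q * delta_unit q)"
  unfolding disc_form_def
proof (intro conjI allI impI)
  show "(\<lambda>q. q * delta_unit q) holomorphic_on ball 0 1"
    by (intro holomorphic_intros holomorphic_delta_unit)
next
  define F where "F = (\<lambda>z. qpar z * delta_unit (qpar z))"
  define Q where "Q = (\<lambda>z. F (-1/z) / (z ^ 12 * F z))"
  have F0: "F z \<noteq> 0" for z by (simp add: F_def)
  have F': "(F has_field_derivative \<tau> * eis 2 (qpar z) * F z) (at z)" if "Im z > 0" for z
    unfolding F_def by (rule delta_deriv[OF that])
  have "(Q has_field_derivative 0) (at z within upper_half)" if "z \<in> upper_half" for z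
  proof -
    have z: "Im z > 0" "z \<noteq> 0" using that by auto
    let ?N = "(\<tau> * eis 2 (qpar (-1/z)) * F (-1/z) * (1 / z\<^sup>2))"
    let ?D = "(z ^ 12 * (\<tau> * eis 2 (qpar z) * F z) + 12 * z ^ 11 * F z)"
    have inv: "((\<lambda>z. -1/z) has_field_derivative 1 / z\<^sup>2) (at z)"
      using z by (auto intro!: derivative_eq_intros simp: power2_eq_square)
    have 1: "((\<lambda>z. F (-1/z)) has_field_derivative
        \<tau> * eis 2 (qpar (-1/z)) * F (-1/z) * (1 / z\<^sup>2)) (at z)"
      by (rule DERIV_chain2[OF F'[OF Im_minus_inverse_pos[OF z(1)]] inv])
    have e: "\<tau> * eis 2 (qpar (-1/z)) * (1 / z\<^sup>2) = \<tau> * eis 2 (qpar z) + 12 / z"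
      unfolding eis_2_inversion[OF z(1)] using z by (simp add: field_simps power2_eq_square)
    have 2: "((\<lambda>z. z ^ 12 * F z) has_field_derivative
        z ^ 12 * (\<tau> * eis 2 (qpar z) * F z) + 12 * z ^ 11 * F z) (at z)"
      by (auto intro!: derivative_eq_intros F' z(1))
    have "(Q has_field_derivative
       (?N * (z ^ 12 * F z) -
        F (-1/z) * ?D) /
        ((z ^ 12 * F z) * (z ^ 12 * F z))) (at z)"
      unfolding Q_def by (rule DERIV_divide[OF 1 2]) (use z F0 in auto)
    moreover have "?N * (z ^ 12 * F z) =
       F (-1/z) * ?D"
    proof -
      have "?N * (z ^ 12 * F z) =
         (\<tau> * eis 2 (qpar (-1/z)) * (1 / z\<^sup>2)) * (F (-1/z) * (z ^ 12 * F z))"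
        by (simp only: mult_ac)
      also have "\<dots> = (\<tau> * eis 2 (qpar z) + 12 / z) * (F (-1/z) * (z ^ 12 * F z))"
        unfolding e ..
      also have "\<dots> = F (-1/z) * ?D"
      proof -
        have "z ^ 12 = z * z ^ 11" by (simp add: eval_nat_numeral)
        thus ?thesis using z by (simp only:) (simp add: distrib_left distrib_right)
      qed
      finally show ?thesis .
    qed
    ultimately show ?thesis by (auto intro: has_field_derivative_at_within)
  qed
  then obtain c where c: "\<And>z. z \<in> upper_half \<Longrightarrow> Q z = c"
    using has_field_derivative_zero_constant[OF convex_upper_half, of Q] by blast
  have "F \<i> \<noteq> 0" by (rule F0)
  moreover have "-1 / \<i> = \<i>" by (simp add: divide_i)
  moreover have "\<i> ^ 12 = (1 :: complex)" by (simp add: eval_nat_numeral)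
  ultimately have "Q \<i> = 1" unfolding Q_def by simp
  hence "c = 1" using c[of \<i>] by simp
  fix z assume z: "Im z > 0"
  hence "z \<noteq> 0" by auto
  have "Q z = 1" using c[of z] \<open>c = 1\<close> z by simp
  hence "F (-1/z) = z ^ 12 * F z"
    using F0[of z] \<open>z \<noteq> 0\<close> unfolding Q_def by (simp add: divide_eq_eq)
  thus "qpar (-1/z) * delta_unit (qpar (-1/z)) = z powi 12 * (qpar z * delta_unit (qpar z))"
    by (simp add: F_def)
qed

subsection \<open>Forms of high vanishing order are zero\<close>

lemma disc_punctured_zero:
  assumes "w holomorphic_on ball 0 1" "\<And>q. q \<in> ball 0 1 - {0} \<Longrightarrow> w q = (0 :: complex)"
  shows "w 0 = 0"
proof -
  have "continuous (at 0) w"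
    using holomorphic_on_imp_continuous_on[OF assms(1)] by (simp add: continuous_on_eq_continuous_at)
  hence "(w \<longlongrightarrow> w 0) (at 0)" by (simp add: continuous_at)
  moreover have "(w \<longlongrightarrow> 0) (at 0)"
    by (rule tendsto_eventually, unfold eventually_at, rule exI[of _ 1]) (use assms(2) in auto)
  ultimately show ?thesis by (rule tendsto_unique[rotated]) auto
qed

text \<open>Comparison of \<open>g ^ 12\<close> with \<open>\<Delta> ^ K\<close>: the quotient has weight \<open>0\<close> and vanishes at the cusp,
  so its modulus attains its maximum inside the disc.\<close>

lemma high_order_vanishing:
  fixes K :: int
  assumes w: "w holomorphic_on ball 0 1"
    and inv: "\<And>z. Im z > 0 \<Longrightarrow> norm (qpar (-1/z) ^ m * w (qpar (-1/z))) = norm z powi K * norm (qpar z ^ m * w (qpar z))"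
    and K: "K < 12 * int m" and q: "q \<in> ball 0 1"
  shows "w q = 0"
proof -
  define N where "N = nat (12 * int m - K)"
  have N: "int N = 12 * int m - K" "N > 0" using K by (auto simp: N_def)
  \<comment> \<open>For nonzero q this is (q^m w)^12 / Delta^K. The powers of q are collected in the
    exponent \<open>N\<close> > 0, so \<open>G\<close> is holomorphic at q = 0 too and vanishes
    there.\<close>
  define G where "G = (\<lambda>q. q ^ N * w q ^ 12 * delta_unit q powi (-K))"
  have G: "G holomorphic_on ball 0 1"
    unfolding G_def by (intro holomorphic_intros w holomorphic_delta_unit holomorphic_on_power_int) auto
  have G_eq: "G q = (q ^ m * w q) ^ 12 * (q * delta_unit q) powi (-K)" if "q \<noteq> 0" for q
  proof -
    have "q ^ N = q powi (12 * int m + -K)"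
      using N by (metis diff_conv_add_uminus power_int_of_nat)
    also have "\<dots> = q powi (12 * int m) * q powi (-K)"
      using that by (subst power_int_add) auto
    also have "q powi (12 * int m) = (q ^ m) ^ 12"
      by (metis mult.commute of_nat_numeral of_nat_mult power_int_of_nat power_mult)
    finally show ?thesis
      by (simp only: G_def power_mult_distrib power_int_mult_distrib mult_ac)
  qed
  have G_inv: "norm (G (qpar (-1/z))) = norm (G (qpar z))" if z: "Im z > 0" for z
  proof -
    have z0: "norm z \<noteq> 0" using z by auto
    define g where "g = (\<lambda>z. norm (qpar z ^ m * w (qpar z)))"
    define d where "d = (\<lambda>z. norm (qpar z * delta_unit (qpar z)))"
    have n: "norm (G (qpar z)) = g z ^ 12 * d z powi (-K)" for z
      unfolding G_eq[OF qpar_nonzero] g_def d_def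
      by (simp only: norm_mult norm_power norm_power_int)
    have "d (-1/z) = norm z powi 12 * d z"
      using disc_form_inversion[OF disc_form_delta z] unfolding d_def
      by (simp only: norm_mult norm_power_int)
    moreover have "g (-1/z) = norm z powi K * g z"
      unfolding g_def by (rule inv[OF z])
    ultimately have "norm (G (qpar (-1/z))) = (norm z powi K * g z) ^ 12 * (norm z powi 12 * d z) powi (-K)"
      unfolding n by (simp only:)
    also have "\<dots> = ((norm z powi K) ^ 12 * (norm z powi 12) powi (-K)) * (g z ^ 12 * d z powi (-K))"
      by (simp only: power_mult_distrib power_int_mult_distrib mult_ac)
    also have "(norm z powi K) ^ 12 * (norm z powi 12) powi (-K) = norm z powi (K * 12 + 12 * (-K))"
    proof -
      have "norm z powi (K * 12 + 12 * (-K)) = norm z powi (K * 12) * norm z powi (12 * (-K))"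
        using z0 by (intro power_int_add) auto
      also have "\<dots> = (norm z powi K) powi 12 * (norm z powi 12) powi (-K)"
        unfolding power_int_mult ..
      finally show ?thesis by simp
    qed
    finally show ?thesis by (simp add: n)
  qed
  \<comment> \<open>The radius of the image of the line Im z = 1/2; by
    \<open>reduce_to_strip\<close>, every value of |G| on the punctured disc is already taken for
    |q| <= R.\<close>
  define R where "R = exp (-pi)"
  have R: "0 < R" "R < 1" by (auto simp: R_def)
  have "continuous_on (cball 0 R) (\<lambda>q. norm (G q))"
    using R by (intro continuous_on_norm holomorphic_on_imp_continuous_on holomorphic_on_subset[OF G]) auto
  then obtain q0 where q0: "q0 \<in> cball 0 R" "\<And>q. q \<in> cball 0 R \<Longrightarrow> norm (G q) \<le> norm (G q0)"
    using continuous_attains_sup[of "cball 0 R" "\<lambda>q. norm (G q)"] R by (auto simp del: mem_cball)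
  have max: "norm (G q) \<le> norm (G q0)" if "q \<in> ball 0 1" for q
  proof (cases "q = 0")
    case True
    thus ?thesis using N by (simp add: G_def zero_power)
  next
    case False
    from that have "norm q < 1" by simp
    from qpar_surj[OF False this] obtain z where z: "Im z > 0" "qpar z = q" by blast
    obtain z' where z': "Im z' \<ge> 1/2" "norm (G (qpar z')) = norm (G (qpar z))"
      using reduce_to_strip[where v = "\<lambda>q. norm (G q)", OF _ z(1)] G_inv by blast
    have "norm (qpar z') \<le> R" unfolding norm_qpar R_def using z'(1) by simp
    thus ?thesis using q0(2)[of "qpar z'"] z' z by simp
  qed
  have "G constant_on ball 0 1"
    by (rule maximum_modulus_principle[OF G, of "ball 0 1" q0]) (use q0(1) R max in auto)
  then obtain c where c: "\<And>q. q \<in> ball 0 1 \<Longrightarrow> G q = c" by (auto simp: constant_on_def)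
  have "c = 0" using c[of 0] N by (simp add: G_def zero_power)
  have w0: "w q = 0" if "q \<in> ball 0 1 - {0}" for q
    using c[of q] \<open>c = 0\<close> that by (auto simp: G_def power_int_eq_0_iff)
  have "w 0 = 0"
    by (rule disc_punctured_zero[OF w w0])
  with w0 q show ?thesis by (cases "q = 0") auto
qed

lemma holomorphic_divide_disc_variable:
  assumes "g holomorphic_on ball 0 1" "g 0 = (0 :: complex)"
  obtains w where "w holomorphic_on ball 0 1" "\<And>q. q \<in> ball 0 1 \<Longrightarrow> g q = q * w q"
proof
  show "(\<lambda>q. if q = 0 then deriv g 0 else (g q - g 0) / (q - 0)) holomorphic_on ball 0 1"
    by (rule pole_lemma[OF assms(1)]) auto
qed (use assms(2) in auto)

lemma disc_form_high_order:
  assumes g: "disc_form k g" and w: "w holomorphic_on ball 0 1"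
    and gw: "\<And>q. q \<in> ball 0 1 \<Longrightarrow> g q = q ^ m * w q" and k: "k < 12 * int m" and q: "q \<in> ball 0 1"
  shows "g q = 0"
proof -
  have "w q = 0"
  proof (rule high_order_vanishing[OF w _ k q])
    fix z assume z: "Im z > 0"
    have "g (qpar (-1/z)) = z powi k * g (qpar z)"
      by (rule disc_form_inversion[OF g z])
    moreover have "qpar (-1/z) \<in> ball 0 1" "qpar z \<in> ball 0 1"
      using norm_qpar_less_1[OF Im_minus_inverse_pos[OF z]] z by simp_all
    ultimately show "norm (qpar (-1/z) ^ m * w (qpar (-1/z))) = norm z powi k * norm (qpar z ^ m * w (qpar z))"
      by (metis gw norm_mult norm_power_int)
  qed
  thus ?thesis using gw[OF q] by simp
qed

lemma disc_form_negative_weight: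
  assumes "disc_form k g" "k < 0" "q \<in> ball 0 1"
  shows "g q = 0"
  by (rule disc_form_high_order[OF assms(1) disc_form_holomorphic[OF assms(1)], of 0]) (use assms in auto)

lemma disc_form_cusp:
  assumes "disc_form k g" "k < 12" "g 0 = 0" "q \<in> ball 0 1"
  shows "g q = 0"
proof -
  obtain w where "w holomorphic_on ball 0 1" "\<And>q. q \<in> ball 0 1 \<Longrightarrow> g q = q * w q"
    using holomorphic_divide_disc_variable[OF disc_form_holomorphic[OF assms(1)] assms(3)] by blast
  thus ?thesis
    by (intro disc_form_high_order[OF assms(1), of w 1]) (use assms in auto)
qed

section \<open>Modularity and normalisation of E_4, E_6, E_8 and E_10\<close>

lemma sigma_series_derivatives:
  obtains D where "\<And>q. norm q < 1 \<Longrightarrow> (sigma_series j has_field_derivative D q) (at q)"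
    "D 0 = 1" "(D has_field_derivative 2 * (1 + 2 ^ j)) (at 0)"
proof -
  define a where "a = (\<lambda>n. of_nat (divisor_sigma j n) :: complex)"
  have sm: "summable (\<lambda>n. a n * q ^ n)" if "norm q < 1" for q
    unfolding a_def by (rule summable_divisor_sigma'[OF that])
  have sm': "summable (\<lambda>n. diffs a n * q ^ n)" if "norm q < 1" for q
    by (rule power_series_disc(2)) (erule sm, rule that)
  show ?thesis
  proof (rule that[of "\<lambda>q. \<Sum>n. diffs a n * q ^ n"])
    fix q :: complex assume q: "norm q < 1"
    have "((\<lambda>q. \<Sum>n. a n * q ^ n) has_field_derivative (\<Sum>n. diffs a n * q ^ n)) (at q)"
      by (rule power_series_disc(1)) (erule sm, rule q)
    thus "(sigma_series j has_field_derivative (\<Sum>n. diffs a n * q ^ n)) (at q)"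
      by (rule has_field_derivative_transform_within_open[of _ _ _ "ball 0 1"])
         (use q in \<open>auto simp: sigma_series_eq a_def\<close>)
  next
    show "(\<Sum>n. diffs a n * 0 ^ n) = 1"
      by (simp only: powser_zero) (simp add: diffs_def a_def)
  next
    have "((\<lambda>q. \<Sum>n. diffs a n * q ^ n) has_field_derivative (\<Sum>n. diffs (diffs a) n * 0 ^ n)) (at 0)"
      by (rule power_series_disc(1)) (erule sm', simp)
    also have "(\<Sum>n. diffs (diffs a) n * 0 ^ n) = 2 * (1 + 2 ^ j)"
      using divisor_sigma_2[of j]
      by (simp only: powser_zero) (simp add: diffs_def a_def numeral_2_eq_2)
    finally show "((\<lambda>q. \<Sum>n. diffs a n * q ^ n) has_field_derivative 2 * (1 + 2 ^ j)) (at 0)" .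
  qed
qed

text \<open>The coefficients of q and q^2 are compared through the first two derivatives at 0; only
  sigma(1) = 1 and sigma(2) = 1 + 2^j enter.\<close>

lemma product_coefficients:
  assumes eq: "\<And>q. q \<in> ball 0 1 \<Longrightarrow>
    (1 + a * sigma_series i q) * (1 + b * sigma_series j q) = 1 + c * sigma_series k q"
  shows "a + b = c" "a * (1 + 2 ^ i) + b * (1 + 2 ^ j) + a * b = c * (1 + 2 ^ k)"
proof -
  obtain Di where Di: "\<And>q. norm q < 1 \<Longrightarrow> (sigma_series i has_field_derivative Di q) (at q)"
    "Di 0 = 1" "(Di has_field_derivative 2 * (1 + 2 ^ i)) (at 0)" using sigma_series_derivatives by blast
  obtain Dj where Dj: "\<And>q. norm q < 1 \<Longrightarrow> (sigma_series j has_field_derivative Dj q) (at q)"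
    "Dj 0 = 1" "(Dj has_field_derivative 2 * (1 + 2 ^ j)) (at 0)" using sigma_series_derivatives by blast
  obtain Dk where Dk: "\<And>q. norm q < 1 \<Longrightarrow> (sigma_series k has_field_derivative Dk q) (at q)"
    "Dk 0 = 1" "(Dk has_field_derivative 2 * (1 + 2 ^ k)) (at 0)" using sigma_series_derivatives by blast
  have deq: "a * Di q * (1 + b * sigma_series j q) + b * Dj q * (1 + a * sigma_series i q) = c * Dk q"
    if q: "q \<in> ball 0 1" for q
  proof (rule DERIV_unique)
    show "((\<lambda>q. (1 + a * sigma_series i q) * (1 + b * sigma_series j q)) has_field_derivative
        a * Di q * (1 + b * sigma_series j q) + b * Dj q * (1 + a * sigma_series i q)) (at q)"
      using q by (auto intro!: derivative_eq_intros Di(1) Dj(1))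
    have "((\<lambda>q. 1 + c * sigma_series k q) has_field_derivative c * Dk q) (at q)"
      using q by (auto intro!: derivative_eq_intros Dk(1))
    thus "((\<lambda>q. (1 + a * sigma_series i q) * (1 + b * sigma_series j q)) has_field_derivative c * Dk q) (at q)"
      by (rule has_field_derivative_transform_within_open[of _ _ _ "ball 0 1"]) (use q eq in auto)
  qed
  show "a + b = c" using deq[of 0] by (simp add: Di(2) Dj(2) Dk(2))
  have "a * (2 * (1 + 2 ^ i)) + 2 * (a * b) + b * (2 * (1 + 2 ^ j)) = c * (2 * (1 + 2 ^ k))"
  proof (rule DERIV_unique)
    show "((\<lambda>q. a * Di q * (1 + b * sigma_series j q) + b * Dj q * (1 + a * sigma_series i q)) has_field_derivative
        a * (2 * (1 + 2 ^ i)) + 2 * (a * b) + b * (2 * (1 + 2 ^ j))) (at 0)"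
      by (rule derivative_eq_intros Di(1,3) Dj(1,3) refl | simp)+ (simp add: Di(2) Dj(2))
    have "((\<lambda>q. c * Dk q) has_field_derivative c * (2 * (1 + 2 ^ k))) (at 0)"
      by (intro DERIV_cmult Dk(3))
    thus "((\<lambda>q. a * Di q * (1 + b * sigma_series j q) + b * Dj q * (1 + a * sigma_series i q)) has_field_derivative
        c * (2 * (1 + 2 ^ k))) (at 0)"
      by (rule has_field_derivative_transform_within_open[of _ _ _ "ball 0 1"]) (use deq in auto)
  qed
  hence "2 * (a * (1 + 2 ^ i) + b * (1 + 2 ^ j) + a * b) = 2 * (c * (1 + 2 ^ k))"
    by (simp add: algebra_simps)
  thus "a * (1 + 2 ^ i) + b * (1 + 2 ^ j) + a * b = c * (1 + 2 ^ k)"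
    by (metis mult_cancel_left zero_neq_numeral)
qed

text \<open>The constant term \<open>2 \<zeta>(k)\<close> of the lattice sum cannot vanish, because there are no cusp
  forms of weight below 12.\<close>

lemma disc_form_sigma_series:
  assumes "even k" "4 \<le> k" "k < 12"
  obtains \<beta> where "disc_form (int k) (\<lambda>q. 1 + \<beta> * sigma_series (k - 1) q)"
proof -
  define c where "c = 2 * (\<tau>) ^ k / fact (k - 1)"
  have c: "c \<noteq> 0" by (simp add: c_def)
  define F where "F = (\<lambda>q. int_zeta k + c * sigma_series (k - 1) q)"
  have F: "disc_form (int k) F"
    unfolding disc_form_def
  proof (intro conjI allI impI)
    show "F holomorphic_on ball 0 1"
      unfolding F_def by (intro holomorphic_intros holomorphic_sigma_series)
    show "F (qpar (-1/z)) = z powi int k * F (qpar z)" if "Im z > 0" for z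
      using lattice_tail_inversion[OF that assms(1,2)]
      unfolding F_def lattice_tail_def c_def by (simp only: add.commute power_int_of_nat)
  qed
  have z: "int_zeta k \<noteq> 0"
  proof
    assume "int_zeta k = 0"
    hence "F q = 0" if "q \<in> ball 0 1" for q
      using disc_form_cusp[OF F _ _ that] assms by (simp add: F_def)
    hence S0: "sigma_series (k - 1) q = 0" if "q \<in> ball 0 1" for q
      using that c \<open>int_zeta k = 0\<close> unfolding F_def by auto
    obtain D where D: "\<And>q. norm q < 1 \<Longrightarrow> (sigma_series (k - 1) has_field_derivative D q) (at q)"
      "D 0 = 1" using sigma_series_derivatives by blast
    have "((\<lambda>q. 0) has_field_derivative 1) (at (0::complex))"
      by (rule has_field_derivative_transform_within_open[of "sigma_series (k - 1)" _ _ "ball 0 1"])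
         (use S0 D(1)[of 0] D(2) in auto)
    thus False using DERIV_unique DERIV_const zero_neq_one by blast
  qed
  have "disc_form (int k) (\<lambda>q. 1 / int_zeta k * F q)"
    by (rule disc_form_cmult[OF F])
  also have "(\<lambda>q. 1 / int_zeta k * F q) = (\<lambda>q. 1 + (c / int_zeta k) * sigma_series (k - 1) q)"
    using z by (simp add: F_def fun_eq_iff field_simps)
  finally show ?thesis using that by blast
qed

lemma disc_forms_equal:
  assumes "disc_form k f" "disc_form k g" "k < 12" "f 0 = g 0" "q \<in> ball 0 1"
  shows "f q = g q"
  using disc_form_cusp[OF disc_form_diff[OF assms(1,2)] assms(3)] assms(4,5) by simp

text \<open>The normalising constants follow from \<open>E\<^sub>4\<^sup>2 = E\<^sub>8\<close> and \<open>E\<^sub>4 E\<^sub>6 = E\<^sub>1\<^sub>0\<close>, without evaluating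
  \<open>\<zeta>(k)\<close>.\<close>

lemma disc_form_eis:
  assumes "m \<in> {4, 6, 8, 10}"
  shows "disc_form (int m) (eis m)"
proof -
  obtain a where a: "disc_form 4 (\<lambda>q. 1 + a * sigma_series 3 q)"
    using disc_form_sigma_series[of 4] by auto
  obtain b where b: "disc_form 6 (\<lambda>q. 1 + b * sigma_series 5 q)"
    using disc_form_sigma_series[of 6] by auto
  obtain c where c: "disc_form 8 (\<lambda>q. 1 + c * sigma_series 7 q)"
    using disc_form_sigma_series[of 8] by auto
  obtain d where d: "disc_form 10 (\<lambda>q. 1 + d * sigma_series 9 q)"
    using disc_form_sigma_series[of 10] by auto
  have e1: "(1 + a * sigma_series 3 q) * (1 + a * sigma_series 3 q) = 1 + c * sigma_series 7 q"
    if "q \<in> ball 0 1" for q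
    using disc_forms_equal[of 8, OF _ c _ _ that] disc_form_mult[OF a a] by simp
  have ac: "a + a = c" "a * (1 + 2 ^ 3) + a * (1 + 2 ^ 3) + a * a = c * (1 + 2 ^ 7)"
    by (rule product_coefficients, erule e1)+
  have e2: "(1 + a * sigma_series 3 q) * (1 + b * sigma_series 5 q) = 1 + d * sigma_series 9 q"
    if "q \<in> ball 0 1" for q
    using disc_forms_equal[of 10, OF _ d _ _ that] disc_form_mult[OF a b] by simp
  have abd: "a + b = d" "a * (1 + 2 ^ 3) + b * (1 + 2 ^ 5) + a * b = d * (1 + 2 ^ 9)"
    by (rule product_coefficients, erule e2)+
  \<comment> \<open>Otherwise the constant 1 would have weight 4, but (2 i)^4 = 16.\<close>
  have "a \<noteq> 0"
  proof
    assume "a = 0"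
    hence "1 = (2 * \<i>) powi 4 * (1 :: complex)"
      using disc_form_inversion[OF a, of "2 * \<i>"] by simp
    thus False by (simp add: eval_nat_numeral)
  qed
  \<comment> \<open>The q^2 coefficients of E_4^2 = E_8 give 18 a + a^2 = 258 a; those of E_4 E_6 =
    E_10 then give b = -504.\<close>
  have "a * (a - 240) = (a * (1 + 2 ^ 3) + a * (1 + 2 ^ 3) + a * a) - (a + a) * (1 + 2 ^ 7)"
    by (simp add: algebra_simps)
  moreover have "a * (1 + 2 ^ 3) + a * (1 + 2 ^ 3) + a * a = (a + a) * (1 + 2 ^ 7)"
    using ac(2) unfolding ac(1) .
  ultimately have "a * (a - 240) = 0" by (simp only: diff_self)
  with \<open>a \<noteq> 0\<close> have a': "a = 240" by simp
  have "240 * (b + 504) = (a + b) * (1 + 2 ^ 9) - (a * (1 + 2 ^ 3) + b * (1 + 2 ^ 5) + a * b)"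
    unfolding a' by (simp add: algebra_simps)
  moreover have "a * (1 + 2 ^ 3) + b * (1 + 2 ^ 5) + a * b = (a + b) * (1 + 2 ^ 9)"
    using abd(2) unfolding abd(1) .
  ultimately have "240 * (b + 504) = 0" by (simp only: diff_self)
  hence "b + 504 = 0" by (simp only: mult_eq_0_iff) simp
  hence b': "b = -504" by (simp add: add_eq_0_iff2)
  have c': "c = 480" using ac(1) a' by simp
  have d': "d = -264" using abd(1) a' b' by simp
  have "eis 4 = (\<lambda>q. 1 + a * sigma_series 3 q)" "eis 6 = (\<lambda>q. 1 + b * sigma_series 5 q)"
    "eis 8 = (\<lambda>q. 1 + c * sigma_series 7 q)" "eis 10 = (\<lambda>q. 1 + d * sigma_series 9 q)"
    by (auto simp: fun_eq_iff eis_def bernoulli_values a' b' c' d')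
  thus ?thesis using assms a b c d by auto
qed

subsection \<open>Vector-valued forms of symmetric power type\<close>

text \<open>A family \<open>B\<close> of type \<open>(r, k)\<close> stands for the functions \<open>\<Sum>l\<le>r. B l z * (z - t) ^ (r - l)\<close>
  of weight \<open>k\<close>, \<open>t\<close> being a parameter on which the modular group acts as well.  For the
  (rescaled) companions of a quasimodular form \<open>f\<close> of weight \<open>w\<close> and depth \<open>r\<close>, \<open>k = w - r\<close>
  and \<open>B 0 = f\<close>.\<close>

definition sym_form :: "nat \<Rightarrow> int \<Rightarrow> (nat \<Rightarrow> complex \<Rightarrow> complex) \<Rightarrow> bool" where
  "sym_form r k B \<longleftrightarrow> (\<forall>l\<le>r. B l holomorphic_on upper_half) \<and>
     (\<forall>l\<le>r. \<forall>z. Im z > 0 \<longrightarrow> B l (-1/z) =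
        z powi k * (\<Sum>j\<le>r. of_nat (j choose l) * z powi (int r - int l - int j) * B j z))"

lemma sym_form_holomorphic: "sym_form r k B \<Longrightarrow> l \<le> r \<Longrightarrow> B l holomorphic_on upper_half"
  and sym_form_inversion: "sym_form r k B \<Longrightarrow> l \<le> r \<Longrightarrow> Im z > 0 \<Longrightarrow> B l (-1/z) =
        z powi k * (\<Sum>j\<le>r. of_nat (j choose l) * z powi (int r - int l - int j) * B j z)"
  unfolding sym_form_def by blast+

lemma sym_form_has_derivative:
  "sym_form r k B \<Longrightarrow> l \<le> r \<Longrightarrow> Im z > 0 \<Longrightarrow> (B l has_field_derivative deriv (B l) z) (at z)"
  using holomorphic_derivI[OF sym_form_holomorphic open_upper_half] by simp

lemma sym_form_add:
  assumes "sym_form r k B" "sym_form r k C"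
  shows "sym_form r k (\<lambda>l z. B l z + C l z)"
  unfolding sym_form_def
proof (intro conjI allI impI)
  fix l assume l: "l \<le> r"
  show "(\<lambda>z. B l z + C l z) holomorphic_on upper_half"
    using l by (intro holomorphic_intros sym_form_holomorphic[OF assms(1)] sym_form_holomorphic[OF assms(2)])
  fix z assume z: "Im z > 0"
  show "B l (-1/z) + C l (-1/z) =
      z powi k * (\<Sum>j\<le>r. of_nat (j choose l) * z powi (int r - int l - int j) * (B j z + C j z))"
    unfolding sym_form_inversion[OF assms(1) l z] sym_form_inversion[OF assms(2) l z]
    by (simp only: distrib_left sum.distrib)
qed

lemma sym_form_0: "sym_form r k (\<lambda>l z. 0)"
  by (simp add: sym_form_def)

lemma sym_form_sum:
  "(\<And>i. i \<in> I \<Longrightarrow> sym_form r k (B i)) \<Longrightarrow> sym_form r k (\<lambda>l z. \<Sum>i\<in>I. B i l z)"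
  by (induction I rule: infinite_finite_induct) (auto intro: sym_form_add simp: sym_form_0)

lemma sym_form_mult:
  assumes "disc_form m g" "sym_form r k B"
  shows "sym_form r (k + m) (\<lambda>l z. g (qpar z) * B l z)"
  unfolding sym_form_def
proof (intro conjI allI impI)
  fix l assume l: "l \<le> r"
  have "(\<lambda>z. g (qpar z)) holomorphic_on upper_half"
    by (intro holomorphic_compose_qpar disc_form_holomorphic[OF assms(1)])
  thus "(\<lambda>z. g (qpar z) * B l z) holomorphic_on upper_half"
    using l by (intro holomorphic_intros sym_form_holomorphic[OF assms(2)])
  fix z assume z: "Im z > 0"
  hence "z \<noteq> 0" by auto
  thus "g (qpar (-1/z)) * B l (-1/z) =
      z powi (k + m) * (\<Sum>j\<le>r. of_nat (j choose l) * z powi (int r - int l - int j) * (g (qpar z) * B j z))"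
    unfolding sym_form_inversion[OF assms(2) l z] disc_form_inversion[OF assms(1) z]
    by (simp add: power_int_add sum_distrib_left mult_ac)
qed

lemma sym_form_cmult: "sym_form r k B \<Longrightarrow> sym_form r k (\<lambda>l z. c * B l z)"
  using sym_form_mult[of 0 "\<lambda>_. c"] by (simp add: disc_form_def)

text \<open>The Serre derivative in z of the whole family at fixed t: differentiating (z - t)^(r + 1
  - l) moves component l - 1 to l with the factor r + 1 - l.\<close>

definition nabla :: "nat \<Rightarrow> int \<Rightarrow> (nat \<Rightarrow> complex \<Rightarrow> complex) \<Rightarrow> nat \<Rightarrow> complex \<Rightarrow> complex" where
  "nabla r k B l z = serre_deriv k (B l) z +
     (if l = 0 then 0 else of_nat (r + 1 - l) / (\<tau>) * B (l - 1) z)"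

text \<open>Pascal's rule and absorption. On the left are the terms from differentiating the powers
  of z in the inversion law and from the shift in \<open>nabla\<close>, on the right the coefficient
  that the new law demands.\<close>

lemma binomial_nabla_identity:
  assumes "l \<le> r" "i \<le> r"
  shows "of_nat (i choose l) * (of_nat r - of_nat l - of_nat i) +
     (if l = 0 then 0 else of_nat (r + 1 - l) * of_nat (i choose (l - 1))) =
     of_nat (Suc i choose l) * (of_nat r - of_nat i :: complex)"
proof (cases l)
  case (Suc m)
  have "of_nat (Suc m) * of_nat (i choose Suc m) = (of_nat i - of_nat m :: complex) * of_nat (i choose m)"
  proof (cases "m \<le> i")
    case True
    have "Suc m * (i choose Suc m) = (i - m) * (i choose m)"
      by (simp only: binomial_absorption binomial_absorb_comp)
    hence "(of_nat (Suc m * (i choose Suc m)) :: complex) = of_nat ((i - m) * (i choose m))"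
      by (rule arg_cong)
    thus ?thesis using True by (simp only: of_nat_mult of_nat_diff)
  qed (simp add: binomial_eq_0)
  thus ?thesis using Suc assms by (simp add: of_nat_diff algebra_simps)
qed simp

text \<open>Differentiating the inversion law leaves two kinds of excess terms. Those from z^k
  cancel against the anomaly of E_2, which is why the Serre derivative is taken in weight k; those
  from the other powers of z combine with the shift term.\<close>

lemma nabla_sym_form:
  assumes B: "sym_form r k B"
  shows "sym_form r (k + 2) (nabla r k B)"
  unfolding sym_form_def
proof (intro conjI allI impI)
  fix l assume l: "l \<le> r"
  have "(\<lambda>z. serre_deriv k (B l) z) holomorphic_on upper_half"
    unfolding serre_deriv_def using l
    by (intro holomorphic_intros holomorphic_deriv holomorphic_eisenstein sym_form_holomorphic[OF B]) auto
  moreover have "(\<lambda>z. if l = 0 then 0 else of_nat (r + 1 - l) / (\<tau>) * B (l - 1) z) holomorphic_on upper_half"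
    using l by (cases "l = 0") (auto intro!: holomorphic_intros sym_form_holomorphic[OF B])
  ultimately show "nabla r k B l holomorphic_on upper_half"
    unfolding nabla_def by (intro holomorphic_intros)
  fix z assume z: "Im z > 0"
  have z0: "z \<noteq> 0" using z by auto
  define t where "t = (\<lambda>j. z powi (int r - int l - int j))"
  define S0 where "S0 = (\<Sum>j\<le>r. of_nat (j choose l) * t j * B j z)"
  define S1 where "S1 = (\<Sum>j\<le>r. of_nat (j choose l) * t j * deriv (B j) z)"
  define S2 where "S2 = (\<Sum>j\<le>r. of_nat (j choose l) * (of_nat r - of_nat l - of_nat j) * t j * B j z)"
  define S3 where "S3 = (if l = 0 then 0 else \<Sum>j\<le>r. of_nat (r + 1 - l) * of_nat (j choose (l - 1)) * t j * B j z)"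
  define S4 where "S4 = (\<Sum>j\<le>r. of_nat (Suc j choose l) * (of_nat r - of_nat j) * t j * B j z)"
  define \<kappa> where "\<kappa> = 2 * complex_of_real pi * \<i>"
  have \<kappa>: "\<kappa> \<noteq> 0" by (simp add: \<kappa>_def)
  have S234: "S2 + S3 = S4"
  proof -
    have "S2 + S3 = (\<Sum>j\<le>r. (of_nat (j choose l) * (of_nat r - of_nat l - of_nat j) +
       (if l = 0 then 0 else of_nat (r + 1 - l) * of_nat (j choose (l - 1)))) * t j * B j z)"
      by (cases "l = 0") (simp_all add: S2_def S3_def sum.distrib [symmetric] distrib_right)
    also have "\<dots> = S4"
      unfolding S4_def by (intro sum.cong refl) (use binomial_nabla_identity[OF l] in auto)
    finally show ?thesis .
  qed
  have inv: "((\<lambda>z. -1/z) has_field_derivative 1 / z\<^sup>2) (at z)"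
    using z0 by (auto intro!: derivative_eq_intros simp: power2_eq_square)
  have 1: "((\<lambda>z. B l (-1/z)) has_field_derivative deriv (B l) (-1/z) * (1 / z\<^sup>2)) (at z)"
    by (rule DERIV_chain2[OF sym_form_has_derivative[OF B l Im_minus_inverse_pos[OF z]] inv])
  have "((\<lambda>z. z powi k * (\<Sum>j\<le>r. of_nat (j choose l) * z powi (int r - int l - int j) * B j z)) has_field_derivative
      of_int k * z powi (k - 1) * S0 + (\<Sum>j\<le>r. of_nat (j choose l) *
         (of_int (int r - int l - int j) * z powi (int r - int l - int j - 1) * B j z + deriv (B j) z * t j)) * z powi k) (at z)"
    unfolding S0_def t_def using z0
    by (auto intro!: derivative_eq_intros sym_form_has_derivative[OF B _ z] sum.cong simp: algebra_simps)
  also have "(\<Sum>j\<le>r. of_nat (j choose l) *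
         (of_int (int r - int l - int j) * z powi (int r - int l - int j - 1) * B j z + deriv (B j) z * t j)) = S2 / z + S1"
  proof -
    have "z powi (int r - int l - int j - 1) = t j / z" for j
      unfolding t_def using z0 by (simp add: power_int_diff)
    thus ?thesis
      unfolding S2_def S1_def sum_divide_distrib sum.distrib [symmetric]
      by (intro sum.cong refl) (simp add: algebra_simps add_divide_distrib diff_divide_distrib)
  qed
  also have "z powi (k - 1) = z powi k / z" using z0 by (simp add: power_int_diff)
  finally have "((\<lambda>z. z powi k * (\<Sum>j\<le>r. of_nat (j choose l) * z powi (int r - int l - int j) * B j z)) has_field_derivative
      of_int k * (z powi k / z) * S0 + (S2 / z + S1) * z powi k) (at z)" .
  hence "((\<lambda>z. B l (-1/z)) has_field_derivative
      of_int k * (z powi k / z) * S0 + (S2 / z + S1) * z powi k) (at z)"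
    by (rule has_field_derivative_transform_within_open[of _ _ _ upper_half])
       (use z sym_form_inversion[OF B l] in auto)
  from DERIV_unique[OF 1 this]
  have d: "deriv (B l) (-1/z) = z\<^sup>2 * (of_int k * (z powi k / z) * S0 + (S2 / z + S1) * z powi k)"
    using z0 by (simp add: divide_eq_eq mult.commute)
  have b: "B l (-1/z) = z powi k * S0"
    unfolding S0_def t_def by (rule sym_form_inversion[OF B l z])
  have b': "(if l = 0 then 0 else of_nat (r + 1 - l) / \<kappa> * B (l - 1) (-1/z)) = z powi k * z * S3 / \<kappa>"
  proof (cases "l = 0")
    case False
    have "B (l - 1) (-1/z) = z powi k * (\<Sum>j\<le>r. of_nat (j choose (l - 1)) * z powi (int r - int (l - 1) - int j) * B j z)"
      by (rule sym_form_inversion[OF B _ z]) (use l in auto)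
    also have "(\<Sum>j\<le>r. of_nat (j choose (l - 1)) * z powi (int r - int (l - 1) - int j) * B j z) =
       (\<Sum>j\<le>r. z * (of_nat (j choose (l - 1)) * t j * B j z))"
    proof (intro sum.cong refl)
      fix j
      have "z powi (int r - int (l - 1) - int j) = z powi ((int r - int l - int j) + 1)"
        using False by (intro arg_cong[of _ _ "power_int z"]) simp
      also have "\<dots> = t j * z" unfolding t_def using z0 by (simp add: power_int_add)
      finally show "of_nat (j choose (l - 1)) * z powi (int r - int (l - 1) - int j) * B j z =
        z * (of_nat (j choose (l - 1)) * t j * B j z)" by simp
    qed
    finally show ?thesis using False
      by (simp add: S3_def sum_distrib_left sum_divide_distrib mult_ac)
  qed (simp add: S3_def)
  have e: "eisenstein 2 (-1/z) = z\<^sup>2 * eisenstein 2 z + 12 / \<kappa> * z"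
    unfolding eisenstein_eq_eis eis_2_inversion[OF z] \<kappa>_def by simp
  \<comment> \<open>Here j = i + 1; the missing summand i = r of \<open>S4\<close> carries the
    factor r - i = 0.\<close>
  have shift: "(\<Sum>j\<le>r. of_nat (j choose l) * t j * (if j = 0 then 0 else of_nat (r + 1 - j) / \<kappa> * B (j - 1) z)) = S4 / z / \<kappa>"
  proof -
    have "(\<Sum>j\<le>r. of_nat (j choose l) * t j * (if j = 0 then 0 else of_nat (r + 1 - j) / \<kappa> * B (j - 1) z)) =
        (\<Sum>i<r. of_nat (Suc i choose l) * t (Suc i) * (of_nat (r - i) / \<kappa> * B i z))"
      unfolding lessThan_Suc_atMost [symmetric] by (subst sum.lessThan_Suc_shift) simp
    also have "\<dots> = (\<Sum>i<r. of_nat (Suc i choose l) * (of_nat r - of_nat i) * t i * B i z / z / \<kappa>)"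
    proof (intro sum.cong refl)
      fix i assume i: "i \<in> {..<r}"
      have "t (Suc i) = z powi ((int r - int l - int i) - 1)"
        unfolding t_def by (intro arg_cong[of _ _ "power_int z"]) simp
      also have "\<dots> = t i / z" unfolding t_def using z0 by (simp add: power_int_diff)
      finally show "of_nat (Suc i choose l) * t (Suc i) * (of_nat (r - i) / \<kappa> * B i z) =
        of_nat (Suc i choose l) * (of_nat r - of_nat i) * t i * B i z / z / \<kappa>"
        using i by (simp add: of_nat_diff)
    qed
    also have "\<dots> = (\<Sum>i\<le>r. of_nat (Suc i choose l) * (of_nat r - of_nat i) * t i * B i z / z / \<kappa>)"
      unfolding lessThan_Suc_atMost [symmetric] by simp
    also have "\<dots> = S4 / z / \<kappa>" by (simp add: S4_def sum_divide_distrib)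
    finally show ?thesis .
  qed
  have "(\<Sum>j\<le>r. of_nat (j choose l) * t j * nabla r k B j z) =
      S1 / \<kappa> - of_int k / 12 * eisenstein 2 z * S0 + S4 / z / \<kappa>"
    unfolding shift [symmetric] S1_def S0_def sum_divide_distrib sum_distrib_left sum_subtractf [symmetric] sum.distrib [symmetric]
    by (intro sum.cong refl) (simp add: nabla_def serre_deriv_def \<kappa>_def algebra_simps)
  moreover have "nabla r k B l (-1/z) = z powi k * z\<^sup>2 * (S1 / \<kappa> - of_int k / 12 * eisenstein 2 z * S0 + S4 / z / \<kappa>)"
    unfolding nabla_def serre_deriv_def \<kappa>_def [symmetric] d b b' e S234 [symmetric]
    using z0 \<kappa> by (simp add: field_simps power2_eq_square)
  moreover have "z powi (k + 2) = z powi k * z\<^sup>2"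
    using z0 by (simp add: power_int_add)
  ultimately show "nabla r k B l (-1/z) = z powi (k + 2) *
      (\<Sum>j\<le>r. of_nat (j choose l) * z powi (int r - int l - int j) * nabla r k B j z)"
    by (simp only: t_def)
qed

primrec nabla_iter :: "nat \<Rightarrow> int \<Rightarrow> nat \<Rightarrow> (nat \<Rightarrow> complex \<Rightarrow> complex) \<Rightarrow> nat \<Rightarrow> complex \<Rightarrow> complex" where
  "nabla_iter r k 0 B = B"
| "nabla_iter r k (Suc i) B = nabla r (k + 2 * int i) (nabla_iter r k i B)"

lemma nabla_iter_sym_form:
  assumes "sym_form r k B"
  shows "sym_form r (k + 2 * int i) (nabla_iter r k i B)"
proof (induction i)
  case (Suc i)
  have "k + 2 * int (Suc i) = k + 2 * int i + 2" by simp
  thus ?case unfolding nabla_iter.simps by (simp only: nabla_sym_form[OF Suc])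
qed (use assms in simp)

text \<open>No component is shifted into index 0, so the first component of an equation for the
  family is an equation in Serre derivatives of \<open>B 0\<close>.\<close>

lemma nabla_iter_0: "nabla_iter r k i B 0 = serre_iter k i (B 0)"
proof (induction i)
  case (Suc i)
  show ?case by (simp only: nabla_iter.simps serre_iter.simps Suc[symmetric]) (simp add: nabla_def fun_eq_iff)
qed simp

subsection \<open>Expansions at the cusp\<close>

text \<open>The orders are a parameter and need not be exact, since \<open>b l 0\<close> may be 0; a
  combination of derivatives can thus be given the orders \<open>lam\<close> at first and larger
  ones once its leading terms cancel.\<close>

definition disc_family :: "nat \<Rightarrow> (nat \<Rightarrow> nat) \<Rightarrow> (nat \<Rightarrow> complex \<Rightarrow> complex) \<Rightarrow> (nat \<Rightarrow> complex \<Rightarrow> complex) \<Rightarrow> bool" where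
  "disc_family r lam b B \<longleftrightarrow> (\<forall>l\<le>r. b l holomorphic_on ball 0 1 \<and>
     (\<forall>z. Im z > 0 \<longrightarrow> B l z = qpar z ^ lam l * b l (qpar z)))"

definition disc_nabla :: "nat \<Rightarrow> (nat \<Rightarrow> nat) \<Rightarrow> int \<Rightarrow> (nat \<Rightarrow> complex \<Rightarrow> complex) \<Rightarrow> nat \<Rightarrow> complex \<Rightarrow> complex" where
  "disc_nabla r lam k b l q = of_nat (lam l) * b l q + q * deriv (b l) q - of_int k / 12 * eis 2 q * b l q +
     (if l = 0 then 0 else of_nat (r + 1 - l) / (\<tau>) * q ^ (lam (l - 1) - lam l) * b (l - 1) q)"

text \<open>As \<open>lam\<close> does not increase, the component l - 1 that is added to component
  l vanishes at the cusp at least as strongly, so the order \<open>lam l\<close> is kept.\<close>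

lemma disc_family_nabla:
  assumes fam: "disc_family r lam b B" and lam: "\<And>l. l < r \<Longrightarrow> lam (Suc l) \<le> lam l"
  shows "disc_family r lam (disc_nabla r lam k b) (nabla r k B)"
  unfolding disc_family_def
proof (intro allI impI conjI)
  fix l assume l: "l \<le> r"
  have hol: "b i holomorphic_on ball 0 1" if "i \<le> r" for i
    using fam that by (auto simp: disc_family_def)
  have B: "B i z = qpar z ^ lam i * b i (qpar z)" if "i \<le> r" "Im z > 0" for i z
    using fam that by (auto simp: disc_family_def)
  have "(\<lambda>q. if l = 0 then 0 else of_nat (r + 1 - l) / (\<tau>) * q ^ (lam (l - 1) - lam l) * b (l - 1) q) holomorphic_on ball 0 1"
    using l by (cases "l = 0") (auto intro!: holomorphic_intros hol)
  thus "disc_nabla r lam k b l holomorphic_on ball 0 1"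
    unfolding disc_nabla_def by (intro holomorphic_intros hol holomorphic_deriv holomorphic_eis l) auto
  fix z assume z: "Im z > 0"
  define q where "q = qpar z"
  have q: "(qpar has_field_derivative \<tau> * q) (at z)"
    using has_field_derivative_qpar[OF DERIV_ident, of z UNIV] by (simp add: q_def)
  have "(b l has_field_derivative deriv (b l) q) (at q)"
    unfolding q_def using z by (intro holomorphic_derivI[OF hol[OF l]]) auto
  hence bq: "((\<lambda>z. b l (qpar z)) has_field_derivative deriv (b l) q * (\<tau> * q)) (at z)"
    unfolding q_def using q[unfolded q_def] by (rule DERIV_chain2)
  have "((\<lambda>z. qpar z ^ lam l * b l (qpar z)) has_field_derivative
      \<tau> * (q ^ lam l * (of_nat (lam l) * b l q + q * deriv (b l) q))) (at z)"
    by (rule derivative_eq_intros q bq refl)+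
       (cases "lam l", auto simp: q_def algebra_simps)
  hence "(B l has_field_derivative
      \<tau> * (q ^ lam l * (of_nat (lam l) * b l q + q * deriv (b l) q))) (at z)"
    by (rule has_field_derivative_transform_within_open[of _ _ _ upper_half]) (use z B[OF l] in auto)
  hence d: "deriv (B l) z / (\<tau>) = q ^ lam l * (of_nat (lam l) * b l q + q * deriv (b l) q)"
    by (simp add: DERIV_imp_deriv)
  have "q ^ lam (l - 1) = q ^ lam l * q ^ (lam (l - 1) - lam l)" if "l \<noteq> 0"
    using lam[of "l - 1"] that l by (simp flip: power_add)
  thus "nabla r k B l z = qpar z ^ lam l * disc_nabla r lam k b l (qpar z)"
    unfolding nabla_def disc_nabla_def serre_deriv_def d eisenstein_eq_eis q_def [symmetric]
    using l z by (auto simp: B q_def algebra_simps)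
qed

primrec disc_nabla_iter :: "nat \<Rightarrow> (nat \<Rightarrow> nat) \<Rightarrow> int \<Rightarrow> nat \<Rightarrow> (nat \<Rightarrow> complex \<Rightarrow> complex) \<Rightarrow> nat \<Rightarrow> complex \<Rightarrow> complex" where
  "disc_nabla_iter r lam k 0 b = b"
| "disc_nabla_iter r lam k (Suc i) b = disc_nabla r lam (k + 2 * int i) (disc_nabla_iter r lam k i b)"

lemma disc_family_nabla_iter:
  assumes "disc_family r lam b B" "\<And>l. l < r \<Longrightarrow> lam (Suc l) \<le> lam l"
  shows "disc_family r lam (disc_nabla_iter r lam k i b) (nabla_iter r k i B)"
  by (induction i) (simp_all add: assms disc_family_nabla)

subsection \<open>Determinants of function matrices\<close>

definition fdet :: "nat \<Rightarrow> (nat \<Rightarrow> nat \<Rightarrow> complex) \<Rightarrow> complex" where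
  "fdet n F = Determinant.det (Matrix.mat n n (\<lambda>(i, j). F i j))"

lemma fdet_leibniz:
  "fdet n F = (\<Sum>p | p permutes {0..<n}. signof p * (\<Prod>i = 0..<n. F i (p i)))"
proof -
  have "fdet n F = (\<Sum>p | p permutes {0..<n}. signof p *
      (\<Prod>i = 0..<n. Matrix.mat n n (\<lambda>(i, j). F i j) $$ (i, p i)))"
    unfolding fdet_def by (rule det_def') simp
  also have "\<dots> = (\<Sum>p | p permutes {0..<n}. signof p * (\<Prod>i = 0..<n. F i (p i)))"
  proof (rule sum.cong[OF refl])
    fix p assume p: "p \<in> {p. p permutes {0..<n}}"
    have "(\<Prod>i = 0..<n. Matrix.mat n n (\<lambda>(i, j). F i j) $$ (i, p i)) = (\<Prod>i = 0..<n. F i (p i))"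
    proof (rule prod.cong[OF refl])
      fix i assume i: "i \<in> {0..<n}"
      hence "p i \<in> {0..<n}" using p by (simp only: mem_Collect_eq permutes_in_image)
      thus "Matrix.mat n n (\<lambda>(i, j). F i j) $$ (i, p i) = F i (p i)" using i by simp
    qed
    thus "signof p * (\<Prod>i = 0..<n. Matrix.mat n n (\<lambda>(i, j). F i j) $$ (i, p i)) = signof p * (\<Prod>i = 0..<n. F i (p i))"
      by (simp only:)
  qed
  finally show ?thesis .
qed

lemma fdet_cong:
  assumes "\<And>i j. i < n \<Longrightarrow> j < n \<Longrightarrow> F i j = G i j"
  shows "fdet n F = fdet n G"
  unfolding fdet_def by (rule arg_cong[of _ _ Determinant.det]) (use assms in auto)

lemma fdet_0 [simp]: "fdet 0 F = 1"
  by (simp add: fdet_def)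

lemma fdet_mult: "fdet n (\<lambda>i j. \<Sum>k<n. F i k * G k j) = fdet n F * fdet n G"
proof -
  have "Matrix.mat n n (\<lambda>(i, j). \<Sum>k<n. F i k * G k j) =
      Matrix.mat n n (\<lambda>(i, j). F i j) * Matrix.mat n n (\<lambda>(i, j). G i j)"
    by (intro eq_matI) (auto simp: scalar_prod_def lessThan_atLeast0)
  thus ?thesis unfolding fdet_def by (simp only:) (rule det_mult, auto)
qed

lemma fdet_lower_triangular:
  assumes "\<And>i j. i < j \<Longrightarrow> j < n \<Longrightarrow> F i j = 0"
  shows "fdet n F = (\<Prod>i<n. F i i)"
  unfolding fdet_def
  by (subst det_lower_triangular[where n = n]) (use assms in \<open>auto simp: prod_list_diag_prod lessThan_atLeast0\<close>)

lemma fdet_column_scale: "fdet n (\<lambda>i j. c j * F i j) = (\<Prod>j<n. c j) * fdet n F"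
proof -
  have "(\<Prod>i = 0..<n. c (p i) * F i (p i)) = (\<Prod>j<n. c j) * (\<Prod>i = 0..<n. F i (p i))"
    if "p permutes {0..<n}" for p
    using prod.permute[OF that, of c] by (simp add: prod.distrib o_def lessThan_atLeast0)
  thus ?thesis
    unfolding fdet_leibniz sum_distrib_left by (intro sum.cong refl) (simp add: mult_ac)
qed

lemma fdet_row_scale: "fdet n (\<lambda>i j. c i * F i j) = (\<Prod>i<n. c i) * fdet n F"
  unfolding fdet_leibniz sum_distrib_left
  by (intro sum.cong refl) (simp add: prod.distrib lessThan_atLeast0 mult_ac)

lemma holomorphic_fdet:
  assumes "\<And>i j. i < n \<Longrightarrow> j < n \<Longrightarrow> F i j holomorphic_on S"
  shows "(\<lambda>z. fdet n (\<lambda>i j. F i j z)) holomorphic_on S"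
  unfolding fdet_leibniz
proof (intro holomorphic_intros)
  fix p i assume "p \<in> {p. p permutes {0..<n}}" "i \<in> {0..<n}"
  moreover from this have "p i \<in> {0..<n}" by (simp only: mem_Collect_eq permutes_in_image)
  ultimately show "F i (p i) holomorphic_on S" using assms by simp
qed

lemma fdet_kernel:
  assumes "fdet n F = 0"
  obtains v where "\<exists>j<n. v j \<noteq> 0" "\<And>i. i < n \<Longrightarrow> (\<Sum>j<n. v j * F i j) = 0"
proof -
  let ?A = "Matrix.mat n n (\<lambda>(i, j). F i j)"
  have "\<exists>v. v \<in> carrier_vec n \<and> v \<noteq> 0\<^sub>v n \<and> ?A *\<^sub>v v = 0\<^sub>v n"
    using assms unfolding fdet_def by (subst (asm) det_0_iff_vec_prod_zero[of _ n]) auto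
  then obtain v where v: "v \<in> carrier_vec n" "v \<noteq> 0\<^sub>v n" "?A *\<^sub>v v = 0\<^sub>v n" by blast
  have "\<exists>j<n. Matrix.vec_index v j \<noteq> 0"
    using v(1,2) by (metis carrier_vecD eq_vecI index_zero_vec)
  moreover have "(\<Sum>j<n. Matrix.vec_index v j * F i j) = 0" if i: "i < n" for i
  proof -
    have "Matrix.vec_index (?A *\<^sub>v v) i = 0" using v(3) i by simp
    thus ?thesis using i v(1) by (simp add: scalar_prod_def lessThan_atLeast0 mult.commute)
  qed
  ultimately show ?thesis using that by blast
qed

text \<open>Cofactors of the last column of a matrix of size n + 1: row i and column n are dropped.
  As functions of z they become the coefficients of a differential equation.\<close>

definition last_cofactor :: "nat \<Rightarrow> (nat \<Rightarrow> nat \<Rightarrow> complex) \<Rightarrow> nat \<Rightarrow> complex" where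
  "last_cofactor n F i = (-1) ^ (i + n) * fdet n (\<lambda>i' j'. F (if i' < i then i' else Suc i') j')"

lemma last_cofactor_last: "last_cofactor n F n = fdet n F"
  unfolding last_cofactor_def by (simp cong: fdet_cong)

text \<open>Entry (n, j) of adjugate times matrix: for j < n it is a determinant with column j
  repeated, for j = n the determinant itself, which is 0.\<close>

lemma last_cofactor_orthogonal:
  assumes "fdet (Suc n) F = 0" "j \<le> n"
  shows "(\<Sum>i\<le>n. last_cofactor n F i * F i j) = 0"
proof -
  let ?A = "Matrix.mat (Suc n) (Suc n) (\<lambda>(i, j). F i j)"
  have A: "?A \<in> carrier_mat (Suc n) (Suc n)" by simp
  have cof: "cofactor ?A i n = last_cofactor n F i" if "i \<le> n" for i
    unfolding cofactor_def last_cofactor_def fdet_def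
    by (intro arg_cong2[of _ _ _ _ "(*)"] refl arg_cong[of _ _ Determinant.det])
       (use that in \<open>auto simp: mat_delete_def\<close>)
  have "(adj_mat ?A * ?A) $$ (n, j) = 0"
    unfolding adj_mat(3)[OF A] using assms by (simp add: fdet_def)
  also have "(adj_mat ?A * ?A) $$ (n, j) = (\<Sum>i = 0..<Suc n. cofactor ?A i n * F i j)"
    using assms(2) by (simp add: adj_mat_def scalar_prod_def)
  also have "\<dots> = (\<Sum>i\<le>n. last_cofactor n F i * F i j)"
    using cof by (intro sum.cong) auto
  finally show ?thesis .
qed

subsection \<open>Wronskians\<close>

lemma serre_deriv_eqI:
  "(f has_field_derivative D) (at z) \<Longrightarrow>
   serre_deriv k f z = D / (\<tau>) - of_int k / 12 * eisenstein 2 z * f z"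
  by (simp add: serre_deriv_def DERIV_imp_deriv)

lemma holomorphic_serre_iter:
  assumes "f holomorphic_on upper_half"
  shows "serre_iter k i f holomorphic_on upper_half"
proof (induction i)
  case (Suc i)
  have "(\<lambda>z. serre_deriv (k + 2 * int i) (serre_iter k i f) z) holomorphic_on upper_half"
    unfolding serre_deriv_def
    by (intro holomorphic_intros holomorphic_deriv holomorphic_eisenstein Suc) auto
  thus ?case by simp
qed (use assms in simp)

lemma serre_iter_sum:
  assumes "\<And>j. j \<in> J \<Longrightarrow> \<phi> j holomorphic_on upper_half" "finite J" "Im z > 0"
  shows "serre_iter k i (\<lambda>z. \<Sum>j\<in>J. c j * \<phi> j z) z = (\<Sum>j\<in>J. c j * serre_iter k i (\<phi> j) z)"
  using assms(3)
proof (induction i arbitrary: z)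
  case (Suc i)
  let ?D = "\<Sum>j\<in>J. c j * deriv (serre_iter k i (\<phi> j)) z"
  have "((\<lambda>z. \<Sum>j\<in>J. c j * serre_iter k i (\<phi> j) z) has_field_derivative
      ?D) (at z)"
    by (intro DERIV_sum DERIV_cmult holomorphic_derivI[OF holomorphic_serre_iter[OF assms(1)] open_upper_half])
       (use Suc.prems in auto)
  hence "(serre_iter k i (\<lambda>z. \<Sum>j\<in>J. c j * \<phi> j z) has_field_derivative
      ?D) (at z)"
    by (rule has_field_derivative_transform_within_open[of _ _ _ upper_half]) (use Suc in auto)
  from serre_deriv_eqI[OF this, of "k + 2 * int i"]
  have "serre_iter k (Suc i) (\<lambda>z. \<Sum>j\<in>J. c j * \<phi> j z) z =
      ?D / (\<tau>) -
      of_int (k + 2 * int i) / 12 * eisenstein 2 z * (\<Sum>j\<in>J. c j * serre_iter k i (\<phi> j) z)"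
    by (simp only: serre_iter.simps Suc.IH[OF Suc.prems])
  also have "\<dots> = (\<Sum>j\<in>J. c j * serre_iter k (Suc i) (\<phi> j) z)"
    unfolding serre_iter.simps serre_deriv_def sum_distrib_left sum_divide_distrib sum_subtractf [symmetric]
    by (intro sum.cong refl) (simp only: right_diff_distrib times_divide_eq_right times_divide_eq_left mult_ac)
  finally show ?case .
qed simp

text \<open>Each Serre derivative lowers the order of the zero at \<open>z0\<close> by exactly one:
  differentiating the power does so with a nonzero factor, and the E_2 term does not lower the
  order.\<close>

lemma serre_iter_factor:
  assumes "ball z0 \<rho> \<subseteq> upper_half" "\<rho> > 0"
    and g: "g holomorphic_on ball z0 \<rho>" "g z0 \<noteq> 0"
    and u: "\<And>w. w \<in> ball z0 \<rho> \<Longrightarrow> u w = (w - z0) ^ m * g w"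
    and i: "i \<le> m"
  shows "\<exists>g. g holomorphic_on ball z0 \<rho> \<and> g z0 \<noteq> 0 \<and>
     (\<forall>w\<in>ball z0 \<rho>. serre_iter k i u w = (w - z0) ^ (m - i) * g w)"
  using i
proof (induction i)
  case 0
  thus ?case using g u by auto
next
  case (Suc i)
  then obtain h where h: "h holomorphic_on ball z0 \<rho>" "h z0 \<noteq> 0"
    "\<And>w. w \<in> ball z0 \<rho> \<Longrightarrow> serre_iter k i u w = (w - z0) ^ (m - i) * h w" by auto
  obtain p where p: "m - i = Suc p" "m - Suc i = p" using Suc.prems by (metis Suc_diff_Suc Suc_le_lessD)
  define K where "K = k + 2 * int i"
  define h' where "h' = (\<lambda>w. (of_nat (Suc p) * h w + (w - z0) * deriv h w) / (\<tau>) -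
      of_int K / 12 * eisenstein 2 w * ((w - z0) * h w))"
  have "h' holomorphic_on ball z0 \<rho>"
    unfolding h'_def
    by (intro holomorphic_intros h holomorphic_deriv holomorphic_on_subset[OF holomorphic_eisenstein assms(1)]) auto
  moreover have "h' z0 \<noteq> 0"
    using h(2) by (simp add: h'_def del: of_nat_Suc)
  moreover have "serre_iter k (Suc i) u w = (w - z0) ^ (m - Suc i) * h' w" if w: "w \<in> ball z0 \<rho>" for w
  proof -
    have "((\<lambda>w. (w - z0) ^ Suc p) has_field_derivative of_nat (Suc p) * (w - z0) ^ p) (at w)"
      by (auto intro!: derivative_eq_intros simp del: power_Suc of_nat_Suc)
    from DERIV_mult[OF this holomorphic_derivI[OF h(1) open_ball w]]
    have "(serre_iter k i u has_field_derivative
        of_nat (Suc p) * (w - z0) ^ p * h w + deriv h w * (w - z0) ^ Suc p) (at w)"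
      by (rule has_field_derivative_transform_within_open[of _ _ _ "ball z0 \<rho>"])
         (use w h(3) p in auto)
    from serre_deriv_eqI[OF this, of K]
    have "serre_deriv K (serre_iter k i u) w = (w - z0) ^ p * h' w"
      unfolding h(3)[OF w] p h'_def
      by (simp add: algebra_simps add_divide_distrib diff_divide_distrib del: of_nat_Suc)
    thus ?thesis by (simp only: serre_iter.simps p K_def)
  qed
  ultimately show ?case by blast
qed

text \<open>The cofactors of the last column give a differential equation satisfied by all \<open>\<phi> j\<close>; where its
  leading coefficient does not vanish, a combination of the \<open>\<phi> j\<close> with zero initial values is zero.\<close>

lemma serre_wronskian:
  assumes "\<And>j. j < n \<Longrightarrow> \<phi> j holomorphic_on upper_half"
    and "\<And>z. Im z > 0 \<Longrightarrow> fdet n (\<lambda>i j. serre_iter k i (\<phi> j) z) = 0"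
  shows "\<exists>c. (\<exists>j<n. c j \<noteq> 0) \<and> (\<forall>z. Im z > 0 \<longrightarrow> (\<Sum>j<n. c j * \<phi> j z) = 0)"
  using assms
proof (induction n)
  case 0
  from "0.prems"(2)[of \<i>] show ?case by simp
next
  case (Suc n)
  define M where "M = (\<lambda>z i j. serre_iter k i (\<phi> j) z)"
  have Mhol: "(\<lambda>z. M z i j) holomorphic_on upper_half" if "j \<le> n" for i j
    using holomorphic_serre_iter[OF Suc.prems(1)] that by (simp add: M_def)
  have det0: "fdet (Suc n) (M z) = 0" if "Im z > 0" for z
    using Suc.prems(2)[OF that] by (simp add: M_def)
  show ?case
  \<comment> \<open>If the leading minor vanishes everywhere, the first n functions are already
    dependent.\<close>
  proof (cases "\<forall>z. Im z > 0 \<longrightarrow> fdet n (M z) = 0")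
    case True
    have "\<exists>c. (\<exists>j<n. c j \<noteq> 0) \<and> (\<forall>z. Im z > 0 \<longrightarrow> (\<Sum>j<n. c j * \<phi> j z) = 0)"
    proof (rule Suc.IH)
      show "fdet n (\<lambda>i j. serre_iter k i (\<phi> j) z) = 0" if "Im z > 0" for z
        using True that by (simp add: M_def)
    qed (use Suc.prems(1) in simp)
    then obtain c where c: "\<exists>j<n. c j \<noteq> 0" "\<And>z. Im z > 0 \<Longrightarrow> (\<Sum>j<n. c j * \<phi> j z) = 0"
      by blast
    show ?thesis
    proof (intro exI[of _ "\<lambda>j. if j < n then c j else 0"] conjI allI impI)
      show "\<exists>j<Suc n. (if j < n then c j else 0) \<noteq> 0" using c(1) by auto
      show "(\<Sum>j<Suc n. (if j < n then c j else 0) * \<phi> j z) = 0" if "Im z > 0" for z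
        using c(2)[OF that] by simp
    qed
  next
    case False
    then obtain z0 where z0: "Im z0 > 0" "fdet n (M z0) \<noteq> 0" by blast
    \<comment> \<open>The kernel vector makes the Serre derivatives of orders 0 to n of the
      combination \<open>u\<close> vanish at \<open>z0\<close>.\<close>
    obtain c where c: "\<exists>j<Suc n. c j \<noteq> 0" "\<And>i. i < Suc n \<Longrightarrow> (\<Sum>j<Suc n. c j * M z0 i j) = 0"
      using fdet_kernel[OF det0[OF z0(1)]] by blast
    define u where "u = (\<lambda>z. \<Sum>j<Suc n. c j * \<phi> j z)"
    have u: "u holomorphic_on upper_half"
      unfolding u_def using Suc.prems(1) by (intro holomorphic_intros) auto
    have Du: "serre_iter k i u z = (\<Sum>j<Suc n. c j * M z i j)" if "Im z > 0" for i z
      unfolding u_def M_def by (rule serre_iter_sum) (use Suc.prems(1) that in auto)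
    have ode: "(\<Sum>i\<le>n. last_cofactor n (M z) i * serre_iter k i u z) = 0" if z: "Im z > 0" for z
    proof -
      have "(\<Sum>i\<le>n. last_cofactor n (M z) i * serre_iter k i u z) =
          (\<Sum>j<Suc n. c j * (\<Sum>i\<le>n. last_cofactor n (M z) i * M z i j))"
        unfolding Du[OF z] sum_distrib_left
        by (subst sum.swap) (simp add: mult_ac)
      also have "\<dots> = 0"
        using last_cofactor_orthogonal[OF det0[OF z]] by (intro sum.neutral) auto
      finally show ?thesis .
    qed
    have "u z = 0" if z: "Im z > 0" for z
    proof (rule ccontr)
      assume "u z \<noteq> 0"
      have "u z0 = 0" using Du[OF z0(1), of 0] c(2)[of 0] by simp
      hence "\<not> u constant_on upper_half"
        using \<open>u z \<noteq> 0\<close> z z0(1) unfolding constant_on_def by (metis upper_half_iff)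
      from holomorphic_factor_zero_nonconstant[OF u open_upper_half convex_connected[OF convex_upper_half] _ \<open>u z0 = 0\<close> this] z0(1)
      obtain g \<rho> m where g: "0 < m" "0 < \<rho>" "ball z0 \<rho> \<subseteq> upper_half" "g holomorphic_on ball z0 \<rho>"
        "\<And>w. w \<in> ball z0 \<rho> \<Longrightarrow> u w = (w - z0) ^ m * g w" "\<And>w. w \<in> ball z0 \<rho> \<Longrightarrow> g w \<noteq> 0"
        by (metis upper_half_iff)
      have g0: "g z0 \<noteq> 0" using g(2,6) by simp
      have ex: "\<exists>h. h holomorphic_on ball z0 \<rho> \<and> h z0 \<noteq> 0 \<and>
          (\<forall>w\<in>ball z0 \<rho>. serre_iter k i u w = (w - z0) ^ (m - i) * h w)" if "i \<le> m" for i
        by (rule serre_iter_factor[OF g(3,2,4) g0 g(5) that])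
      have "m > n"
      proof (rule ccontr)
        assume "\<not> m > n"
        obtain h where "h z0 \<noteq> 0" "\<forall>w\<in>ball z0 \<rho>. serre_iter k m u w = (w - z0) ^ (m - m) * h w"
          using ex[of m] by blast
        hence "serre_iter k m u z0 \<noteq> 0" using g(2) by simp
        moreover have "serre_iter k m u z0 = 0"
          using Du[OF z0(1), of m] c(2)[of m] \<open>\<not> m > n\<close> by simp
        ultimately show False by simp
      qed
      have "\<exists>h. \<forall>i\<le>n. h i holomorphic_on ball z0 \<rho> \<and> h i z0 \<noteq> 0 \<and>
          (\<forall>w\<in>ball z0 \<rho>. serre_iter k i u w = (w - z0) ^ (m - i) * h i w)"
        using ex \<open>m > n\<close> by (intro choice_iff'[THEN iffD1]) auto
      then obtain h where h: "\<And>i. i \<le> n \<Longrightarrow> h i holomorphic_on ball z0 \<rho>" "\<And>i. i \<le> n \<Longrightarrow> h i z0 \<noteq> 0"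
        "\<And>i w. i \<le> n \<Longrightarrow> w \<in> ball z0 \<rho> \<Longrightarrow> serre_iter k i u w = (w - z0) ^ (m - i) * h i w" by blast
      \<comment> \<open>The equation divided by (w - z0)^(m - n). At \<open>z0\<close> only the term
        i = n survives, and it is the nonzero minor times \<open>h n z0\<close>.\<close>
      define E where "E = (\<lambda>w. \<Sum>i\<le>n. last_cofactor n (M w) i * (w - z0) ^ (n - i) * h i w)"
      have cof: "(\<lambda>w. last_cofactor n (M w) i) holomorphic_on ball z0 \<rho>" for i
        unfolding last_cofactor_def
        by (intro holomorphic_intros holomorphic_fdet holomorphic_on_subset[OF Mhol g(3)]) auto
      have Ehol: "E holomorphic_on ball z0 \<rho>"
        unfolding E_def by (intro holomorphic_intros cof h(1)) auto
      have E0: "E w = 0" if w: "w \<in> ball z0 \<rho> - {z0}" for w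
      proof -
        have "(w - z0) ^ (m - n) * E w = (\<Sum>i\<le>n. last_cofactor n (M w) i * serre_iter k i u w)"
          unfolding E_def sum_distrib_left
        proof (intro sum.cong refl)
          fix i assume i: "i \<in> {..n}"
          have "(w - z0) ^ (m - i) = (w - z0) ^ (m - n) * (w - z0) ^ (n - i)"
            using i \<open>m > n\<close> by (simp flip: power_add)
          thus "(w - z0) ^ (m - n) * (last_cofactor n (M w) i * (w - z0) ^ (n - i) * h i w) =
              last_cofactor n (M w) i * serre_iter k i u w"
            using h(3)[of i w] i w by simp
        qed
        also have "\<dots> = 0" using w g(3) by (intro ode) auto
        finally show ?thesis using w by simp
      qed
      have "continuous (at z0) E"
        using holomorphic_on_imp_continuous_on[OF Ehol] g(2) by (simp add: continuous_on_eq_continuous_at)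
      hence "(E \<longlongrightarrow> E z0) (at z0)" by (simp add: continuous_at)
      moreover have "(E \<longlongrightarrow> 0) (at z0)"
        by (rule tendsto_eventually, unfold eventually_at, rule exI[of _ \<rho>])
           (use E0 g(2) in \<open>auto simp: dist_commute\<close>)
      ultimately have "E z0 = 0" by (rule tendsto_unique[rotated]) auto
      moreover have "E z0 = fdet n (M z0) * h n z0"
      proof -
        have "E z0 = (\<Sum>i\<in>{n}. last_cofactor n (M z0) i * (z0 - z0) ^ (n - i) * h i z0)"
          unfolding E_def by (rule sum.mono_neutral_right) auto
        thus ?thesis by (simp add: last_cofactor_last)
      qed
      ultimately show False using h(2)[of n] z0(2) by simp
    qed
    thus ?thesis using c(1) unfolding u_def by blast
  qed
qed

subsection \<open>Symmetric power forms of high vanishing order\<close>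

text \<open>The inversion acts on the columns by a lower triangular matrix with diagonal entries
  z^(r - 2 i), and row i has weight k + 2 i; each index therefore contributes z^(k + r).\<close>

lemma sym_wronskian_inversion:
  assumes B: "sym_form r k B" and z: "Im z > 0"
  shows "norm (fdet (Suc r) (\<lambda>i l. nabla_iter r k i B l (-1/z))) =
     norm z powi ((int r + 1) * (k + int r)) * norm (fdet (Suc r) (\<lambda>i l. nabla_iter r k i B l z))"
proof -
  have z0: "z \<noteq> 0" using z by auto
  define A where "A = (\<lambda>i l. nabla_iter r k i B l z)"
  define T where "T = (\<lambda>j l. of_nat (j choose l) * z powi (int r - int l - int j))"
  have "fdet (Suc r) (\<lambda>i l. nabla_iter r k i B l (-1/z)) =
      fdet (Suc r) (\<lambda>i l. z powi (k + 2 * int i) * (\<Sum>j<Suc r. A i j * T j l))"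
  proof (rule fdet_cong)
    fix i l assume l: "l < Suc r"
    have "nabla_iter r k i B l (-1/z) = z powi (k + 2 * int i) *
       (\<Sum>j\<le>r. of_nat (j choose l) * z powi (int r - int l - int j) * nabla_iter r k i B j z)"
      by (rule sym_form_inversion[OF nabla_iter_sym_form[OF B] _ z]) (use l in auto)
    also have "\<dots> = z powi (k + 2 * int i) * (\<Sum>j<Suc r. A i j * T j l)"
      unfolding lessThan_Suc_atMost A_def T_def by (simp only: mult_ac)
    finally show "nabla_iter r k i B l (-1/z) = z powi (k + 2 * int i) * (\<Sum>j<Suc r. A i j * T j l)" .
  qed
  also have "\<dots> = (\<Prod>i<Suc r. z powi (k + 2 * int i)) * (fdet (Suc r) A * fdet (Suc r) T)"
    by (simp only: fdet_row_scale fdet_mult)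
  also have "fdet (Suc r) T = (\<Prod>i<Suc r. z powi (int r - 2 * int i))"
  proof -
    have "fdet (Suc r) T = (\<Prod>i<Suc r. T i i)"
      by (rule fdet_lower_triangular) (simp add: T_def binomial_eq_0)
    also have "\<dots> = (\<Prod>i<Suc r. z powi (int r - 2 * int i))"
      by (intro prod.cong refl) (simp add: T_def)
    finally show ?thesis .
  qed
  also have "(\<Prod>i<Suc r. z powi (k + 2 * int i)) * (fdet (Suc r) A * (\<Prod>i<Suc r. z powi (int r - 2 * int i))) =
      (\<Prod>i<Suc r. z powi (k + 2 * int i) * z powi (int r - 2 * int i)) * fdet (Suc r) A"
    by (simp only: prod.distrib mult_ac)
  also have "(\<Prod>i<Suc r. z powi (k + 2 * int i) * z powi (int r - 2 * int i)) = (\<Prod>i<Suc r. z powi (k + int r))"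
  proof (intro prod.cong refl)
    fix i
    have "z powi (k + 2 * int i) * z powi (int r - 2 * int i) = z powi ((k + 2 * int i) + (int r - 2 * int i))"
      using z0 by (intro power_int_add [symmetric]) auto
    thus "z powi (k + 2 * int i) * z powi (int r - 2 * int i) = z powi (k + int r)" by simp
  qed
  also have "\<dots> = (z powi (k + int r)) powi (int r + 1)"
    by (simp add: power_int_add_1')
  also have "\<dots> = z powi ((int r + 1) * (k + int r))"
    by (simp only: power_int_mult [symmetric] mult.commute)
  finally show ?thesis by (simp only: norm_mult norm_power_int A_def)
qed

lemma sym_wronskian_zero:
  assumes B: "sym_form r k B" and b: "disc_family r lam b B" and lam: "\<And>l. l < r \<Longrightarrow> lam (Suc l) \<le> lam l"
    and order: "(int r + 1) * (k + int r) < 12 * int (\<Sum>l\<le>r. lam l)" and z: "Im z > 0"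
  shows "fdet (Suc r) (\<lambda>i l. nabla_iter r k i B l z) = 0"
proof -
  define w where "w = (\<lambda>q. fdet (Suc r) (\<lambda>i l. disc_nabla_iter r lam k i b l q))"
  have fam: "disc_family r lam (disc_nabla_iter r lam k i b) (nabla_iter r k i B)" for i
    by (rule disc_family_nabla_iter[OF b lam])
  have eq: "fdet (Suc r) (\<lambda>i l. nabla_iter r k i B l z) = qpar z ^ (\<Sum>l\<le>r. lam l) * w (qpar z)" if "Im z > 0" for z
  proof -
    have "fdet (Suc r) (\<lambda>i l. nabla_iter r k i B l z) =
        fdet (Suc r) (\<lambda>i l. qpar z ^ lam l * disc_nabla_iter r lam k i b l (qpar z))"
      by (rule fdet_cong) (use fam that in \<open>auto simp: disc_family_def\<close>)
    thus ?thesis by (simp only: fdet_column_scale w_def lessThan_Suc_atMost power_sum)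
  qed
  have "w holomorphic_on ball 0 1"
    unfolding w_def by (rule holomorphic_fdet) (use fam in \<open>auto simp: disc_family_def\<close>)
  moreover have "norm (qpar (-1/z) ^ (\<Sum>l\<le>r. lam l) * w (qpar (-1/z))) =
      norm z powi ((int r + 1) * (k + int r)) * norm (qpar z ^ (\<Sum>l\<le>r. lam l) * w (qpar z))" if "Im z > 0" for z
    using sym_wronskian_inversion[OF B that] unfolding eq[OF that] eq[OF Im_minus_inverse_pos[OF that]] .
  ultimately have "w (qpar z) = 0"
    by (rule high_order_vanishing[OF _ _ order]) (use z in auto)
  thus ?thesis by (simp add: eq[OF z])
qed

text \<open>The coefficients in \<open>-t\<close> of the polynomial \<open>\<Sum>l\<le>r. B l z * (z - t) ^ (r - l)\<close>.\<close>

definition shift_matrix :: "nat \<Rightarrow> complex \<Rightarrow> nat \<Rightarrow> nat \<Rightarrow> complex" where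
  "shift_matrix r z l j = (if l \<le> j then of_nat ((r - l) choose (j - l)) * z ^ (j - l) else 0)"

lemma shift_matrix_deriv:
  assumes "l \<le> r" "j \<le> r"
  shows "((\<lambda>z. shift_matrix r z l j) has_field_derivative
     (if l < r then of_nat (r - l) * shift_matrix r z (Suc l) j else 0)) (at z)"
proof (cases "l < j")
  case True
  then obtain p where p: "j - l = Suc p" "j - Suc l = p" by (metis Suc_diff_Suc)
  obtain s where s: "r - l = Suc s" "r - Suc l = s" using True assms by (metis Suc_diff_Suc order_less_le_trans)
  have "((\<lambda>z. of_nat (Suc s choose Suc p) * z ^ Suc p) has_field_derivative
      of_nat (Suc s choose Suc p) * (of_nat (Suc p) * z ^ p)) (at z)"
    by (auto intro!: derivative_eq_intros simp del: power_Suc of_nat_Suc binomial_Suc_Suc)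
  also have "of_nat (Suc s choose Suc p) * (of_nat (Suc p) * z ^ p) = of_nat (Suc p * (Suc s choose Suc p)) * z ^ p"
    by (simp only: of_nat_mult mult_ac)
  also have "Suc p * (Suc s choose Suc p) = Suc s * (s choose p)"
    by (rule Suc_times_binomial)
  also have "of_nat (Suc s * (s choose p)) * z ^ p = of_nat (Suc s) * (of_nat (s choose p) * z ^ p)"
    by (simp only: of_nat_mult mult.assoc)
  finally show ?thesis
    using True assms unfolding shift_matrix_def
    by (simp add: p s del: power_Suc of_nat_Suc binomial_Suc_Suc)
next
  case False
  hence "(\<lambda>z. shift_matrix r z l j) = (\<lambda>z. if l = j then 1 else 0)" "shift_matrix r z (Suc l) j = 0"
    by (auto simp: shift_matrix_def fun_eq_iff)
  thus ?thesis by simp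
qed

text \<open>As t is independent of z, the Serre derivative acts on the coefficients in t one by one;
  differentiating row l of \<open>shift_matrix\<close> yields the shift term of \<open>nabla\<close>
  at l + 1.\<close>

lemma serre_iter_shift:
  assumes B: "sym_form r k B" and z: "Im z > 0" and j: "j \<le> r"
  shows "serre_iter k i (\<lambda>z. \<Sum>l\<le>r. B l z * shift_matrix r z l j) z =
     (\<Sum>l\<le>r. nabla_iter r k i B l z * shift_matrix r z l j)"
  using z
proof (induction i arbitrary: z)
  case (Suc i)
  define C where "C = nabla_iter r k i B"
  define K where "K = k + 2 * int i"
  define U where "U = (\<lambda>l. shift_matrix r z l j)"
  define \<kappa> where "\<kappa> = 2 * complex_of_real pi * \<i>"
  let ?S = "\<Sum>l\<le>r. (if l < r then of_nat (r - l) * U (Suc l) else 0) * C l z / \<kappa>"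
  let ?R = "\<Sum>l\<le>r. (if l = 0 then 0 else of_nat (r + 1 - l) / \<kappa> * C (l - 1) z) * U l"
  let ?D = "\<Sum>l\<le>r. deriv (C l) z * U l + (if l < r then of_nat (r - l) * U (Suc l) else 0) * C l z"
  have C: "sym_form r K C" unfolding C_def K_def by (rule nabla_iter_sym_form[OF B])
  have "((\<lambda>z. \<Sum>l\<le>r. C l z * shift_matrix r z l j) has_field_derivative
      ?D) (at z)"
    unfolding U_def
    by (intro DERIV_sum DERIV_mult sym_form_has_derivative[OF C] shift_matrix_deriv Suc.prems) (use j in auto)
  hence "(serre_iter k i (\<lambda>z. \<Sum>l\<le>r. B l z * shift_matrix r z l j) has_field_derivative
      ?D) (at z)"
    by (rule has_field_derivative_transform_within_open[of _ _ _ upper_half])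
       (use Suc in \<open>auto simp: C_def\<close>)
  from serre_deriv_eqI[OF this, of K]
  have "serre_iter k (Suc i) (\<lambda>z. \<Sum>l\<le>r. B l z * shift_matrix r z l j) z =
     ?D / \<kappa> -
       of_int K / 12 * eisenstein 2 z * (\<Sum>l\<le>r. C l z * U l)"
    by (simp only: serre_iter.simps Suc.IH[OF Suc.prems] K_def C_def U_def \<kappa>_def)
  also have "\<dots> = (\<Sum>l\<le>r. serre_deriv K (C l) z * U l) +
      ?S"
    unfolding serre_deriv_def sum_divide_distrib sum_distrib_left sum_subtractf [symmetric] sum.distrib [symmetric]
    by (intro sum.cong refl) (simp add: \<kappa>_def algebra_simps add_divide_distrib)
  also have "?S =
     ?R"
  proof -
    have "?R =
        (\<Sum>l<r. of_nat (r - l) / \<kappa> * C l z * U (Suc l))"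
      unfolding lessThan_Suc_atMost [symmetric] by (subst sum.lessThan_Suc_shift) simp
    also have "\<dots> = (\<Sum>l<Suc r. (if l < r then of_nat (r - l) * U (Suc l) else 0) * C l z / \<kappa>)"
      by (simp add: mult_ac)
    finally show ?thesis unfolding lessThan_Suc_atMost ..
  qed
  also have "(\<Sum>l\<le>r. serre_deriv K (C l) z * U l) +
     ?R =
     (\<Sum>l\<le>r. nabla_iter r k (Suc i) B l z * U l)"
    unfolding sum.distrib [symmetric] nabla_iter.simps nabla_def C_def [symmetric] K_def [symmetric] \<kappa>_def [symmetric]
    by (intro sum.cong refl) (simp only: distrib_right)
  finally show ?case by (simp only: U_def)
qed simp

text \<open>The linear dependence is evaluated at z + N for all N. The \<open>B l\<close> have
  period 1, so it is a polynomial in z + N with fixed coefficients and infinitely many zeros. Let J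
  be the largest index with nonzero \<open>c J\<close>; the coefficient of degree J is
  \<open>B 0 z\<close> times \<open>c J\<close> and a binomial coefficient.\<close>

lemma sym_form_vanishing:
  assumes B: "sym_form r k B" and b: "disc_family r lam b B" and lam: "\<And>l. l < r \<Longrightarrow> lam (Suc l) \<le> lam l"
    and order: "(int r + 1) * (k + int r) < 12 * int (\<Sum>l\<le>r. lam l)" and z: "Im z > 0"
  shows "B 0 z = 0"
proof -
  define \<phi> where "\<phi> = (\<lambda>j z. \<Sum>l\<le>r. B l z * shift_matrix r z l j)"
  have "\<exists>c. (\<exists>j<Suc r. c j \<noteq> 0) \<and> (\<forall>z. Im z > 0 \<longrightarrow> (\<Sum>j<Suc r. c j * \<phi> j z) = 0)"
  proof (rule serre_wronskian)
    fix j assume j: "j < Suc r"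
    have "(\<lambda>z. shift_matrix r z l j) holomorphic_on upper_half" for l
      by (cases "l \<le> j") (auto simp: shift_matrix_def intro!: holomorphic_intros)
    thus "\<phi> j holomorphic_on upper_half"
      unfolding \<phi>_def by (intro holomorphic_intros sym_form_holomorphic[OF B]) auto
  next
    fix z assume z: "Im z > 0"
    have "fdet (Suc r) (\<lambda>i j. serre_iter k i (\<phi> j) z) =
        fdet (Suc r) (\<lambda>i j. \<Sum>l<Suc r. nabla_iter r k i B l z * shift_matrix r z l j)"
      unfolding \<phi>_def lessThan_Suc_atMost by (rule fdet_cong, rule serre_iter_shift[OF B z]) simp
    also have "\<dots> = 0"
      by (simp only: fdet_mult sym_wronskian_zero[OF B b lam order z] mult_zero_left)
    finally show "fdet (Suc r) (\<lambda>i j. serre_iter k i (\<phi> j) z) = 0" .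
  qed
  then obtain c where c: "\<exists>j<Suc r. c j \<noteq> 0" "\<And>z. Im z > 0 \<Longrightarrow> (\<Sum>j<Suc r. c j * \<phi> j z) = 0"
    by blast
  define J where "J = Max {j. j < Suc r \<and> c j \<noteq> 0}"
  have fin: "finite {j. j < Suc r \<and> c j \<noteq> 0}" by simp
  have J: "J < Suc r" "c J \<noteq> 0"
    using Max_in[OF fin] c(1) unfolding J_def by blast+
  have Jmax: "c j = 0" if "j < Suc r" "j > J" for j
    using Max_ge[OF fin, of j] that unfolding J_def by fastforce
  define p where "p = (\<Sum>j<Suc r. \<Sum>l\<le>r. if l \<le> j then
     monom (c j * B l z * of_nat ((r - l) choose (j - l))) (j - l) else 0)"
  have "poly p (z + of_nat N) = 0" for N
  proof -
    have per: "B l (z + of_nat N) = B l z" if "l \<le> r" for l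
      using b that z by (auto simp: disc_family_def)
    have "poly p (z + of_nat N) = (\<Sum>j<Suc r. c j * \<phi> j (z + of_nat N))"
      unfolding p_def \<phi>_def poly_sum sum_distrib_left
      by (intro sum.cong refl) (auto simp: poly_monom shift_matrix_def per)
    also have "\<dots> = 0" using z by (intro c(2)) auto
    finally show ?thesis .
  qed
  hence "range (\<lambda>N::nat. z + of_nat N) \<subseteq> {x. poly p x = 0}" by auto
  moreover have "infinite (range (\<lambda>N::nat. z + of_nat N))"
    by (rule range_inj_infinite) (auto simp: inj_on_def)
  ultimately have "p = 0" using poly_roots_finite infinite_super by blast
  hence "0 = coeff p J" by simp
  also have "coeff p J = (\<Sum>j<Suc r. \<Sum>l\<le>r. if j = J \<and> l = 0 then c J * B 0 z * of_nat (r choose J) else 0)"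
    unfolding p_def coeff_sum
  proof (intro sum.cong refl)
    fix j l assume j: "j \<in> {..<Suc r}" and l: "l \<in> {..r}"
    have "c j = 0" if "l \<le> j" "j - l = J" "l \<noteq> 0"
      by (rule Jmax) (use j that in auto)
    thus "coeff (if l \<le> j then monom (c j * B l z * of_nat ((r - l) choose (j - l))) (j - l) else 0) J =
       (if j = J \<and> l = 0 then c J * B 0 z * of_nat (r choose J) else 0)"
      by (cases "l = 0") auto
  qed
  also have "\<dots> = (\<Sum>j<Suc r. if j = J then c J * B 0 z * of_nat (r choose J) else 0)"
  proof (intro sum.cong refl)
    fix j
    show "(\<Sum>l\<le>r. if j = J \<and> l = 0 then c J * B 0 z * of_nat (r choose J) else 0) =
       (if j = J then c J * B 0 z * of_nat (r choose J) else 0)"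
      by (cases "j = J") auto
  qed
  also have "\<dots> = c J * B 0 z * of_nat (r choose J)"
    using J(1) by simp
  finally show ?thesis using J by simp
qed

subsection \<open>A lower bound for the dimension of spaces of quasimodular forms\<close>

text \<open>The monomials E_4^a and E_4^a E_6 reach every even weight m >= 0 except 2.\<close>

lemma exists_noncuspidal_form:
  assumes "even m" "m \<noteq> 2"
  shows "\<exists>X. disc_form (int m) X \<and> X 0 = 1"
proof -
  have E4: "disc_form 4 (eis 4)" and E6: "disc_form 6 (eis 6)"
    using disc_form_eis[of 4] disc_form_eis[of 6] by auto
  from assms have "(\<exists>a. m = 4 * a) \<or> (\<exists>a. m = 4 * a + 6)" by presburger
  thus ?thesis
  proof (elim disjE exE)
    fix a assume "m = 4 * a"
    thus ?thesis using disc_form_power[OF E4, of a]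
      by (intro exI[of _ "\<lambda>q. eis 4 q ^ a"]) (simp add: mult.commute)
  next
    fix a assume "m = 4 * a + 6"
    thus ?thesis using disc_form_mult[OF disc_form_power[OF E4, of a] E6]
      by (intro exI[of _ "\<lambda>q. eis 4 q ^ a * eis 6 q"]) (simp add: mult.commute)
  qed
qed

lemma delta_unit_0 [simp]: "delta_unit 0 = 1"
  unfolding delta_unit_def delta_log_def powser_zero by simp

lemma exists_form_of_order:
  assumes "even k" "12 * int i \<le> k" "k - 12 * int i \<noteq> 2"
  obtains u where "u holomorphic_on ball 0 1" "u 0 = 1" "disc_form k (\<lambda>q. q ^ i * u q)"
proof -
  define m where "m = nat (k - 12 * int i)"
  have m: "int m = k - 12 * int i" using assms by (simp add: m_def)
  have "even (int m)" unfolding m using assms(1) by simp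
  hence "even m" by simp
  moreover have "m \<noteq> 2" using m assms(3) by auto
  ultimately obtain X where X: "disc_form (int m) X" "X 0 = 1"
    using exists_noncuspidal_form by blast
  have "disc_form (int i * 12 + int m) (\<lambda>q. (q * delta_unit q) ^ i * X q)"
    by (intro disc_form_mult disc_form_power disc_form_delta X)
  also have "int i * 12 + int m = k" using m by simp
  also have "(\<lambda>q. (q * delta_unit q) ^ i * X q) = (\<lambda>q. q ^ i * (delta_unit q ^ i * X q))"
    by (simp add: fun_eq_iff power_mult_distrib mult_ac)
  finally have "disc_form k (\<lambda>q. q ^ i * (delta_unit q ^ i * X q))" .
  thus ?thesis
  proof (rule that[rotated 2])
    show "(\<lambda>q. delta_unit q ^ i * X q) holomorphic_on ball 0 1"
      by (intro holomorphic_intros holomorphic_delta_unit disc_form_holomorphic[OF X(1)])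
  qed (simp add: X)
qed

text \<open>Once the coefficients below i vanish, the sum may be divided by q^i and evaluated at q =
  0.\<close>

lemma distinct_orders_independent:
  assumes "\<And>i. i < d \<Longrightarrow> u i holomorphic_on ball 0 1" "\<And>i. i < d \<Longrightarrow> u i 0 = 1"
    and "\<And>z. Im z > 0 \<Longrightarrow> (\<Sum>i<d. c i * (qpar z ^ i * u i (qpar z))) = 0"
  shows "i < d \<Longrightarrow> c i = (0 :: complex)"
proof (induction i rule: less_induct)
  case (less i)
  define w where "w = (\<lambda>q. \<Sum>j<d. if j < i then 0 else c j * (q ^ (j - i) * u j q))"
  have "(\<lambda>q. if j < i then 0 else c j * (q ^ (j - i) * u j q)) holomorphic_on ball 0 1" if "j < d" for j
    using assms(1)[OF that] by (cases "j < i") (auto intro!: holomorphic_intros)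
  hence "w holomorphic_on ball 0 1"
    unfolding w_def by (intro holomorphic_intros) auto
  moreover have "w q = 0" if "q \<in> ball 0 1 - {0}" for q
  proof -
    have q: "q \<noteq> 0" "norm q < 1" using that by auto
    obtain z where z: "Im z > 0" "qpar z = q" by (rule qpar_surj[OF q])
    have "q ^ i * w q = (\<Sum>j<d. c j * (q ^ j * u j q))"
      unfolding w_def sum_distrib_left
    proof (intro sum.cong refl)
      fix j assume j: "j \<in> {..<d}"
      show "q ^ i * (if j < i then 0 else c j * (q ^ (j - i) * u j q)) = c j * (q ^ j * u j q)"
      proof (cases "j < i")
        case True
        thus ?thesis using less.IH[OF True] j by simp
      next
        case False
        hence "q ^ j = q ^ i * q ^ (j - i)" by (simp flip: power_add)
        thus ?thesis using False by simp
      qed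
    qed
    also have "\<dots> = 0" using assms(3)[OF z(1)] by (simp add: z)
    finally show ?thesis using q by simp
  qed
  ultimately have "w 0 = 0" by (rule disc_punctured_zero)
  moreover have "w 0 = c i"
  proof -
    have "w 0 = (\<Sum>j\<in>{i}. if j < i then 0 else c j * (0 ^ (j - i) * u j 0))"
      unfolding w_def using less.prems by (intro sum.mono_neutral_right) auto
    thus ?thesis using assms(2)[OF less.prems] by simp
  qed
  ultimately show ?case by simp
qed

text \<open>All points v = z + N have the same q. Inverting the relation at v turns E_2 into E_2 +
  \<open>\<kappa>\<close> / v up to powers of v, so a polynomial with coefficients
  \<open>H l (qpar z)\<close> has infinitely many zeros.\<close>

lemma eis_2_independent:
  assumes H: "\<And>l. l \<le> r \<Longrightarrow> disc_form (w - 2 * int l) (H l)"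
    and zero: "\<And>z. Im z > 0 \<Longrightarrow> (\<Sum>l\<le>r. eis 2 (qpar z) ^ l * H l (qpar z)) = 0"
    and z: "Im z > 0" and l: "l \<le> r"
  shows "H l (qpar z) = 0"
proof -
  define \<kappa> where "\<kappa> = 6 / (of_real pi * \<i>)"
  have \<kappa>: "\<kappa> \<noteq> 0" by (simp add: \<kappa>_def)
  define p where "p = (\<Sum>l\<le>r. monom (H l (qpar z)) l)"
  have root: "poly p (eis 2 (qpar z) + \<kappa> / v) = 0" if v: "Im v > 0" "qpar v = qpar z" for v
  proof -
    have v0: "v \<noteq> 0" using v by auto
    have "0 = (\<Sum>l\<le>r. eis 2 (qpar (-1/v)) ^ l * H l (qpar (-1/v)))"
      by (rule zero [symmetric]) (rule Im_minus_inverse_pos[OF v(1)])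
    also have "\<dots> = (\<Sum>l\<le>r. v powi w * (H l (qpar z) * (eis 2 (qpar z) + \<kappa> / v) ^ l))"
    proof (intro sum.cong refl)
      fix l assume "l \<in> {..r}"
      hence "H l (qpar (-1/v)) = v powi (w - 2 * int l) * H l (qpar z)"
        using disc_form_inversion[OF H v(1), of l] v by simp
      moreover have "v powi (w - 2 * int l) = v powi w / (v\<^sup>2) ^ l"
        using v0 by (simp add: power_int_diff power_int_mult)
      moreover have "eis 2 (qpar (-1/v)) = v\<^sup>2 * (eis 2 (qpar z) + \<kappa> / v)"
        unfolding eis_2_inversion[OF v(1)] v(2) \<kappa>_def [symmetric] using v0
        by (simp add: distrib_left power2_eq_square)
      ultimately show "eis 2 (qpar (-1/v)) ^ l * H l (qpar (-1/v)) =
          v powi w * (H l (qpar z) * (eis 2 (qpar z) + \<kappa> / v) ^ l)"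
        using v0 by (simp only: power_mult_distrib) simp
    qed
    also have "\<dots> = v powi w * poly p (eis 2 (qpar z) + \<kappa> / v)"
      by (simp add: p_def poly_sum poly_monom sum_distrib_left)
    finally show ?thesis using v0 by simp
  qed
  have "range (\<lambda>N::nat. eis 2 (qpar z) + \<kappa> / (z + of_nat N)) \<subseteq> {x. poly p x = 0}"
    using root[of "z + of_nat _"] z by auto
  moreover have "inj (\<lambda>N::nat. eis 2 (qpar z) + \<kappa> / (z + of_nat N))"
  proof (rule injI)
    fix M N :: nat
    have nz: "z + of_nat M \<noteq> 0" "z + of_nat N \<noteq> 0" using z by (auto simp: complex_eq_iff)
    assume "eis 2 (qpar z) + \<kappa> / (z + of_nat M) = eis 2 (qpar z) + \<kappa> / (z + of_nat N)"
    hence "\<kappa> * (z + of_nat N) = \<kappa> * (z + of_nat M)" using nz by (simp add: divide_eq_eq eq_divide_eq)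
    thus "M = N" using \<kappa> by simp
  qed
  hence "infinite (range (\<lambda>N::nat. eis 2 (qpar z) + \<kappa> / (z + of_nat N)))"
    by (rule range_inj_infinite)
  ultimately have "p = 0" using poly_roots_finite infinite_super by blast
  hence "0 = coeff p l" by simp
  also have "\<dots> = H l (qpar z)" using l by (simp add: p_def coeff_sum if_distrib cong: if_cong)
  finally show ?thesis by simp
qed

lemma sum_fun_apply: "(\<Sum>i\<in>I. F i) z = (\<Sum>i\<in>I. F i z)"
  by (induction I rule: infinite_finite_induct) auto

text \<open>\<open>cfun.dim\<close> is the cardinality of a basis and hence 0 for an infinite one;
  its positivity certifies that the dimension is finite.\<close>

lemma card_le_dim:
  assumes fin: "finite I" and V: "\<And>i. i \<in> I \<Longrightarrow> F i \<in> V" and dim: "cfun.dim V > 0"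
    and ind: "\<And>c i. (\<And>z. (\<Sum>i\<in>I. c i * F i z) = 0) \<Longrightarrow> i \<in> I \<Longrightarrow> c i = (0::complex)"
  shows "card I \<le> cfun.dim V"
proof -
  have inj: "inj_on F I"
  proof (rule inj_onI, rule ccontr)
    fix i j assume ij: "i \<in> I" "j \<in> I" "F i = F j" "i \<noteq> j"
    define c where "c = (\<lambda>x. if x = i then 1 else if x = j then -1 else (0::complex))"
    have "(\<Sum>x\<in>I. c x * F x z) = 0" for z
    proof -
      have "(\<Sum>x\<in>I. c x * F x z) = (\<Sum>x\<in>{i, j}. c x * F x z)"
        by (rule sum.mono_neutral_right) (use fin ij in \<open>auto simp: c_def\<close>)
      thus ?thesis using ij by (simp add: c_def)
    qed
    from ind[OF this ij(1)] show False by (simp add: c_def)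
  qed
  have "cfun.independent (F ` I)"
  proof (rule cfun.independent_if_scalars_zero)
    fix c x assume s: "(\<Sum>x\<in>F ` I. (\<lambda>z. c x * x z)) = 0" and x: "x \<in> F ` I"
    obtain i where i: "i \<in> I" "x = F i" using x by auto
    have "(\<Sum>i\<in>I. c (F i) * F i z) = 0" for z
    proof -
      have "(\<Sum>x\<in>F ` I. c x * x z) = 0"
        using fun_cong[OF s, of z] by (simp add: sum_fun_apply)
      thus ?thesis by (simp add: sum.reindex[OF inj])
    qed
    from ind[OF this i(1)] show "c x = 0" using i by simp
  qed (use fin in auto)
  moreover obtain b where b: "b \<subseteq> V" "cfun.independent b" "V \<subseteq> cfun.span b" "card b = cfun.dim V"
    using cfun.basis_exists by blast
  have "finite b" using b(4) dim by (auto intro: card_ge_0_finite)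
  ultimately have "card (F ` I) \<le> card b"
    using cfun.independent_span_bound[of b "F ` I"] V b(3) by blast
  thus ?thesis using b(4) inj by (simp add: card_image)
qed

text \<open>The exact dimension of the space of modular forms of even weight \<open>k \<ge> 0\<close>.\<close>

definition form_count :: "int \<Rightarrow> nat" where
  "form_count k = nat (if k mod 12 = 2 then k div 12 else k div 12 + 1)"

lemma form_count_less:
  assumes "k \<ge> 0" "i < form_count k"
  shows "12 * int i \<le> k" "k - 12 * int i \<noteq> 2"
proof -
  have *: "int i < (if k mod 12 = 2 then k div 12 else k div 12 + 1)"
    using assms unfolding form_count_def by simp
  thus "12 * int i \<le> k" by (simp split: if_splits)
  show "k - 12 * int i \<noteq> 2"
  proof
    assume "k - 12 * int i = 2"
    hence "k = 2 + 12 * int i" by simp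
    hence "k mod 12 = 2" "k div 12 = int i" by simp_all
    thus False using * by simp
  qed
qed

text \<open>The products of E_2^l with forms of weight w - 2 l of distinct orders at the cusp are
  independent: E_2 separates different l, the orders separate the forms for the same l.\<close>

lemma quasimodular_dim_ge:
  assumes w: "even w" "2 * int r \<le> w" and dim: "cfun.dim (quasimodular_forms w r) > 0"
  shows "(\<Sum>l\<le>r. form_count (w - 2 * int l)) \<le> cfun.dim (quasimodular_forms w r)"
proof -
  define I where "I = (SIGMA l:{..r}. {..<form_count (w - 2 * int l)})"
  define P where "P = (\<lambda>l i u. u holomorphic_on ball 0 1 \<and> u 0 = (1::complex) \<and> disc_form (w - 2 * int l) (\<lambda>q. q ^ i * u q))"
  define u where "u = (\<lambda>l i. SOME u. P l i u)"
  have P: "P l i (u l i)" if "l \<le> r" "i < form_count (w - 2 * int l)" for l i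
  proof -
    have "w - 2 * int l \<ge> 0" "even (w - 2 * int l)" using w that(1) by simp_all
    from exists_form_of_order[OF this(2) form_count_less[OF this(1) that(2)]]
    have "\<exists>u. P l i u" unfolding P_def by blast
    thus ?thesis unfolding u_def by (rule someI_ex)
  qed
  have u: "u l i holomorphic_on ball 0 1" "u l i 0 = 1" "disc_form (w - 2 * int l) (\<lambda>q. q ^ i * u l i q)"
    if "l \<le> r" "i < form_count (w - 2 * int l)" for l i
    using P[OF that] unfolding P_def by blast+
  define g where "g = (\<lambda>l i q. q ^ i * u l i q)"
  define h where "h = (\<lambda>l i z. if Im z > 0 then g l i (qpar z) else 0)"
  define F where "F = (\<lambda>(l, i) z. eisenstein 2 z ^ l * h l i z)"
  have "card I \<le> cfun.dim (quasimodular_forms w r)"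
  proof (rule card_le_dim[where F = F])
    show "finite I" by (auto simp: I_def)
    fix p assume "p \<in> I"
    then obtain l i where p: "p = (l, i)" "l \<le> r" "i < form_count (w - 2 * int l)" by (auto simp: I_def)
    have even: "even (w - 2 * int j)" for j using w(1) by simp
    have "h l i \<in> modular_forms (w - 2 * int l)"
      unfolding h_def g_def by (rule disc_form_modular_form[OF u(3)[OF p(2,3)] even])
    moreover have "(\<lambda>z. 0) \<in> modular_forms (w - 2 * int j)" for j
      using disc_form_modular_form[OF disc_form_0 even[of j]] by simp
    ultimately have "\<forall>j\<le>r. (if j = l then h l i else (\<lambda>z. 0)) \<in> modular_forms (w - 2 * int j)"
      by auto
    moreover have "F p = (\<lambda>z. \<Sum>j\<le>r. eisenstein 2 z ^ j * (if j = l then h l i else (\<lambda>z. 0)) z)"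
    proof
      fix z
      have "(\<Sum>j\<le>r. eisenstein 2 z ^ j * (if j = l then h l i else (\<lambda>z. 0)) z) =
          (\<Sum>j\<le>r. if j = l then eisenstein 2 z ^ l * h l i z else 0)"
        by (intro sum.cong) auto
      thus "F p z = (\<Sum>j\<le>r. eisenstein 2 z ^ j * (if j = l then h l i else (\<lambda>z. 0)) z)"
        using p(2) by (simp add: F_def p(1))
    qed
    ultimately have "E2_decomposition w r (\<lambda>j. if j = l then h l i else (\<lambda>z. 0)) (F p)"
      unfolding E2_decomposition_def by blast
    thus "F p \<in> quasimodular_forms w r" unfolding quasimodular_forms_def by blast
  next
    fix c p assume c: "\<And>z. (\<Sum>p\<in>I. c p * F p z) = 0" and p: "p \<in> I"
    define H where "H = (\<lambda>l q. \<Sum>i<form_count (w - 2 * int l). c (l, i) * g l i q)"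
    have H: "disc_form (w - 2 * int l) (H l)" if "l \<le> r" for l
      unfolding H_def by (intro disc_form_sum disc_form_cmult) (use u(3) that in \<open>auto simp: g_def\<close>)
    have "(\<Sum>l\<le>r. eis 2 (qpar z) ^ l * H l (qpar z)) = 0" if z: "Im z > 0" for z
    proof -
      have "(\<Sum>l\<le>r. eis 2 (qpar z) ^ l * H l (qpar z)) =
          (\<Sum>l\<le>r. \<Sum>i<form_count (w - 2 * int l). c (l, i) * F (l, i) z)"
        unfolding H_def sum_distrib_left F_def h_def eisenstein_eq_eis using z
        by (intro sum.cong refl) simp
      also have "\<dots> = (\<Sum>p\<in>I. c p * F p z)"
        unfolding I_def by (subst sum.Sigma) auto
      finally show ?thesis using c by simp
    qed
    note H0 = eis_2_independent[OF H this]
    obtain l i where li: "p = (l, i)" "l \<le> r" "i < form_count (w - 2 * int l)" using p by (auto simp: I_def)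
    have "c (l, i) = 0"
    proof (rule distinct_orders_independent[of "form_count (w - 2 * int l)" "u l" "\<lambda>i. c (l, i)"])
      fix z assume "Im z > 0"
      from H0[OF _ _ this li(2)] show "(\<Sum>i<form_count (w - 2 * int l). c (l, i) * (qpar z ^ i * u l i (qpar z))) = 0"
        unfolding H_def g_def by blast
    qed (use u li in auto)
    thus "c p = 0" by (simp add: li)
  qed fact
  thus ?thesis by (simp add: I_def)
qed

lemma form_count_eq:
  assumes "0 \<le> s" "s < 12" "k = 12 * q + s" "k \<ge> 0"
  shows "int (form_count k) = (if s = 2 then q else q + 1)"
proof -
  have "k div 12 = q" "k mod 12 = s" using assms by simp_all
  moreover have "q \<ge> 0" using assms by linarith
  ultimately show ?thesis unfolding form_count_def by simp
qed

text \<open>The cases correspond to the residues \<open>w mod 12\<close> that are compatible with \<open>12 dvd (r + 1) * w\<close>.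
  The inequality fails for \<open>r = 5\<close>.\<close>

lemma form_count_sum:
  assumes "r \<le> 4" "even w" "2 * int r \<le> w" "12 dvd (int r + 1) * w"
  shows "(int r + 1) * w + 12 \<le> 12 * int (\<Sum>l\<le>r. form_count (w - 2 * int l))"
proof -
  define q where "q = w div 12"
  define d where "d = (\<lambda>l. int (form_count (w - 2 * int l)))"
  \<comment> \<open>Each instance records a division w - 2 l = 12 q' + s with remainder s; only the
    remainder 2 costs a form.\<close>
  have d: "d l = (if s = 2 then q' else q' + 1)"
    if "w = 12 * q' + s + 2 * int l" "0 \<le> s" "s < 12" "l \<le> r" for l q' s
    unfolding d_def by (rule form_count_eq) (use that assms(3) in auto)
  have sum: "int (\<Sum>l\<le>r. form_count (w - 2 * int l)) = (\<Sum>l\<le>r. d l)"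
    by (simp add: d_def)
  from assms(1) consider "r = 0" | "r = 1" | "r = 2" | "r = 3" | "r = 4" by linarith
  hence "(int r + 1) * w + 12 \<le> 12 * (\<Sum>l\<le>r. d l)"
  proof cases
    case 1
    hence "w = 12 * q" using assms(4) by (simp add: q_def)
    thus ?thesis using d[of q 0 0] 1 by simp
  next
    case 2
    hence "w = 12 * q \<or> w = 12 * q + 6" using assms(4) unfolding q_def by simp presburger
    thus ?thesis
      using d[of q 0 0] d[of "q - 1" 10 1] d[of q 6 0] d[of q 4 1] 2 by auto
  next
    case 3
    have *: "(\<Sum>l\<le>2. d l) = d 0 + d 1 + d 2" by (simp add: numeral_2_eq_2)
    from 3 have "w = 12 * q \<or> w = 12 * q + 4 \<or> w = 12 * q + 8" using assms(4) unfolding q_def by simp presburger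
    thus ?thesis unfolding 3 *
      using d[of q 0 0] d[of "q - 1" 10 1] d[of "q - 1" 8 2] d[of q 4 0] d[of q 2 1] d[of q 0 2]
        d[of q 8 0] d[of q 6 1] d[of q 4 2] 3 by auto
  next
    case 4
    have *: "(\<Sum>l\<le>3. d l) = d 0 + d 1 + d 2 + d 3" by (simp add: eval_nat_numeral)
    from 4 have "w = 12 * q \<or> w = 12 * q + 6" using assms(2,4) unfolding q_def by simp presburger
    thus ?thesis unfolding 4 *
      using d[of q 0 0] d[of "q - 1" 10 1] d[of "q - 1" 8 2] d[of "q - 1" 6 3]
        d[of q 6 0] d[of q 4 1] d[of q 2 2] d[of q 0 3] 4 by auto
  next
    case 5
    have *: "(\<Sum>l\<le>4. d l) = d 0 + d 1 + d 2 + d 3 + d 4" by (simp add: eval_nat_numeral)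
    from 5 have "w = 12 * q" using assms(4) unfolding q_def by simp presburger
    thus ?thesis unfolding 5 *
      using d[of q 0 0] d[of "q - 1" 10 1] d[of "q - 1" 8 2] d[of "q - 1" 6 3] d[of "q - 1" 4 4] 5 by auto
  qed
  thus ?thesis unfolding sum .
qed

subsection \<open>Products of linear factors\<close>

definition linear_product :: "(nat \<Rightarrow> 'a :: comm_ring_1) \<Rightarrow> nat \<Rightarrow> 'a poly" where
  "linear_product \<gamma> n = (\<Prod>j<n. [:- \<gamma> j, 1:])"

lemma linear_product_0 [simp]: "linear_product \<gamma> 0 = 1"
  by (simp add: linear_product_def)

lemma linear_product_Suc: "linear_product \<gamma> (Suc n) = [:- \<gamma> n, 1:] * linear_product \<gamma> n"
  by (simp add: linear_product_def mult.commute)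

lemma coeff_linear_factor_mult:
  fixes c :: "'a :: comm_ring_1"
  shows "coeff ([:- c, 1:] * p) i = (if i = 0 then 0 else coeff p (i - 1)) - c * coeff p i"
  by (cases i) (simp_all add: algebra_simps)

lemma coeff_linear_product:
  "i > n \<Longrightarrow> coeff (linear_product \<gamma> n) i = 0" "coeff (linear_product \<gamma> n) n = 1"
  by (induction n arbitrary: i) (auto simp: linear_product_Suc coeff_linear_factor_mult simp del: mult_pCons_left)

lemma coeff_linear_product_subleading:
  "coeff (linear_product \<gamma> (Suc n)) n = - (\<Sum>j\<le>n. \<gamma> j)"
proof (induction n)
  case (Suc n)
  have "coeff (linear_product \<gamma> (Suc (Suc n))) (Suc n) =
      coeff (linear_product \<gamma> (Suc n)) n - \<gamma> (Suc n) * coeff (linear_product \<gamma> (Suc n)) (Suc n)"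
    by (subst linear_product_Suc, subst coeff_linear_factor_mult) simp
  thus ?case using Suc by (simp add: coeff_linear_product(2))
qed (simp add: linear_product_Suc)

text \<open>The products are monic, one in each degree, so the top coefficient can be removed
  repeatedly. This basis is chosen because the iterated Serre derivatives have such products as
  indicial polynomials.\<close>

lemma newton_expansion:
  assumes "\<And>i. i \<ge> m \<Longrightarrow> coeff Q i = 0"
  shows "\<exists>b. Q = (\<Sum>j<m. Polynomial.smult (b j) (linear_product \<gamma> j))"
  using assms
proof (induction m arbitrary: Q)
  case 0
  hence "Q = 0" by (intro poly_eqI) simp
  thus ?case by simp
next
  case (Suc m)
  define R where "R = Q - Polynomial.smult (coeff Q m) (linear_product \<gamma> m)"
  have "coeff R i = 0" if "i \<ge> m" for i
    using that Suc.prems[of i]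
    by (cases "i = m") (auto simp: R_def coeff_linear_product)
  from Suc.IH[OF this] obtain b where b: "R = (\<Sum>j<m. Polynomial.smult (b j) (linear_product \<gamma> j))" by blast
  have "Q = (\<Sum>j<Suc m. Polynomial.smult ((b(m := coeff Q m)) j) (linear_product \<gamma> j))"
    using b by (simp add: R_def algebra_simps)
  thus ?case by blast
qed

subsection \<open>The indicial operator\<close>

text \<open>At the cusp, \<open>\<nabla>\<close> acts on the vector of leading coefficients of a family by a lower triangular matrix
  with diagonal \<open>lam\<close>, minus a scalar.\<close>

definition indicial :: "nat \<Rightarrow> (nat \<Rightarrow> nat) \<Rightarrow> (nat \<Rightarrow> complex) \<Rightarrow> nat \<Rightarrow> complex" where
  "indicial r lam v l = of_nat (lam l) * v l +
     (if l = 0 then 0 else of_nat (r + 1 - l) / (\<tau>) * 0 ^ (lam (l - 1) - lam l) * v (l - 1))"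

lemma indicial_sum: "indicial r lam (\<lambda>l. \<Sum>i\<in>I. c i * F i l) l = (\<Sum>i\<in>I. c i * indicial r lam (F i) l)"
  by (cases "l = 0") (simp_all add: indicial_def sum_distrib_left sum_divide_distrib sum.distrib algebra_simps)

text \<open>The value of the polynomial at the operator \<open>indicial\<close>. The coefficients
  are rational because those of the differential equation must be.\<close>

definition indicial_poly :: "nat \<Rightarrow> (nat \<Rightarrow> nat) \<Rightarrow> rat poly \<Rightarrow> (nat \<Rightarrow> complex) \<Rightarrow> nat \<Rightarrow> complex" where
  "indicial_poly r lam p v l = (\<Sum>i\<le>degree p. of_rat (coeff p i) * (indicial r lam ^^ i) v l)"

lemma indicial_poly_altdef:
  assumes "degree p \<le> N"
  shows "indicial_poly r lam p v l = (\<Sum>i\<le>N. of_rat (coeff p i) * (indicial r lam ^^ i) v l)"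
  unfolding indicial_poly_def
  by (rule sum.mono_neutral_left) (use assms in \<open>auto simp: coeff_eq_0\<close>)

lemma indicial_poly_1: "indicial_poly r lam 1 v l = v l"
  by (simp add: indicial_poly_def)

lemma indicial_poly_add:
  "indicial_poly r lam (p + q) v l = indicial_poly r lam p v l + indicial_poly r lam q v l"
proof -
  define N where "N = max (degree p) (degree q)"
  have "degree p \<le> N" "degree q \<le> N" "degree (p + q) \<le> N"
    by (auto simp: N_def degree_add_le)
  thus ?thesis
    by (simp add: indicial_poly_altdef[where N = N] of_rat_add sum.distrib [symmetric] algebra_simps)
qed

lemma indicial_poly_smult:
  "indicial_poly r lam (Polynomial.smult c p) v l = of_rat c * indicial_poly r lam p v l"
  by (simp add: indicial_poly_altdef[where N = "degree p"] degree_smult_le of_rat_mult sum_distrib_left mult_ac)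

lemma indicial_poly_0: "indicial_poly r lam 0 v l = 0"
  by (simp add: indicial_poly_def)

lemma indicial_poly_sum:
  "indicial_poly r lam (\<Sum>i\<in>I. p i) v l = (\<Sum>i\<in>I. indicial_poly r lam (p i) v l)"
  by (induction I rule: infinite_finite_induct) (simp_all add: indicial_poly_0 indicial_poly_add)

lemma indicial_poly_linear_factor:
  "indicial_poly r lam ([:- c, 1:] * p) v l =
     indicial r lam (indicial_poly r lam p v) l - of_rat c * indicial_poly r lam p v l"
proof -
let ?B = "\<Sum>i\<le>Suc (degree p). of_rat c * (of_rat (coeff p i) * (indicial r lam ^^ i) v l)"
let ?A = "\<Sum>i\<le>Suc (degree p). of_rat (if i = 0 then 0 else coeff p (i - 1)) * (indicial r lam ^^ i) v l"
  have deg: "degree ([:- c, 1:] * p) \<le> Suc (degree p)"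
    by (rule order_trans[OF degree_mult_le]) simp
  have "indicial_poly r lam ([:- c, 1:] * p) v l =
      ?A -
      ?B"
    unfolding indicial_poly_altdef[OF deg] coeff_linear_factor_mult sum_subtractf [symmetric]
    by (intro sum.cong refl) (simp only: of_rat_diff of_rat_mult left_diff_distrib mult.assoc)
  also have "?A =
      (\<Sum>i\<le>degree p. of_rat (coeff p i) * indicial r lam ((indicial r lam ^^ i) v) l)"
    by (subst sum.atMost_Suc_shift) simp
  also have "\<dots> = indicial r lam (indicial_poly r lam p v) l"
    unfolding indicial_poly_def[abs_def] by (rule indicial_sum [symmetric])
  also have "?B =
      of_rat c * indicial_poly r lam p v l"
    using indicial_poly_altdef[of p "Suc (degree p)" r lam v l] by (simp only: sum_distrib_left)
  finally show ?thesis .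
qed

text \<open>Cayley-Hamilton for a triangular matrix: the factor for \<open>lam n\<close> kills
  component n once component n - 1, which feeds into it, is 0. Equal consecutive \<open>lam\<close>
  make this coupling nonzero, since 0 ^ 0 = 1.\<close>

lemma indicial_annihilates:
  assumes "l < n"
  shows "indicial_poly r lam (linear_product (\<lambda>j. of_nat (lam j)) n) v l = 0"
  using assms
proof (induction n arbitrary: l)
  case (Suc n)
  define P where "P = indicial_poly r lam (linear_product (\<lambda>j. of_nat (lam j)) n) v"
  have "P j = 0" if "j < n" for j using Suc.IH[OF that] by (simp add: P_def)
  hence "indicial r lam P l - of_nat (lam n) * P l = 0"
    using Suc.prems by (cases "l = n") (auto simp: indicial_def)
  thus ?case
    unfolding linear_product_Suc indicial_poly_linear_factor P_def by simp
qed simp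

text \<open>At q = 0 the term with the factor q vanishes and E_2 is 1, so each step applies
  \<open>indicial\<close> minus a twelfth of the current weight.\<close>

lemma disc_nabla_iter_leading:
  "disc_nabla_iter r lam k i b l 0 =
     indicial_poly r lam (linear_product (\<lambda>j. (of_int k + 2 * of_nat j) / 12) i) (\<lambda>l. b l 0) l"
proof (induction i arbitrary: l)
  case 0
  thus ?case by (simp add: indicial_poly_1)
next
  case (Suc i)
  have "of_rat ((of_int k + 2 * of_nat i) / 12) = (of_int (k + 2 * int i) / 12 :: complex)"
    by (simp add: of_rat_divide of_rat_add of_rat_mult)
  thus ?case
    unfolding linear_product_Suc indicial_poly_linear_factor Suc.IH [symmetric, abs_def]
    by (simp add: disc_nabla_def indicial_def)
qed

subsection \<open>The family of companions\<close>

text \<open>The binomial theorem for the power p - l, followed by (p choose l) (p - l choose j - l)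
  = (p choose j) (j choose l).\<close>

lemma binomial_double_expansion:
  fixes x E :: complex
  assumes "p \<le> r" "l \<le> r"
  shows "of_nat (p choose l) * (E + x) ^ (p - l) =
     (\<Sum>j\<le>r. of_nat (j choose l) * x ^ (j - l) * (of_nat (p choose j) * E ^ (p - j)))"
proof (cases "l \<le> p")
  case True
  have "of_nat (p choose l) * (E + x) ^ (p - l) =
      (\<Sum>s\<le>p - l. of_nat (p choose l) * (of_nat ((p - l) choose s) * x ^ s * E ^ (p - l - s)))"
    by (simp add: add.commute[of E] binomial_ring sum_distrib_left)
  also have "\<dots> = (\<Sum>j\<in>{l..p}. of_nat (p choose l) * (of_nat ((p - l) choose (j - l)) * x ^ (j - l) * E ^ (p - j)))"
    by (rule sum.reindex_bij_witness[of _ "\<lambda>j. j - l" "\<lambda>s. s + l"]) (use True in \<open>auto simp: add.commute\<close>)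
  also have "\<dots> = (\<Sum>j\<in>{l..p}. of_nat (j choose l) * x ^ (j - l) * (of_nat (p choose j) * E ^ (p - j)))"
  proof (intro sum.cong refl)
    fix j assume "j \<in> {l..p}"
    hence "(p choose j) * (j choose l) = (p choose l) * ((p - l) choose (j - l))"
      by (intro choose_mult) auto
    hence "of_nat (p choose j) * of_nat (j choose l) = (of_nat (p choose l) * of_nat ((p - l) choose (j - l)) :: complex)"
      by (simp only: of_nat_mult [symmetric])
    thus "of_nat (p choose l) * (of_nat ((p - l) choose (j - l)) * x ^ (j - l) * E ^ (p - j)) =
        of_nat (j choose l) * x ^ (j - l) * (of_nat (p choose j) * E ^ (p - j))"
      by (simp add: mult_ac)
  qed
  also have "\<dots> = (\<Sum>j\<le>r. of_nat (j choose l) * x ^ (j - l) * (of_nat (p choose j) * E ^ (p - j)))"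
    by (rule sum.mono_neutral_left) (use assms in \<open>auto simp: binomial_eq_0 not_le\<close>)
  finally show ?thesis .
next
  case False
  have "of_nat (j choose l) * x ^ (j - l) * (of_nat (p choose j) * E ^ (p - j)) = 0" for j
    using False by (cases "j < l") (auto simp: binomial_eq_0)
  hence "(\<Sum>j\<le>r. of_nat (j choose l) * x ^ (j - l) * (of_nat (p choose j) * E ^ (p - j))) = 0"
    by (intro sum.neutral ballI)
  thus ?thesis using False by (simp add: binomial_eq_0)
qed

text \<open>Up to the constant power, the right side is the l-th Taylor coefficient at E_2 of the
  polynomial with coefficients \<open>h\<close>.\<close>

lemma companion_eq:
  assumes "l \<le> r"
  shows "of_nat (r choose l) * companion r h l z =
     (6 / (of_real pi * \<i>)) ^ l * (\<Sum>p\<le>r. of_nat (p choose l) * eisenstein 2 z ^ (p - l) * h p z)"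
proof -
  have sym: "(l + m) choose m = (l + m) choose l" for m
    using binomial_symmetric[of m "l + m"] by simp
  have "(\<Sum>m\<le>r - l. of_nat ((l + m) choose m) * eisenstein 2 z ^ m * h (l + m) z) =
      (\<Sum>p\<in>{l..r}. of_nat (p choose l) * eisenstein 2 z ^ (p - l) * h p z)"
    unfolding sym by (rule sum.reindex_bij_witness[of _ "\<lambda>p. p - l" "\<lambda>m. l + m"]) (use assms in auto)
  also have "\<dots> = (\<Sum>p\<le>r. of_nat (p choose l) * eisenstein 2 z ^ (p - l) * h p z)"
    by (rule sum.mono_neutral_left) (auto simp: binomial_eq_0 not_le)
  finally show ?thesis
    using assms by (simp add: companion_def)
qed

text \<open>Up to z^2, inversion replaces E_2 by E_2 + \<open>\<kappa>\<close> / z, a translation of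
  the polynomial variable, under which Taylor coefficients mix binomially. The factor
  \<open>\<kappa> ^ l\<close> in the companions absorbs the powers of \<open>\<kappa>\<close>, and
  splitting off z^(w - r) makes the remaining exponent symmetric in l and j.\<close>

lemma companion_sym_form:
  assumes H: "\<And>l. l \<le> r \<Longrightarrow> disc_form (w - 2 * int l) (H l)"
    and h: "\<And>l z. l \<le> r \<Longrightarrow> Im z > 0 \<Longrightarrow> h l z = H l (qpar z)"
  shows "sym_form r (w - int r) (\<lambda>l z. of_nat (r choose l) * companion r h l z)"
  unfolding sym_form_def
proof (intro conjI allI impI)
  fix l assume l: "l \<le> r"
  define \<kappa> where "\<kappa> = 6 / (of_real pi * \<i>)"
  have hhol: "h p holomorphic_on upper_half" if "p \<le> r" for p
  proof -
    have "(\<lambda>z. H p (qpar z)) holomorphic_on upper_half"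
      by (intro holomorphic_compose_qpar disc_form_holomorphic[OF H[OF that]])
    thus ?thesis by (rule holomorphic_transform) (use h[OF that] in auto)
  qed
  show "(\<lambda>z. of_nat (r choose l) * companion r h l z) holomorphic_on upper_half"
    unfolding companion_eq[OF l] by (intro holomorphic_intros holomorphic_eisenstein hhol) auto
  fix z assume z: "Im z > 0"
  have z0: "z \<noteq> 0" using z by auto
  define E where "E = eisenstein 2 z"
  have ES: "eisenstein 2 (-1/z) = z\<^sup>2 * (E + \<kappa> / z)"
    unfolding E_def eisenstein_eq_eis eis_2_inversion[OF z] \<kappa>_def [symmetric] using z0
    by (simp add: distrib_left power2_eq_square)
  have hS: "h p (-1/z) = z powi (w - 2 * int p) * h p z" if "p \<le> r" for p
    using h[OF that z] h[OF that Im_minus_inverse_pos[OF z]] disc_form_inversion[OF H[OF that] z] by simp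
  have "of_nat (r choose l) * companion r h l (-1/z) =
      \<kappa> ^ l * (\<Sum>p\<le>r. z powi (w - 2 * int l) * (of_nat (p choose l) * (E + \<kappa> / z) ^ (p - l) * h p z))"
    unfolding companion_eq[OF l] \<kappa>_def [symmetric]
  proof (rule arg_cong[of _ _ "(*) (\<kappa> ^ l)"], rule sum.cong[OF refl])
    fix p assume p: "p \<in> {..r}"
    show "of_nat (p choose l) * eisenstein 2 (-1/z) ^ (p - l) * h p (-1/z) =
        z powi (w - 2 * int l) * (of_nat (p choose l) * (E + \<kappa> / z) ^ (p - l) * h p z)"
    proof (cases "l \<le> p")
      case True
      have "(z\<^sup>2) ^ (p - l) * z powi (w - 2 * int p) = z powi (2 * int (p - l)) * z powi (w - 2 * int p)"
        by (simp add: power_int_mult)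
      also have "\<dots> = z powi (2 * int (p - l) + (w - 2 * int p))"
        using z0 by (intro power_int_add [symmetric]) auto
      also have "2 * int (p - l) + (w - 2 * int p) = w - 2 * int l" using True by (simp add: of_nat_diff)
      finally have "(z\<^sup>2) ^ (p - l) * z powi (w - 2 * int p) = z powi (w - 2 * int l)" .
      moreover have "of_nat (p choose l) * eisenstein 2 (-1/z) ^ (p - l) * h p (-1/z) =
        ((z\<^sup>2) ^ (p - l) * z powi (w - 2 * int p)) * (of_nat (p choose l) * (E + \<kappa> / z) ^ (p - l) * h p z)"
        using p by (subst hS) (simp, simp only: ES power_mult_distrib mult_ac)
      ultimately show ?thesis by (simp only:)
    qed (simp add: binomial_eq_0)
  qed
  also have "\<dots> = (\<Sum>p\<le>r. \<Sum>j\<le>r. \<kappa> ^ l * z powi (w - 2 * int l) *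
       (of_nat (j choose l) * (\<kappa> / z) ^ (j - l) * (of_nat (p choose j) * E ^ (p - j))) * h p z)"
    unfolding sum_distrib_left
    by (intro sum.cong refl) (simp add: binomial_double_expansion[OF _ l] sum_distrib_left sum_distrib_right mult_ac)
  also have "\<dots> = (\<Sum>j\<le>r. \<Sum>p\<le>r. \<kappa> ^ l * z powi (w - 2 * int l) *
       (of_nat (j choose l) * (\<kappa> / z) ^ (j - l) * (of_nat (p choose j) * E ^ (p - j))) * h p z)"
    by (rule sum.swap)
  also have "\<dots> = (\<Sum>j\<le>r. z powi (w - int r) * (of_nat (j choose l) * z powi (int r - int l - int j) *
       (of_nat (r choose j) * companion r h j z)))"
  proof (intro sum.cong refl)
    fix j assume j: "j \<in> {..r}"
    have "(\<Sum>p\<le>r. \<kappa> ^ l * z powi (w - 2 * int l) *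
       (of_nat (j choose l) * (\<kappa> / z) ^ (j - l) * (of_nat (p choose j) * E ^ (p - j))) * h p z) =
       of_nat (j choose l) * (\<kappa> ^ l * (\<kappa> / z) ^ (j - l) * z powi (w - 2 * int l)) * (\<Sum>p\<le>r. of_nat (p choose j) * E ^ (p - j) * h p z)"
      unfolding sum_distrib_left by (intro sum.cong refl) (simp add: mult_ac)
    also have "\<dots> = of_nat (j choose l) * (z powi (w - int r) * z powi (int r - int l - int j) * \<kappa> ^ j) *
        (\<Sum>p\<le>r. of_nat (p choose j) * E ^ (p - j) * h p z)"
    proof (cases "l \<le> j")
      case True
      have "z powi (w - 2 * int l) = z powi ((w - int r) + (int r - int l - int j) + int (j - l))"
        using True by (intro arg_cong[of _ _ "power_int z"]) simp
      also have "\<dots> = z powi (w - int r) * z powi (int r - int l - int j) * z ^ (j - l)"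
        using z0 by (simp only: power_int_add simp_thms power_int_of_nat)
      finally have "(\<kappa> / z) ^ (j - l) * z powi (w - 2 * int l) =
          z powi (w - int r) * z powi (int r - int l - int j) * \<kappa> ^ (j - l)"
        using z0 by (simp add: power_divide)
      moreover have "\<kappa> ^ j = \<kappa> ^ l * \<kappa> ^ (j - l)" using True by (simp flip: power_add)
      ultimately show ?thesis by (simp add: mult.assoc)
    qed (simp add: binomial_eq_0)
    also have "\<dots> = z powi (w - int r) * (of_nat (j choose l) * z powi (int r - int l - int j) *
       (of_nat (r choose j) * companion r h j z))"
      using j by (subst companion_eq) (auto simp: \<kappa>_def E_def mult_ac)
    finally show "(\<Sum>p\<le>r. \<kappa> ^ l * z powi (w - 2 * int l) *
       (of_nat (j choose l) * (\<kappa> / z) ^ (j - l) * (of_nat (p choose j) * E ^ (p - j))) * h p z) =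
       z powi (w - int r) * (of_nat (j choose l) * z powi (int r - int l - int j) *
       (of_nat (r choose j) * companion r h j z))" .
  qed
  finally show "of_nat (r choose l) * companion r h l (-1/z) =
     z powi (w - int r) * (\<Sum>j\<le>r. of_nat (j choose l) * z powi (int r - int l - int j) *
       (of_nat (r choose j) * companion r h j z))"
    by (simp only: sum_distrib_left)
qed

subsection \<open>The differential equation\<close>

text \<open>Both products are monic with equal sums of roots, so their difference has degree below
  r. Its expansion starts with the product of r - 1 = r + 1 - 2 factors, which is why the sum begins
  at l = 2.\<close>

lemma indicial_coefficients:
  fixes \<alpha> :: "nat \<Rightarrow> rat"
  assumes "(\<Sum>j\<le>r. \<alpha> j) = (\<Sum>j\<le>r. of_nat (lam j))"
  obtains a :: "nat \<Rightarrow> rat" where "linear_product (\<lambda>j. of_nat (lam j)) (r + 1) =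
    linear_product \<alpha> (r + 1) + (\<Sum>l = 2..r + 1. Polynomial.smult (a (2 * l)) (linear_product \<alpha> (r + 1 - l)))"
proof -
  define Q where "Q = linear_product (\<lambda>j. of_nat (lam j)) (r + 1) - linear_product \<alpha> (r + 1)"
  have "coeff Q i = 0" if i: "i \<ge> r" for i
  proof -
    consider "i = r" | "i = r + 1" | "i > r + 1" using i by linarith
    thus ?thesis
    proof cases
      case 1
      thus ?thesis using assms by (simp add: Q_def coeff_linear_product_subleading)
    next
      case 2
      thus ?thesis unfolding Q_def 2 coeff_diff coeff_linear_product(2) by simp
    next
      case 3
      thus ?thesis by (simp add: Q_def coeff_linear_product(1))
    qed
  qed
  from newton_expansion[OF this] obtain b where b: "Q = (\<Sum>j<r. Polynomial.smult (b j) (linear_product \<alpha> j))"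
    by blast
  \<comment> \<open>Indexing by weight: \<open>a (2 * l)\<close> belongs to the product with r + 1 -
    l factors.\<close>
  define a where "a = (\<lambda>m. b (r + 1 - m div 2))"
  have "(\<Sum>j<r. Polynomial.smult (b j) (linear_product \<alpha> j)) =
      (\<Sum>l = 2..r + 1. Polynomial.smult (a (2 * l)) (linear_product \<alpha> (r + 1 - l)))"
    by (rule sum.reindex_bij_witness[of _ "\<lambda>l. r + 1 - l" "\<lambda>j. r + 1 - j"]) (auto simp: a_def)
  with b have "linear_product (\<lambda>j. of_nat (lam j)) (r + 1) =
    linear_product \<alpha> (r + 1) + (\<Sum>l = 2..r + 1. Polynomial.smult (a (2 * l)) (linear_product \<alpha> (r + 1 - l)))"
    unfolding Q_def by (simp add: algebra_simps)
  thus ?thesis by (rule that)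
qed

lemma modular_differential_equation:
  assumes r: "r \<le> 4" and B: "sym_form r k B" and b: "disc_family r lam b B"
    and lam: "\<And>l. l < r \<Longrightarrow> lam (Suc l) \<le> lam l"
    and order: "(int r + 1) * (k + int r) = 12 * int (\<Sum>l\<le>r. lam l)"
  shows "\<exists>a :: nat \<Rightarrow> rat. \<forall>z\<in>upper_half. serre_iter k (r + 1) (B 0) z +
    (\<Sum>l = 2..r + 1. of_rat (a (2 * l)) * eisenstein (2 * l) z * serre_iter k (r + 1 - l) (B 0) z) = 0"
proof -
  \<comment> \<open>The shifts of the successive Serre derivatives, which act in weights k + 2 j;
    their sum over j <= r is (r + 1) (k + r) / 12, the total order.\<close>
  define \<alpha> where "\<alpha> = (\<lambda>j. (of_int k + 2 * of_nat j) / 12 :: rat)"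
  have "12 * (\<Sum>j\<le>r. \<alpha> j) = (of_nat r + 1) * (of_int k + of_nat r)"
  proof (induction r)
    case (Suc r)
    thus ?case by (simp add: \<alpha>_def algebra_simps)
  qed (simp add: \<alpha>_def)
  also have "\<dots> = of_int ((int r + 1) * (k + int r))" by simp
  also have "\<dots> = 12 * (\<Sum>j\<le>r. of_nat (lam j))" unfolding order by simp
  finally have "(\<Sum>j\<le>r. \<alpha> j) = (\<Sum>j\<le>r. of_nat (lam j))" by simp
  then obtain a :: "nat \<Rightarrow> rat" where a: "linear_product (\<lambda>j. of_nat (lam j)) (r + 1) =
    linear_product \<alpha> (r + 1) + (\<Sum>l = 2..r + 1. Polynomial.smult (a (2 * l)) (linear_product \<alpha> (r + 1 - l)))"
    by (rule indicial_coefficients)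
  define N where "N = r + 1"
  note a = a[folded N_def]
  define L where "L = (\<lambda>l z. nabla_iter r k N B l z +
    (\<Sum>m = 2..N. of_rat (a (2 * m)) * (eis (2 * m) (qpar z) * nabla_iter r k (N - m) B l z)))"
  define d where "d = (\<lambda>l q. disc_nabla_iter r lam k N b l q +
    (\<Sum>m = 2..N. of_rat (a (2 * m)) * (eis (2 * m) q * disc_nabla_iter r lam k (N - m) b l q)))"
  have L: "sym_form r (k + 2 * int N) L"
    unfolding L_def
  proof (intro sym_form_add sym_form_sum sym_form_cmult nabla_iter_sym_form B)
    fix m assume m: "m \<in> {2..N}"
    hence "2 * m \<in> {4, 6, 8, 10}" using r by (auto simp: N_def)
    from sym_form_mult[OF disc_form_eis[OF this] nabla_iter_sym_form[OF B, of "N - m"]]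
    have "sym_form r (k + 2 * int (N - m) + int (2 * m)) (\<lambda>l z. eis (2 * m) (qpar z) * nabla_iter r k (N - m) B l z)" .
    also have "k + 2 * int (N - m) + int (2 * m) = k + 2 * int N"
      using m by (simp add: of_nat_diff)
    finally show "sym_form r (k + 2 * int N) (\<lambda>l z. eis (2 * m) (qpar z) * nabla_iter r k (N - m) B l z)" .
  qed
  have fam: "disc_family r lam (disc_nabla_iter r lam k i b) (nabla_iter r k i B)" for i
    by (rule disc_family_nabla_iter[OF b lam])
  have dhol: "d l holomorphic_on ball 0 1" if "l \<le> r" for l
    unfolding d_def using fam that by (intro holomorphic_intros holomorphic_eis) (auto simp: disc_family_def)
  have Ld: "L l z = qpar z ^ lam l * d l (qpar z)" if "l \<le> r" "Im z > 0" for l z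
  proof -
    have "nabla_iter r k i B l z = qpar z ^ lam l * disc_nabla_iter r lam k i b l (qpar z)" for i
      using fam that by (auto simp: disc_family_def)
    thus ?thesis unfolding L_def d_def by (simp add: distrib_left sum_distrib_left mult_ac)
  qed
  have d0: "d l 0 = 0" if l: "l \<le> r" for l
  proof -
    have lead: "disc_nabla_iter r lam k i b l 0 = indicial_poly r lam (linear_product \<alpha> i) (\<lambda>l. b l 0) l" for i
      unfolding \<alpha>_def by (rule disc_nabla_iter_leading)
    have "d l 0 = indicial_poly r lam (linear_product (\<lambda>j. of_nat (lam j)) N) (\<lambda>l. b l 0) l"
      unfolding d_def a indicial_poly_add indicial_poly_sum indicial_poly_smult lead by simp
    also have "\<dots> = 0" by (rule indicial_annihilates) (use l in \<open>simp add: N_def\<close>)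
    finally show ?thesis .
  qed
  have "\<forall>l. \<exists>e. l \<le> r \<longrightarrow> e holomorphic_on ball 0 1 \<and> (\<forall>q\<in>ball 0 1. d l q = q * e q)"
  proof
    fix l
    show "\<exists>e. l \<le> r \<longrightarrow> e holomorphic_on ball 0 1 \<and> (\<forall>q\<in>ball 0 1. d l q = q * e q)"
    proof (cases "l \<le> r")
      case True
      obtain e where "e holomorphic_on ball 0 1" "\<And>q. q \<in> ball 0 1 \<Longrightarrow> d l q = q * e q"
        by (rule holomorphic_divide_disc_variable[OF dhol[OF True] d0[OF True]]) (erule that, simp)
      thus ?thesis by blast
    qed simp
  qed
  from choice[OF this] obtain e where
    "\<forall>l. l \<le> r \<longrightarrow> e l holomorphic_on ball 0 1 \<and> (\<forall>q\<in>ball 0 1. d l q = q * e l q)" ..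
  hence e: "\<And>l. l \<le> r \<Longrightarrow> e l holomorphic_on ball 0 1"
    "\<And>l q. l \<le> r \<Longrightarrow> q \<in> ball 0 1 \<Longrightarrow> d l q = q * e l q"
    by simp_all
  have famL: "disc_family r (\<lambda>l. Suc (lam l)) e L"
    unfolding disc_family_def
  proof (intro allI impI conjI)
    fix l z assume l: "l \<le> r" and z: "Im z > 0"
    have "qpar z \<in> ball 0 1" using z by simp
    from e(2)[OF l this] Ld[OF l z] show "L l z = qpar z ^ Suc (lam l) * e l (qpar z)"
      by simp
  qed (use e in auto)
  \<comment> \<open>Raising the weight by 2 r + 2 adds (r + 1) (2 r + 2) on the left, raising r + 1
    orders by one adds 12 (r + 1) on the right.\<close>
  have ord: "(int r + 1) * (k + 2 * int N + int r) < 12 * int (\<Sum>l\<le>r. Suc (lam l))"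
  proof -
    have "(int r + 1) * (k + 2 * int N + int r) = (int r + 1) * (k + int r) + (int r + 1) * (2 * int r + 2)"
      by (simp add: N_def algebra_simps)
    moreover have "int (\<Sum>l\<le>r. Suc (lam l)) = int (\<Sum>l\<le>r. lam l) + (int r + 1)"
      by (simp add: sum.distrib sum_Suc)
    moreover have "(int r + 1) * (2 * int r + 2) < (int r + 1) * 12"
      using r by (intro mult_strict_left_mono) auto
    ultimately show ?thesis using order by (simp add: algebra_simps)
  qed
  have "L 0 z = 0" if "Im z > 0" for z
    by (rule sym_form_vanishing[OF L famL _ ord that]) (use lam in simp)
  thus ?thesis unfolding N_def [symmetric]
    by (intro exI[of _ a] ballI) (simp add: L_def nabla_iter_0 eisenstein_eq_eis mult.assoc)
qed

section \<open>Application to a balanced form\<close>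

lemma E2_decomposition_disc_forms:
  assumes "E2_decomposition w r h f"
  obtains H where "\<And>l. l \<le> r \<Longrightarrow> disc_form (w - 2 * int l) (H l)"
    "\<And>l z. l \<le> r \<Longrightarrow> Im z > 0 \<Longrightarrow> h l z = H l (qpar z)"
proof -
  have "\<exists>g. disc_form (w - 2 * int l) g \<and> (\<forall>z. Im z > 0 \<longrightarrow> h l z = g (qpar z))" if "l \<le> r" for l
  proof -
    have "h l \<in> modular_forms (w - 2 * int l)" using assms that by (auto simp: E2_decomposition_def)
    thus ?thesis by (metis modular_form_disc_form)
  qed
  thus ?thesis using that by metis
qed

lemma modular_form_nonzero_weight:
  assumes "f \<in> modular_forms k" "f \<noteq> 0"
  shows "even k" "k \<ge> 0"
proof -
  show "even k" using modular_form_odd_weight[OF assms(1)] assms(2) by blast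
  show "k \<ge> 0"
  proof (rule ccontr)
    assume k: "\<not> k \<ge> 0"
    obtain g where g: "disc_form k g" "\<And>z. Im z > 0 \<Longrightarrow> f z = g (qpar z)"
      using modular_form_disc_form[OF assms(1)] by blast
    have "f z = 0" for z
    proof (cases "Im z > 0")
      case True
      thus ?thesis using disc_form_negative_weight[OF g(1), of "qpar z"] g(2)[OF True] k by simp
    next
      case False
      thus ?thesis using assms(1) by (simp add: modular_forms_def)
    qed
    thus False using assms(2) by (auto simp: fun_eq_iff)
  qed
qed

theorem theorem4p8:
  fixes r :: nat and w :: int and f :: "complex \<Rightarrow> complex"
  assumes "r \<le> 4"
    and "[(int r + 1) * w = 0] (mod 12)"
    and "balanced w r f"
  shows "\<exists>a :: nat \<Rightarrow> rat. \<forall>z \<in> upper_half.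
    serre_iter (w - int r) (r + 1) f z +
    (\<Sum>l = 2..r + 1. of_rat (a (2 * l)) * eisenstein (2 * l) z *
       serre_iter (w - int r) (r + 1 - l) f z) = 0"
proof -
  obtain h lam where dec: "E2_decomposition w r h f" and hr: "h r \<noteq> 0"
    and lam: "\<And>l. l < r \<Longrightarrow> lam (Suc l) \<le> lam l"
    and dim: "\<forall>l\<le>r. lam l < cfun.dim (quasimodular_forms (w - 2 * int l) (r - l))"
    and ex: "\<forall>l\<le>r. \<exists>a :: nat \<Rightarrow> complex. a 0 \<noteq> 0 \<and>
             (\<forall>z \<in> upper_half. (\<lambda>n. a n * qpar z ^ (lam l + n)) sums companion r h l z)"
    and sum: "(\<Sum>l\<le>r. lam l) + 1 = cfun.dim (quasimodular_forms w r)"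
    using assms(3) unfolding balanced_def by blast
  from ex obtain a where a0: "\<And>l. l \<le> r \<Longrightarrow> a l 0 \<noteq> (0::complex)"
    and a: "\<And>l z. l \<le> r \<Longrightarrow> Im z > 0 \<Longrightarrow> (\<lambda>n. a l n * qpar z ^ (lam l + n)) sums companion r h l z"
    unfolding upper_half_iff Ball_def by metis
  obtain H where H: "\<And>l. l \<le> r \<Longrightarrow> disc_form (w - 2 * int l) (H l)"
    "\<And>l z. l \<le> r \<Longrightarrow> Im z > 0 \<Longrightarrow> h l z = H l (qpar z)"
    using E2_decomposition_disc_forms[OF dec] by blast
  define B where "B = (\<lambda>l z. of_nat (r choose l) * companion r h l z)"
  define b where "b = (\<lambda>l q. of_nat (r choose l) * (\<Sum>n. a l n * q ^ n))"
  have B: "sym_form r (w - int r) B"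
    unfolding B_def by (rule companion_sym_form[OF H])
  have b: "disc_family r lam b B"
    unfolding disc_family_def
  proof (intro allI impI conjI)
    fix l assume l: "l \<le> r"
    have s: "(\<lambda>n. a l n * qpar z ^ n) sums (companion r h l z / qpar z ^ lam l)" if "Im z > 0" for z
    proof -
      have "(\<lambda>n. a l n * qpar z ^ (lam l + n) / qpar z ^ lam l) sums (companion r h l z / qpar z ^ lam l)"
        by (intro sums_divide a l that)
      thus ?thesis by (simp add: power_add)
    qed
    have "(\<lambda>q. \<Sum>n. a l n * q ^ n) holomorphic_on ball 0 1"
      by (rule disc_power_series) (use s in \<open>auto simp: sums_iff\<close>)
    thus "b l holomorphic_on ball 0 1" unfolding b_def by (intro holomorphic_intros)
    fix z assume "Im z > 0"
    from s[OF this] show "B l z = qpar z ^ lam l * b l (qpar z)"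
      by (simp add: B_def b_def sums_iff)
  qed
  have fB: "f = B 0"
  proof
    fix z
    show "f z = B 0 z"
      using dec unfolding B_def by (subst companion_eq) (simp_all add: E2_decomposition_def)
  qed
  \<comment> \<open>The nonzero form \<open>h r\<close> can only exist in an even weight w - 2 r >=
    0.\<close>
  have wt: "even w" "2 * int r \<le> w"
  proof -
    have "h r \<in> modular_forms (w - 2 * int r)" using dec by (simp add: E2_decomposition_def)
    from modular_form_nonzero_weight[OF this hr] show "even w" "2 * int r \<le> w" by simp_all
  qed
  have "12 dvd (int r + 1) * w" using assms(2) by (simp add: cong_0_iff)
  from form_count_sum[OF assms(1) wt this]
  have "(int r + 1) * w + 12 \<le> 12 * int (\<Sum>l\<le>r. form_count (w - 2 * int l))" .
  \<comment> \<open>The dimension is positive because balancedness makes it the total order plus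
    1.\<close>
  also have "\<dots> \<le> 12 * int (cfun.dim (quasimodular_forms w r))"
    by (intro mult_left_mono of_nat_mono quasimodular_dim_ge wt) (use sum in auto)
  finally have ge: "(int r + 1) * w \<le> 12 * int (\<Sum>l\<le>r. lam l)"
    unfolding sum [symmetric] by simp
  \<comment> \<open>A larger total order would force \<open>B 0\<close> = 0, against the nonzero
    leading coefficient \<open>a 0 0\<close>.\<close>
  have le: "\<not> (int r + 1) * w < 12 * int (\<Sum>l\<le>r. lam l)"
  proof
    assume "(int r + 1) * w < 12 * int (\<Sum>l\<le>r. lam l)"
    hence "(int r + 1) * (w - int r + int r) < 12 * int (\<Sum>l\<le>r. lam l)" by simp
    note zero = sym_form_vanishing[OF B b lam this]
    have "b 0 0 = 0"
    proof (rule disc_punctured_zero)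
      show "b 0 holomorphic_on ball 0 1" using b by (simp add: disc_family_def)
      fix q :: complex assume "q \<in> ball 0 1 - {0}"
      hence q: "q \<noteq> 0" "norm q < 1" by auto
      obtain z where z: "Im z > 0" "qpar z = q" by (rule qpar_surj[OF q])
      have "B 0 z = qpar z ^ lam 0 * b 0 (qpar z)" using b z(1) by (simp add: disc_family_def)
      thus "b 0 q = 0" using zero[OF _ z(1)] z q by simp
    qed
    moreover have "b 0 0 = a 0 0" by (simp add: b_def powser_zero)
    ultimately show False using a0[of 0] by simp
  qed
  from ge le have "(int r + 1) * (w - int r + int r) = 12 * int (\<Sum>l\<le>r. lam l)" by simp
  from modular_differential_equation[OF assms(1) B b lam this] show ?thesis
    unfolding fB .
qed

end
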